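(* Let $n\ge3$, $0<s<1$, $\alpha:=2s$, let $\Omega\subset\mathbb{R}^n$ be open with $0\in\Omega$, let $V\in L^{n/(2s)}_{\mathrm{loc}}(\Omega;\mathbb{C})$ and $u\in H^s(\mathbb{R}^n;\mathbb{C})$ satisfy $(-\Delta)^su=Vu$ in $\Omega$ in the sense of distributions, and suppose $\int_{B_r}|u|^2\,dx=O(r^N)$ as $r\downarrow0$ for every $N>0$. Let $R>0$ be such that $B_{4R}\Subset\Omega$, let $\chi\in C_c^\infty(B_{3R})$ with $\chi\equiv1$ on $B_{2R}$, and set $$F:=\chi Vu,\qquad h:=u-I_\alpha F.$$ Let $\rho_0\in(0,R)$ and $H>0$ be such that, for every $m\ge1$, $$h=T_{m-1}h+h_m\quad\text{in }B_{\rho_0},\qquad |h_m(x)|\le H\rho_0^{-m}|x|^m\quad(|x|<\rho_0),$$ where $T_{m-1}h$ is the Taylor polynomial of $h$ at the origin of degree at most $m-1$. Then, for every integer $m\ge1$, $$u=R_mF+h_m\qquad\text{in }B_{\rho_0}$$ (almost everywhere).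
   Context: $B_r$ is the open ball of radius $r$ centered at the origin. $(-\Delta)^s$ is the fractional Laplacian (Fourier multiplier $|\xi|^{2s}$). $I_\alpha$ is the Riesz potential normalized by $\widehat{I_\alpha F}(\xi)=|\xi|^{-\alpha}\widehat F(\xi)$, i.e. $I_\alpha F(x)=c_{n,\alpha}\int_{\mathbb{R}^n}|x-y|^{\alpha-n}F(y)\,dy$ with $c_{n,\alpha}=\pi^{-n/2}2^{-\alpha}\Gamma((n-\alpha)/2)/\Gamma(\alpha/2)$. For compactly supported $F$ define, whenever the integrals converge absolutely, $$P_{m-1}^F(x):=c_{n,\alpha}\sum_{j=0}^{m-1}\frac1{j!}\int_{\mathbb{R}^n}\left.\partial_r^j|rx-y|^{\alpha-n}\right|_{r=0}F(y)\,dy,\qquad R_mF:=I_\alpha F-P_{m-1}^F.$$ For the $F$ in the claim, $P_{m-1}^F$ is well defined for all $m\ge1$ and is a polynomial in $x$ of degree at most $m-1$. The function $h$ satisfies $(-\Delta)^sh=0$ distributionally in $B_{2R}$ and is therefore (after modification on a null set) real analytic in $B_{2R}$, so its Taylor polynomials at the origin make sense, and numbers $\rho_0,H$ as in the claim exist. *)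

theory Defs
  imports "HOL-Analysis.Analysis" "HOL-Library.Landau_Symbols"
begin

text \<open>
  The space is \<open>real ^ 'n\<close>, so \<open>n = CARD('n)\<close>. Functions defined up to null sets are represented
  by arbitrary Lebesgue measurable representatives, and all integrals are Lebesgue integrals.
\<close>

subsection \<open>Derivatives, test functions, analyticity, Taylor polynomials\<close>

definition partial_deriv ::
    "'n::finite \<Rightarrow> (real ^ 'n \<Rightarrow> complex) \<Rightarrow> real ^ 'n \<Rightarrow> complex" where
  "partial_deriv i f x = vector_derivative (\<lambda>t. f (x + t *\<^sub>R axis i 1)) (at 0)"

definition iter_partial ::
    "'n::finite list \<Rightarrow> (real ^ 'n \<Rightarrow> complex) \<Rightarrow> real ^ 'n \<Rightarrow> complex" where
  "iter_partial is f = foldr partial_deriv is f"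

text \<open>
  Every iterated partial derivative is Frechet differentiable, hence continuous; this is
  equivalent to \<open>f\<close> being infinitely differentiable.
\<close>
definition smooth :: "(real ^ 'n::finite \<Rightarrow> complex) \<Rightarrow> bool" where
  "smooth f \<longleftrightarrow> (\<forall>is x. iter_partial is f differentiable (at x))"

definition test_function :: "(real ^ 'n::finite) set \<Rightarrow> (real ^ 'n \<Rightarrow> complex) \<Rightarrow> bool" where
  "test_function U f \<longleftrightarrow>
     smooth f \<and> compact (closure {x. f x \<noteq> 0}) \<and> closure {x. f x \<noteq> 0} \<subseteq> U"

definition schwartz :: "(real ^ 'n::finite \<Rightarrow> complex) \<Rightarrow> bool" where
  "schwartz f \<longleftrightarrow>
     smooth f \<and> (\<forall>k is. \<exists>C. \<forall>x. norm x ^ k * norm (iter_partial is f x) \<le> C)"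

text \<open>Multi-indices are functions \<open>'n \<Rightarrow> nat\<close>; \<open>has_sum\<close> is unconditional convergence.\<close>
definition real_analytic_on ::
    "(real ^ 'n::finite \<Rightarrow> complex) \<Rightarrow> (real ^ 'n) set \<Rightarrow> bool" where
  "real_analytic_on f U \<longleftrightarrow>
     (\<forall>a\<in>U. \<exists>r>0. \<exists>c :: ('n \<Rightarrow> nat) \<Rightarrow> complex. \<forall>x\<in>ball a r.
        ((\<lambda>\<beta>. c \<beta> * of_real (\<Prod>i\<in>UNIV. (x $ i - a $ i) ^ \<beta> i)) has_sum f x) UNIV)"

text \<open>
  Taylor polynomial at the origin of degree at most \<open>k\<close>. The sum over index lists of length
  \<open>j\<close> is \<open>D\<^sup>j f(0)[x, \<dots>, x]\<close>; dividing by \<open>j!\<close> gives the terms \<open>\<partial>\<^sup>\<beta> f(0) x\<^sup>\<beta> / \<beta>!\<close>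
  with \<open>|\<beta>| = j\<close>.
\<close>
definition taylor_poly ::
    "nat \<Rightarrow> (real ^ 'n::finite \<Rightarrow> complex) \<Rightarrow> real ^ 'n \<Rightarrow> complex" where
  "taylor_poly k f x =
     (\<Sum>j\<le>k. (1 / fact j) *
        (\<Sum>is\<in>{is. length is = j}. iter_partial is f 0 * of_real (\<Prod>i\<leftarrow>is. x $ i)))"

subsection \<open>Function spaces and the fractional Laplacian\<close>

definition square_integrable :: "(real ^ 'n::finite \<Rightarrow> complex) \<Rightarrow> bool" where
  "square_integrable u \<longleftrightarrow>
     u \<in> borel_measurable lebesgue \<and> integrable lebesgue (\<lambda>x. (norm (u x))\<^sup>2)"

definition Lp_loc :: "real \<Rightarrow> (real ^ 'n::finite) set \<Rightarrow> (real ^ 'n \<Rightarrow> complex) \<Rightarrow> bool" where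
  "Lp_loc p U V \<longleftrightarrow>
     V \<in> borel_measurable (lebesgue_on U) \<and>
     (\<forall>K. compact K \<and> K \<subseteq> U \<longrightarrow> integrable (lebesgue_on K) (\<lambda>x. norm (V x) powr p))"

text \<open>This normalization makes the symbol of \<open>-\<Delta>\<close> equal to \<open>|\<xi>|\<^sup>2\<close>.\<close>
definition fourier :: "(real ^ 'n::finite \<Rightarrow> complex) \<Rightarrow> real ^ 'n \<Rightarrow> complex" where
  "fourier f \<xi> = (LINT x|lebesgue. cis (- (x \<bullet> \<xi>)) * f x)"

definition inv_fourier :: "(real ^ 'n::finite \<Rightarrow> complex) \<Rightarrow> real ^ 'n \<Rightarrow> complex" where
  "inv_fourier g x =
     (LINT \<xi>|lebesgue. cis (x \<bullet> \<xi>) * g \<xi>) / of_real ((2 * pi) ^ CARD('n))"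

text \<open>
  \<open>u \<in> H\<^sup>s\<close> for \<open>s \<ge> 0\<close>: the Fourier transform of \<open>u\<close>, as a tempered distribution, is a
  function \<open>g\<close> with \<open>(1 + |\<xi>|\<^sup>2) powr (s/2) * g \<in> L\<^sup>2\<close>.
\<close>
definition sobolev_H :: "real \<Rightarrow> (real ^ 'n::finite \<Rightarrow> complex) \<Rightarrow> bool" where
  "sobolev_H s u \<longleftrightarrow>
     square_integrable u \<and>
     (\<exists>g. square_integrable g \<and>
          integrable lebesgue (\<lambda>\<xi>. (1 + (norm \<xi>)\<^sup>2) powr s * (norm (g \<xi>))\<^sup>2) \<and>
          (\<forall>\<phi>. schwartz \<phi> \<longrightarrow>
             (LINT \<xi>|lebesgue. g \<xi> * \<phi> \<xi>) = (LINT x|lebesgue. u x * fourier \<phi> x)))"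

definition frac_laplacian ::
    "real \<Rightarrow> (real ^ 'n::finite \<Rightarrow> complex) \<Rightarrow> real ^ 'n \<Rightarrow> complex" where
  "frac_laplacian s \<phi> = inv_fourier (\<lambda>\<xi>. of_real (norm \<xi> powr (2 * s)) * fourier \<phi> \<xi>)"

text \<open>
  \<open>(-\<Delta>)\<^sup>s u = f\<close> in \<open>U\<close> in the sense of distributions, with the bilinear pairing
  (the symbol is even, so no reflection appears in the transpose). Used for \<open>u \<in> L\<^sup>2\<close>.
\<close>
definition frac_laplacian_eq_on ::
    "real \<Rightarrow> (real ^ 'n::finite) set \<Rightarrow> (real ^ 'n \<Rightarrow> complex) \<Rightarrow> (real ^ 'n \<Rightarrow> complex) \<Rightarrow> bool" where
  "frac_laplacian_eq_on s U u f \<longleftrightarrow>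
     (\<forall>\<phi>. test_function U \<phi> \<longrightarrow>
        (LINT x|lebesgue. u x * frac_laplacian s \<phi> x) = (LINT x|lebesgue_on U. f x * \<phi> x))"

definition vanishes_infinite_order_L2 :: "(real ^ 'n::finite \<Rightarrow> complex) \<Rightarrow> bool" where
  "vanishes_infinite_order_L2 u \<longleftrightarrow>
     (\<forall>N>0. (\<lambda>r. LINT x|lebesgue_on (ball 0 r). (norm (u x))\<^sup>2) \<in> O[at_right 0](\<lambda>r. r powr N))"

subsection \<open>The Riesz potential and its Taylor remainder\<close>

definition riesz_const :: "nat \<Rightarrow> real \<Rightarrow> real" where
  "riesz_const n \<alpha> =
     pi powr (- real n / 2) * 2 powr (- \<alpha>) * Gamma ((real n - \<alpha>) / 2) / Gamma (\<alpha> / 2)"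

definition riesz_potential ::
    "real \<Rightarrow> (real ^ 'n::finite \<Rightarrow> complex) \<Rightarrow> real ^ 'n \<Rightarrow> complex" where
  "riesz_potential \<alpha> F x =
     riesz_const CARD('n) \<alpha> *\<^sub>R
       (LINT y|lebesgue. norm (x - y) powr (\<alpha> - real CARD('n)) *\<^sub>R F y)"

definition riesz_taylor ::
    "real \<Rightarrow> nat \<Rightarrow> (real ^ 'n::finite \<Rightarrow> complex) \<Rightarrow> real ^ 'n \<Rightarrow> complex" where
  "riesz_taylor \<alpha> k F x =
     riesz_const CARD('n) \<alpha> *\<^sub>R
       (\<Sum>j\<le>k. (1 / fact j) *\<^sub>R
          (LINT y|lebesgue.
             (deriv ^^ j) (\<lambda>r. norm (r *\<^sub>R x - y) powr (\<alpha> - real CARD('n))) 0 *\<^sub>R F y))"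

text \<open>Meant for \<open>m \<ge> 1\<close>.\<close>
definition riesz_remainder ::
    "real \<Rightarrow> nat \<Rightarrow> (real ^ 'n::finite \<Rightarrow> complex) \<Rightarrow> real ^ 'n \<Rightarrow> complex" where
  "riesz_remainder \<alpha> m F x = riesz_potential \<alpha> F x - riesz_taylor \<alpha> (m - 1) F x"

end

theory Submission
  imports Defs "HOL-Probability.Characteristic_Functions" "HOL-Real_Asymp.Real_Asymp"
begin

text \<open>
  Write \<open>Q = T\<^sub>m\<^sub>-\<^sub>1 h + P\<^sub>m\<^sub>-\<^sub>1\<^sup>F\<close>, so that \<open>u = Q + R\<^sub>m F + h\<^sub>m\<close> almost everywhere near the origin. \<open>Q\<close> is a sum
  of homogeneous functions of degrees \<open>0, \<dots>, m - 1\<close>, hence it vanishes as soon as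
  \<open>\<integral>\<^bsub>|x|<r\<^esub> |Q| = O(r\<^bsup>n+m\<^esup>)\<close>. For \<open>u\<close> and \<open>h\<^sub>m\<close> this bound is clear. For \<open>R\<^sub>m F\<close> the Taylor remainder of
  the Riesz kernel gives \<open>O(|x|\<^sup>m)\<close> away from the diagonal, and the near field is controlled by the mass
  of \<open>F\<close> on small balls, which must therefore be \<open>O(r\<^sup>N)\<close> for every \<open>N\<close>.

  Since \<open>V\<close> is only locally in \<open>L\<^sup>p\<close> with \<open>p = n/(2s)\<close>, possibly less than \<open>2\<close>, the latter needs \<open>u\<close> in \<open>L\<^sup>b\<close> for
  some \<open>b\<close> above the dual exponent \<open>n/(n - 2s)\<close>. Splitting the Fourier transform of \<open>u\<close> at a
  frequency \<open>\<mu>\<close> crudely yields a weak type estimate with exponent \<open>2 + 4s/n\<close>; this falls short of the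
  Sobolev exponent but suffices, because \<open>8 s\<^sup>2 < 9 \<le> n\<^sup>2\<close>.
\<close>

subsection \<open>Gaussians\<close>

text \<open>The hypothesis \<open>sobolev_H\<close> gives the Fourier transform \<open>g\<close> of
  \<open>u\<close> only through its pairing with Schwartz functions. Modulated Gaussians suffice to
  exploit it: their transforms are bumps of shrinking width, so averaging them recovers the integral
  of \<open>u\<close> against any continuous, rapidly decaying weight in terms of \<open>g\<close>.
  With weights approximating the indicator of a compact subset of a superlevel set this becomes, by
  duality, a bound on the measure of that set; the frequency cut-off is tuned so that the terms
  proportional to the measure are absorbed on the left. The decay of the mass of \<open>F\<close> is
  used twice. The radial derivatives of order j of the Riesz kernel are singular like
  |y|^(\<alpha>-n-j) at the origin, for large j far beyond local integrability, and their integrals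
  against \<open>F\<close> converge only because all negative moments of \<open>F\<close> are
  finite. The same decay makes the near field small. The function Q is estimated in the mean and not
  pointwise because \<open>u\<close> and the near field are under control only in the mean.\<close>

definition gauss :: "'a::euclidean_space \<Rightarrow> real" where
  "gauss x = exp (- (norm x)\<^sup>2 / 2)"

lemma gauss_pos [simp]: "0 < gauss x"
  by (simp add: gauss_def)

lemma gauss_nonneg [simp]: "0 \<le> gauss x"
  by (simp add: gauss_def)

lemma gauss_neq_0 [simp]: "gauss x \<noteq> 0"
  by (simp add: gauss_def)

lemma gauss_le_1 [simp]: "gauss x \<le> 1"
  by (simp add: gauss_def)

lemma gauss_0 [simp]: "gauss 0 = 1"
  by (simp add: gauss_def)

lemma continuous_on_gauss [continuous_intros]:
  "continuous_on S f \<Longrightarrow> continuous_on S (\<lambda>x. gauss (f x))"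
  unfolding gauss_def by (intro continuous_intros) auto

lemma borel_measurable_gauss [measurable]: "gauss \<in> borel_measurable borel"
  unfolding gauss_def[abs_def] by measurable

text \<open>This is the characteristic function of the standard normal distribution, freed of the
  factor \<open>1 / sqrt (2 * pi)\<close> of its density.\<close>

lemma has_bochner_integral_gauss_cis_real:
  "has_bochner_integral lborel (\<lambda>t::real. cis (w * t) * of_real (exp (- t\<^sup>2 / 2)))
     (of_real (sqrt (2 * pi) * exp (- w\<^sup>2 / 2)))"
proof -
  let ?f = "\<lambda>t::real. cis (w * t) * of_real (exp (- t\<^sup>2 / 2))"
  have g: "integrable lborel (\<lambda>t::real. exp (- t\<^sup>2 / 2))"
    using integrable_mult_right[OF integrable_normal_density[of 1 0], of "sqrt (2 * pi)"]
    by (simp add: normal_density_def)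
  have meas: "?f \<in> borel_measurable borel"
    by (intro borel_measurable_continuous_onI continuous_intros) auto
  have int: "integrable lborel ?f"
  proof (rule Bochner_Integration.integrable_bound[OF g])
    show "?f \<in> borel_measurable lborel"
      using meas by simp
    show "AE x in lborel. norm (?f x) \<le> norm (exp (- x\<^sup>2 / 2))"
      by (auto simp: norm_mult)
  qed
  have "complex_of_real (exp (- w\<^sup>2 / 2)) = char std_normal_distribution w"
    by (simp add: char_std_normal_distribution)
  also have "\<dots> = (LINT t|lborel. std_normal_density t *\<^sub>R cis (w * t))"
    unfolding char_def
    by (subst integral_density) (auto simp: cis_conv_exp mult.commute normal_density_nonneg)
  also have "\<dots> = (LINT t|lborel. of_real (1 / sqrt (2 * pi)) * ?f t)"
    by (intro Bochner_Integration.integral_cong) (auto simp: std_normal_density_def scaleR_conv_of_real)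
  also have "\<dots> = of_real (1 / sqrt (2 * pi)) * (LINT t|lborel. ?f t)"
    by simp
  finally have "(LINT t|lborel. ?f t) = of_real (sqrt (2 * pi) * exp (- w\<^sup>2 / 2))"
    by (simp add: field_simps)
  with int show ?thesis
    by (simp add: has_bochner_integral_iff)
qed

text \<open>Character and Gaussian both factor over the coordinates, and Lebesgue measure is the
  image of the product of the one-dimensional ones, so the formula on the line multiplies
  up.\<close>

lemma has_bochner_integral_gauss_cis:
  fixes w :: "'a::euclidean_space"
  shows "has_bochner_integral lborel (\<lambda>x. cis (w \<bullet> x) * of_real (gauss x))
     (of_real (sqrt (2 * pi) ^ DIM('a) * gauss w))"
proof -
  interpret product_sigma_finite "\<lambda>_::'a. lborel :: real measure" ..
  let ?P = "\<Pi>\<^sub>M b\<in>(Basis::'a set). (lborel :: real measure)"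
  let ?T = "\<lambda>f. \<Sum>b\<in>(Basis::'a set). f b *\<^sub>R b"
  let ?F = "\<lambda>x. cis (w \<bullet> x) * complex_of_real (gauss x)"
  let ?g = "\<lambda>b (t::real). cis ((w \<bullet> b) * t) * complex_of_real (exp (- t\<^sup>2 / 2))"
  have T: "?T \<in> measurable ?P borel" by measurable
  have norm2: "(norm x)\<^sup>2 = (\<Sum>b\<in>Basis. (x \<bullet> b)\<^sup>2)" for x :: 'a
    unfolding power2_norm_eq_inner by (subst euclidean_inner) (simp add: power2_eq_square)
  have cis_sum: "cis (sum h A) = (\<Prod>b\<in>A. cis (h b))" if "finite A" for h and A :: "'a set"
    using that by (induction A) (auto simp: cis_mult[symmetric])
  have F: "?F x = (\<Prod>b\<in>Basis. ?g b (x \<bullet> b))" for x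
  proof -
    have "cis (w \<bullet> x) = (\<Prod>b\<in>Basis. cis ((w \<bullet> b) * (x \<bullet> b)))"
      by (simp add: euclidean_inner[of w x] cis_sum)
    moreover have "gauss x = (\<Prod>b\<in>Basis. exp (- (x \<bullet> b)\<^sup>2 / 2))"
      by (simp only: gauss_def norm2 exp_sum[OF finite_Basis, symmetric] sum_negf[symmetric] sum_divide_distrib)
    ultimately show ?thesis by (simp add: prod.distrib)
  qed
  have FT: "?F (?T f) = (\<Prod>b\<in>Basis. ?g b (f b))" for f
    unfolding F by (intro prod.cong refl) (simp add: inner_sum_left_Basis)
  have int: "integrable ?P (\<lambda>f. ?F (?T f))"
    unfolding FT using has_bochner_integral_gauss_cis_real
    by (intro product_integrable_prod) (auto simp: has_bochner_integral_iff)
  have "(LINT f|?P. ?F (?T f)) = (\<Prod>b\<in>Basis. LINT t|lborel. ?g b t)"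
    unfolding FT using has_bochner_integral_gauss_cis_real
    by (intro product_integral_prod) (auto simp: has_bochner_integral_iff)
  also have "\<dots> = (\<Prod>b\<in>(Basis::'a set). of_real (sqrt (2 * pi) * exp (- (w \<bullet> b)\<^sup>2 / 2)))"
    using has_bochner_integral_gauss_cis_real by (intro prod.cong refl) (auto simp: has_bochner_integral_iff)
  also have "\<dots> = of_real (sqrt (2 * pi) ^ DIM('a) * gauss w)"
    by (simp only: gauss_def norm2 prod.distrib exp_sum[OF finite_Basis, symmetric] sum_negf[symmetric]
        sum_divide_distrib prod_constant of_real_prod[symmetric])
  finally have val: "(LINT f|?P. ?F (?T f)) = of_real (sqrt (2 * pi) ^ DIM('a) * gauss w)" .
  have meas: "?F \<in> borel_measurable borel"
    by (intro borel_measurable_continuous_onI continuous_intros)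
  show ?thesis
    unfolding has_bochner_integral_iff
    by (subst (1 2) lborel_eq) (simp only: int val integrable_distr_eq[OF T meas] integral_distr[OF T meas] simp_thms)
qed

section \<open>Gaussian integrals under scaling and translation\<close>

lemma integrable_scaleR_right_eq:
  fixes f :: "'a \<Rightarrow> 'b::{banach, second_countable_topology}"
  assumes "c \<noteq> 0"
  shows "integrable M (\<lambda>x. c *\<^sub>R f x) \<longleftrightarrow> integrable M f"
  using integrable_scaleR_right[of "1 / c" M "\<lambda>x. c *\<^sub>R f x"] assms by auto

lemma integral_lborel_scale:
  fixes f :: "'a::euclidean_space \<Rightarrow> 'b::{banach, second_countable_topology}"
  assumes c: "c \<noteq> 0" and [measurable]: "f \<in> borel_measurable borel"
  shows "(LINT x|lborel. f x) = \<bar>c\<bar> ^ DIM('a) *\<^sub>R (LINT x|lborel. f (t + c *\<^sub>R x))"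
    and "integrable lborel f \<longleftrightarrow> integrable lborel (\<lambda>x. f (t + c *\<^sub>R x))"
proof -
  show "(LINT x|lborel. f x) = \<bar>c\<bar> ^ DIM('a) *\<^sub>R (LINT x|lborel. f (t + c *\<^sub>R x))"
    by (subst lborel_affine[OF c, of t]) (simp add: integral_density integral_distr)
  show "integrable lborel f \<longleftrightarrow> integrable lborel (\<lambda>x. f (t + c *\<^sub>R x))"
    by (subst lborel_affine[OF c, of t]) (use c in \<open>simp add: integrable_density integrable_distr_eq integrable_scaleR_right_eq\<close>)
qed

lemma has_bochner_integral_gauss_cis_scaled:
  fixes w :: "'a::euclidean_space"
  assumes e: "\<epsilon> > 0"
  shows "has_bochner_integral lebesgue (\<lambda>x. cis (w \<bullet> x) * of_real (gauss (\<epsilon> *\<^sub>R x)))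
     (of_real ((sqrt (2 * pi) / \<epsilon>) ^ DIM('a) * gauss (w /\<^sub>R \<epsilon>)))"
proof -
  let ?f = "\<lambda>x::'a. cis ((w /\<^sub>R \<epsilon>) \<bullet> x) * complex_of_real (gauss x)"
  let ?h = "\<lambda>x::'a. cis (w \<bullet> x) * complex_of_real (gauss (\<epsilon> *\<^sub>R x))"
  have m: "?f \<in> borel_measurable borel"
    by (intro borel_measurable_continuous_onI continuous_intros)
  have [measurable]: "?h \<in> borel_measurable borel"
    by (intro borel_measurable_continuous_onI continuous_intros)
  have "(w /\<^sub>R \<epsilon>) \<bullet> (0 + \<epsilon> *\<^sub>R x) = w \<bullet> x" for x
    using e by simp
  then have h: "?h x = ?f (0 + \<epsilon> *\<^sub>R x)" for x
    by (simp only: add_0)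
  have f: "integrable lborel ?f" "(LINT x|lborel. ?f x) = of_real (sqrt (2 * pi) ^ DIM('a) * gauss (w /\<^sub>R \<epsilon>))"
    using has_bochner_integral_gauss_cis[of "w /\<^sub>R \<epsilon>"] by (auto simp: has_bochner_integral_iff)
  have "integrable lborel ?h"
    unfolding h using f(1) integral_lborel_scale(2)[OF _ m, of \<epsilon> 0] e by (simp only:)
  moreover have "of_real (sqrt (2 * pi) ^ DIM('a) * gauss (w /\<^sub>R \<epsilon>)) = \<epsilon> ^ DIM('a) *\<^sub>R (LINT x|lborel. ?h x)"
    unfolding h f(2)[symmetric] using integral_lborel_scale(1)[OF _ m, of \<epsilon> 0] e
    by (simp only: abs_of_pos)
  then have "(LINT x|lborel. ?h x) = of_real ((sqrt (2 * pi) / \<epsilon>) ^ DIM('a) * gauss (w /\<^sub>R \<epsilon>))"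
    using e by (simp add: scaleR_conv_of_real field_simps)
  ultimately show ?thesis
    by (simp add: has_bochner_integral_iff integrable_completion integral_completion)
qed

lemma integrable_gauss_scaled:
  assumes "\<epsilon> > 0" shows "integrable lebesgue (\<lambda>x::'a::euclidean_space. gauss (\<epsilon> *\<^sub>R x))"
proof -
  have "integrable lebesgue (\<lambda>x::'a. complex_of_real (gauss (\<epsilon> *\<^sub>R x)))"
    using has_bochner_integral_gauss_cis_scaled[OF assms, of "0::'a"]
    by (simp add: has_bochner_integral_iff)
  then show ?thesis by (simp add: complex_of_real_integrable_eq)
qed

text \<open>Polynomial multiples of \<open>cis (w \<bullet> x) * gauss (\<epsilon> *\<^sub>R x)\<close> are closed under
  partial derivatives.\<close>
inductive_set gauss_alg :: "real \<Rightarrow> real ^ 'n::finite \<Rightarrow> (real ^ 'n \<Rightarrow> complex) set"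
  for \<epsilon> :: real and w :: "real ^ 'n::finite" where
  base: "(\<lambda>x. cis (w \<bullet> x) * of_real (gauss (\<epsilon> *\<^sub>R x))) \<in> gauss_alg \<epsilon> w"
| coord: "f \<in> gauss_alg \<epsilon> w \<Longrightarrow> (\<lambda>x. of_real (x $ i) * f x) \<in> gauss_alg \<epsilon> w"
| scale: "f \<in> gauss_alg \<epsilon> w \<Longrightarrow> (\<lambda>x. c * f x) \<in> gauss_alg \<epsilon> w"
| add: "f \<in> gauss_alg \<epsilon> w \<Longrightarrow> g \<in> gauss_alg \<epsilon> w \<Longrightarrow> (\<lambda>x. f x + g x) \<in> gauss_alg \<epsilon> w"

lemma has_derivative_vec_nth_of_real:
  "((\<lambda>x::real ^ 'n::finite. complex_of_real (x $ i)) has_derivative (\<lambda>v. of_real (v $ i))) (at x)"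
  by (intro bounded_linear_imp_has_derivative bounded_linear_compose[OF bounded_linear_of_real bounded_linear_vec_nth])

text \<open>The derivative is kept in the algebra in coordinate directions only, because
  \<open>iter_partial\<close> uses no others. This is what makes an induction over the list of
  indices possible.\<close>

lemma gauss_alg_has_derivative:
  fixes w :: "real ^ 'n::finite"
  assumes "f \<in> gauss_alg \<epsilon> w"
  shows "\<exists>D. (\<forall>i. (\<lambda>x. D x (axis i 1)) \<in> gauss_alg \<epsilon> w) \<and> (\<forall>x. (f has_derivative D x) (at x))"
  using assms
proof induction
  case base
  let ?f = "\<lambda>x::real^'n. cis (w \<bullet> x) * complex_of_real (gauss (\<epsilon> *\<^sub>R x))"
  let ?D = "\<lambda>(x::real^'n) v. (of_real (w \<bullet> v) * \<i> - of_real (\<epsilon>\<^sup>2 * (x \<bullet> v))) * ?f x"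
  let ?E = "\<lambda>x. \<i> * of_real (w \<bullet> x) + of_real (- (\<epsilon>\<^sup>2 / 2) * (x \<bullet> x))"
  let ?E' = "\<lambda>x v. \<i> * of_real (w \<bullet> v) + of_real (- (\<epsilon>\<^sup>2 / 2) * (x \<bullet> v + v \<bullet> x))"
  \<comment> \<open>As the exponential of one quadratic polynomial the generator needs a single
    chain rule.\<close>
  have f_exp: "?f = (\<lambda>x. exp (?E x))"
  proof
    fix x :: "real^'n"
    have "gauss (\<epsilon> *\<^sub>R x) = exp (- (\<epsilon>\<^sup>2 / 2) * (x \<bullet> x))"
      unfolding gauss_def power2_norm_eq_inner by (simp add: power2_eq_square)
    then show "?f x = exp (?E x)"
      by (simp only: exp_add cis_conv_exp exp_of_real[symmetric])
  qed
  have d: "(?f has_derivative ?D x) (at x)" for x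
  proof -
    have "((\<lambda>x. ?E x) has_derivative
        (\<lambda>v. ?E' x v)) (at x)"
      by (intro has_derivative_add has_derivative_mult_right has_derivative_of_real
          has_derivative_inner_right has_derivative_inner has_derivative_ident)
    from has_derivative_compose[OF this DERIV_exp[unfolded has_field_derivative_def]]
    have "(?f has_derivative (\<lambda>v. ?f x * (?E' x v))) (at x)"
      unfolding fun_cong[OF f_exp, of x] f_exp .
    moreover have "?f x * (?E' x v) = ?D x v" for v
      by (simp add: inner_commute[of v x] algebra_simps)
    ultimately show ?thesis by (simp only:)
  qed
  have a: "(\<lambda>x. ?D x (axis i 1)) \<in> gauss_alg \<epsilon> w" for i
  proof -
    have "(\<lambda>x. (of_real (w $ i) * \<i>) * ?f x + (- of_real (\<epsilon>\<^sup>2)) * (of_real (x $ i) * ?f x)) \<in> gauss_alg \<epsilon> w"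
      by (intro gauss_alg.intros)
    then show ?thesis
      by (simp add: inner_axis algebra_simps)
  qed
  show ?case by (rule exI[of _ ?D]) (intro conjI allI a d)
next
  case (coord f i)
  then obtain D where D: "\<And>j. (\<lambda>x. D x (axis j 1)) \<in> gauss_alg \<epsilon> w"
    "\<And>x. (f has_derivative D x) (at x)" by blast
  let ?E = "\<lambda>x v. of_real (x $ i) * D x v + of_real (v $ i) * f x"
  have "((\<lambda>x. of_real (x $ i) * f x) has_derivative ?E x) (at x)" for x
    by (intro has_derivative_mult has_derivative_vec_nth_of_real D)
  moreover have "(\<lambda>x. ?E x (axis j 1)) \<in> gauss_alg \<epsilon> w" for j
    by (intro gauss_alg.intros D coord)
  ultimately show ?case by (intro exI[of _ ?E]) blast
next
  case (scale f c)
  then obtain D where D: "\<And>j. (\<lambda>x. D x (axis j 1)) \<in> gauss_alg \<epsilon> w"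
    "\<And>x. (f has_derivative D x) (at x)" by blast
  have "((\<lambda>x. c * f x) has_derivative (\<lambda>v. c * D x v)) (at x)" for x
    by (intro has_derivative_mult_right D)
  with D(1) show ?case by (intro exI[of _ "\<lambda>x v. c * D x v"]) (auto intro: gauss_alg.intros)
next
  case (add f g)
  then obtain D E where D: "\<And>j. (\<lambda>x. D x (axis j 1)) \<in> gauss_alg \<epsilon> w"
    "\<And>x. (f has_derivative D x) (at x)" "\<And>j. (\<lambda>x. E x (axis j 1)) \<in> gauss_alg \<epsilon> w"
    "\<And>x. (g has_derivative E x) (at x)" by blast
  then show ?case
    by (intro exI[of _ "\<lambda>x v. D x v + E x v"]) (auto intro: gauss_alg.intros has_derivative_add)
qed

lemma partial_deriv_eq:
  assumes "(f has_derivative D) (at x)"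
  shows "partial_deriv i f x = D (axis i 1)"
proof -
  interpret linear D using assms by (rule has_derivative_linear)
  have "((\<lambda>t. f (x + t *\<^sub>R axis i 1)) has_derivative (\<lambda>t. D (t *\<^sub>R axis i 1))) (at 0)"
    by (rule has_derivative_compose[where g = f])
       (use assms in \<open>auto intro!: derivative_eq_intros\<close>)
  then show ?thesis
    unfolding partial_deriv_def
    by (intro vector_derivative_at) (simp add: has_vector_derivative_def scale)
qed

lemma iter_partial_gauss_alg:
  assumes "f \<in> gauss_alg \<epsilon> w" shows "iter_partial is f \<in> gauss_alg \<epsilon> w"
proof (induction "is")
  case Nil
  then show ?case using assms by (simp add: iter_partial_def)
next
  case (Cons i "is")
  obtain D where D: "\<And>i. (\<lambda>x. D x (axis i 1)) \<in> gauss_alg \<epsilon> w"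
    "\<And>x. (iter_partial is f has_derivative D x) (at x)"
    using gauss_alg_has_derivative[OF Cons.IH] by blast
  have "iter_partial (i # is) f = (\<lambda>x. D x (axis i 1))"
    using partial_deriv_eq[OF D(2)] by (auto simp: iter_partial_def)
  with D(1) show ?case by simp
qed

text \<open>The exponent \<open>k\<close> has to stay arbitrary in the induction: multiplication by
  a coordinate consumes the bound for \<open>Suc k\<close>.\<close>

lemma gauss_alg_decay:
  fixes w :: "real ^ 'n::finite"
  assumes f: "f \<in> gauss_alg \<epsilon> w" and e: "\<epsilon> > 0"
  shows "\<exists>C. \<forall>x. norm x ^ k * norm (f x) \<le> C"
  using f
proof (induction arbitrary: k)
  case base
  have "eventually (\<lambda>t::real. t ^ k * exp (- (\<epsilon> * t)\<^sup>2 / 2) \<le> 1) at_top"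
    using e by real_asymp
  then obtain T where T: "\<And>t. t \<ge> T \<Longrightarrow> t ^ k * exp (- (\<epsilon> * t)\<^sup>2 / 2) \<le> 1"
    by (auto simp: eventually_at_top_linorder)
  have "norm x ^ k * norm (cis (w \<bullet> x) * complex_of_real (gauss (\<epsilon> *\<^sub>R x))) \<le> 1 + \<bar>T\<bar> ^ k" for x
  proof (cases "norm x \<ge> T")
    case True
    have "norm x ^ k * norm (cis (w \<bullet> x) * complex_of_real (gauss (\<epsilon> *\<^sub>R x))) = norm x ^ k * exp (- (\<epsilon> * norm x)\<^sup>2 / 2)"
      using e by (simp add: norm_mult gauss_def)
    also have "\<dots> \<le> 1" using T[OF True] .
    finally show ?thesis by (rule order_trans) simp
  next
    case False
    have "norm x ^ k * gauss (\<epsilon> *\<^sub>R x) \<le> \<bar>T\<bar> ^ k * 1"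
      using False by (intro mult_mono power_mono) auto
    then show ?thesis by (simp add: norm_mult)
  qed
  then show ?case by blast
next
  case (coord f i)
  obtain C where C: "\<And>x. norm x ^ Suc k * norm (f x) \<le> C" using coord.IH by blast
  have "norm x ^ k * norm (complex_of_real (x $ i) * f x) \<le> C" for x
  proof -
    have "norm x ^ k * norm (complex_of_real (x $ i) * f x) \<le> norm x ^ k * (norm x * norm (f x))"
      by (intro mult_left_mono) (auto simp: norm_mult intro!: mult_right_mono component_le_norm_cart)
    also have "\<dots> \<le> C" using C[of x] by (simp add: mult_ac)
    finally show ?thesis .
  qed
  then show ?case by blast
next
  case (scale f c)
  obtain C where C: "\<And>x. norm x ^ k * norm (f x) \<le> C" using scale.IH by blast
  have "norm x ^ k * norm (c * f x) \<le> norm c * C" for x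
    using mult_left_mono[OF C[of x], of "norm c"] by (simp add: norm_mult mult_ac)
  then show ?case by blast
next
  case (add f g)
  obtain C C' where C: "\<And>x. norm x ^ k * norm (f x) \<le> C" "\<And>x. norm x ^ k * norm (g x) \<le> C'"
    using add.IH by blast
  have "norm x ^ k * norm (f x + g x) \<le> C + C'" for x
  proof -
    have "norm x ^ k * norm (f x + g x) \<le> norm x ^ k * (norm (f x) + norm (g x))"
      by (intro mult_left_mono norm_triangle_ineq) auto
    also have "\<dots> \<le> C + C'" using C[of x] by (simp add: distrib_left)
    finally show ?thesis .
  qed
  then show ?case by blast
qed

lemma schwartz_gauss_alg:
  assumes f: "f \<in> gauss_alg \<epsilon> w" and e: "\<epsilon> > 0" shows "schwartz f"
  unfolding schwartz_def smooth_def
proof (intro conjI allI)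
  fix "is" x
  show "iter_partial is f differentiable at x"
    using gauss_alg_has_derivative[OF iter_partial_gauss_alg[OF f], of "is"]
    by (auto simp: differentiable_def)
next
  fix k "is"
  show "\<exists>C. \<forall>x. norm x ^ k * norm (iter_partial is f x) \<le> C"
    by (rule gauss_alg_decay[OF iter_partial_gauss_alg[OF f] e])
qed

text \<open>These are the Schwartz functions at which the pairing in \<open>sobolev_H\<close> will
  be evaluated.\<close>

lemma schwartz_gauss_cis:
  fixes w :: "real ^ 'n::finite"
  assumes "\<epsilon> > 0"
  shows "schwartz (\<lambda>x. cis (w \<bullet> x) * of_real (gauss (\<epsilon> *\<^sub>R x)))"
  by (rule schwartz_gauss_alg[OF gauss_alg.base assms])

subsection \<open>An \<open>L\<^sup>2\<close> bound for the Fourier transform\<close>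

lemma sigma_finite_measure_lebesgue: "sigma_finite_measure (lebesgue :: 'a::euclidean_space measure)"
proof
  obtain A :: "'a set set" where A: "countable A" "A \<subseteq> sets lborel" "\<Union>A = space lborel"
    "\<forall>a\<in>A. emeasure lborel a \<noteq> \<infinity>"
    using lborel.sigma_finite_countable by blast
  moreover have "emeasure lebesgue a \<noteq> \<infinity>" if "a \<in> A" for a
    using A that by auto
  ultimately show "\<exists>A. countable A \<and> A \<subseteq> sets lebesgue \<and> \<Union>A = space (lebesgue :: 'a measure) \<and>
      (\<forall>a\<in>A. emeasure lebesgue a \<noteq> \<infinity>)"
    by (intro exI[of _ A]) auto
qed

interpretation lebesgue: sigma_finite_measure "lebesgue :: 'a::euclidean_space measure"
  by (rule sigma_finite_measure_lebesgue)

interpretation lebesgue_pair: pair_sigma_finite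
  "lebesgue :: 'a::euclidean_space measure" "lebesgue :: 'b::euclidean_space measure" ..

text \<open>The product of the two completed sigma-algebras differs from the Borel one but contains
  it, since the identity of each factor is Borel measurable.\<close>

lemma borel_measurable_lebesgue_pair:
  fixes f :: "'a::euclidean_space \<times> 'b::euclidean_space \<Rightarrow> 'c::topological_space"
  assumes "f \<in> borel_measurable borel"
  shows "f \<in> borel_measurable (lebesgue \<Otimes>\<^sub>M lebesgue)"
proof -
  have id: "(\<lambda>x. x) \<in> borel_measurable (lebesgue :: 'd::euclidean_space measure)"
    by (intro measurable_completion) simp
  have "(\<lambda>p :: 'a \<times> 'b. (fst p, snd p)) \<in> measurable (lebesgue \<Otimes>\<^sub>M lebesgue) (borel \<Otimes>\<^sub>M borel)"
    by (intro measurable_Pair measurable_compose[OF measurable_fst id] measurable_compose[OF measurable_snd id])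
  from measurable_compose[OF this, of f borel] assms show ?thesis
    by (simp add: borel_prod)
qed

lemma borel_measurable_continuous_lebesgue_pair:
  fixes f :: "'a::euclidean_space \<times> 'b::euclidean_space \<Rightarrow> 'c::topological_space"
  assumes "continuous_on UNIV f"
  shows "f \<in> borel_measurable (lebesgue \<Otimes>\<^sub>M lebesgue)"
  by (rule borel_measurable_lebesgue_pair[OF borel_measurable_continuous_onI[OF assms]])

lemma borel_measurable_continuous_lebesgue:
  "continuous_on UNIV f \<Longrightarrow> f \<in> borel_measurable lebesgue"
  by (intro measurable_completion) (simp add: borel_measurable_continuous_onI)

lemma integrable_bounded_mult_pair:
  fixes f :: "'a::euclidean_space \<Rightarrow> complex" and g :: "'b::euclidean_space \<Rightarrow> complex"
    and k :: "'a \<times> 'b \<Rightarrow> complex"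
  assumes f: "integrable lebesgue f" and g: "integrable lebesgue g"
    and k: "continuous_on UNIV k" "\<And>p. norm (k p) \<le> B"
  shows "integrable (lebesgue \<Otimes>\<^sub>M lebesgue) (\<lambda>(x, y). k (x, y) * f x * g y)"
proof (rule lebesgue_pair.Fubini_integrable)
  note [measurable] = borel_measurable_continuous_lebesgue_pair[OF k(1)]
  note [measurable] = borel_measurable_integrable[OF f] borel_measurable_integrable[OF g]
  show m: "(\<lambda>(x, y). k (x, y) * f x * g y) \<in> borel_measurable (lebesgue \<Otimes>\<^sub>M lebesgue)"
    by measurable
  have i: "integrable lebesgue (\<lambda>y. k (x, y) * f x * g y)" for x
  proof (rule Bochner_Integration.integrable_bound[OF integrable_mult_right[OF g, of "of_real B * f x"]])
    have "continuous_on UNIV (\<lambda>y. k (x, y))"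
      by (intro continuous_on_compose2[OF k(1)] continuous_intros) auto
    note [measurable] = borel_measurable_continuous_lebesgue[OF this]
    show "(\<lambda>y. k (x, y) * f x * g y) \<in> borel_measurable lebesgue" by measurable
    show "AE y in lebesgue. norm (k (x, y) * f x * g y) \<le> norm (of_real B * f x * g y)"
      using k(2) order_trans[OF k(2) abs_ge_self]
      by (intro AE_I2) (auto simp: norm_mult intro!: mult_right_mono)
  qed
  then show "AE x in lebesgue. integrable lebesgue (\<lambda>y. case (x, y) of (x, y) \<Rightarrow> k (x, y) * f x * g y)"
    by simp
  have B: "B \<ge> 0" using k(2) norm_ge_zero order_trans by blast
  show "integrable lebesgue (\<lambda>x. LINT y|lebesgue. norm (case (x, y) of (x, y) \<Rightarrow> k (x, y) * f x * g y))"
  proof (rule Bochner_Integration.integrable_bound)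
    show "integrable lebesgue (\<lambda>x. norm (f x) * (B * (LINT y|lebesgue. norm (g y))))"
      using f by (intro integrable_mult_left integrable_norm)
    show "(\<lambda>x. LINT y|lebesgue. norm (case (x, y) of (x, y) \<Rightarrow> k (x, y) * f x * g y)) \<in> borel_measurable lebesgue"
      using m by measurable
    show "AE x in lebesgue. norm (LINT y|lebesgue. norm (case (x, y) of (x, y) \<Rightarrow> k (x, y) * f x * g y))
       \<le> norm (norm (f x) * (B * (LINT y|lebesgue. norm (g y))))"
    proof (intro AE_I2)
      fix x
      have "(LINT y|lebesgue. norm (k (x, y) * f x * g y)) \<le> (LINT y|lebesgue. norm (f x) * (B * norm (g y)))"
      proof (intro integral_mono integrable_norm i integrable_mult_right g)
        fix y
        have "norm (k (x, y)) * (norm (f x) * norm (g y)) \<le> B * (norm (f x) * norm (g y))"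
          by (intro mult_right_mono k) auto
        then show "norm (k (x, y) * f x * g y) \<le> norm (f x) * (B * norm (g y))"
          by (simp add: norm_mult mult_ac)
      qed
      then show "norm (LINT y|lebesgue. norm (case (x, y) of (x, y) \<Rightarrow> k (x, y) * f x * g y))
         \<le> norm (norm (f x) * (B * (LINT y|lebesgue. norm (g y))))"
        using B by (simp add: abs_mult)
    qed
  qed
qed

lemma Fubini_bounded_kernel:
  fixes f :: "'a::euclidean_space \<Rightarrow> complex" and g :: "'b::euclidean_space \<Rightarrow> complex"
    and k :: "'a \<times> 'b \<Rightarrow> complex"
  assumes f: "integrable lebesgue f" and g: "integrable lebesgue g"
    and k: "continuous_on UNIV k" "\<And>p. norm (k p) \<le> B"
  shows "(LINT y|lebesgue. (LINT x|lebesgue. k (x, y) * f x) * g y) =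
    (LINT x|lebesgue. f x * (LINT y|lebesgue. k (x, y) * g y))"
proof -
  have "(LINT y|lebesgue. (LINT x|lebesgue. k (x, y) * f x) * g y) =
      (LINT y|lebesgue. (LINT x|lebesgue. k (x, y) * f x * g y))"
    by simp
  also have "\<dots> = (LINT x|lebesgue. (LINT y|lebesgue. k (x, y) * f x * g y))"
    using integrable_bounded_mult_pair[OF assms] by (intro lebesgue_pair.Fubini_integral) simp
  also have "\<dots> = (LINT x|lebesgue. f x * (LINT y|lebesgue. k (x, y) * g y))"
    by (subst integral_mult_right_zero[symmetric]) (simp add: mult_ac)
  finally show ?thesis .
qed

text \<open>Up to the factor \<open>(2 * pi) ^ n\<close> this is the inverse transform. In
  \<open>sobolev_H\<close> the function \<open>g\<close> carries the sign of \<open>fourier\<close>,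
  so the weight paired with \<open>u\<close> has to be transformed with the opposite sign.\<close>

definition conj_fourier :: "('a::euclidean_space \<Rightarrow> complex) \<Rightarrow> 'a \<Rightarrow> complex" where
  "conj_fourier f \<xi> = (LINT x|lebesgue. cis (x \<bullet> \<xi>) * f x)"

lemma norm_conj_fourier_le:
  fixes f :: "'a::euclidean_space \<Rightarrow> complex"
  assumes "integrable lebesgue f"
  shows "norm (conj_fourier f \<xi>) \<le> (LINT x|lebesgue. norm (f x))"
proof -
  have "norm (conj_fourier f \<xi>) \<le> (LINT x|lebesgue. norm (cis (x \<bullet> \<xi>) * f x))"
    unfolding conj_fourier_def by (rule integral_norm_bound)
  then show ?thesis by (simp add: norm_mult)
qed

lemma borel_measurable_conj_fourier:
  fixes f :: "'a::euclidean_space \<Rightarrow> complex"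
  assumes "integrable lebesgue f"
  shows "conj_fourier f \<in> borel_measurable lebesgue"
proof -
  have "continuous_on UNIV (\<lambda>p::'a \<times> 'a. cis (snd p \<bullet> fst p))"
    by (intro continuous_intros)
  note [measurable] = borel_measurable_continuous_lebesgue_pair[OF this] borel_measurable_integrable[OF assms]
  have "(\<lambda>(\<xi>, x). cis (x \<bullet> \<xi>) * f x) = (\<lambda>p. cis (snd p \<bullet> fst p) * f (snd p))"
    by auto
  also have "\<dots> \<in> borel_measurable (lebesgue \<Otimes>\<^sub>M lebesgue)"
    by measurable
  finally show ?thesis
    unfolding conj_fourier_def[abs_def] by (rule lebesgue.borel_measurable_lebesgue_integral)
qed

text \<open>The kernel \<open>cis (x \<bullet> \<xi>)\<close> is symmetric and of modulus one, so
  Fubini moves the transform from one factor to the other. Together with the Gaussian integral this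
  is the whole Fourier analysis behind the square norm bound.\<close>

lemma conj_fourier_mult_formula:
  fixes f g :: "'a::euclidean_space \<Rightarrow> complex"
  assumes "integrable lebesgue f" "integrable lebesgue g"
  shows "(LINT \<xi>|lebesgue. conj_fourier f \<xi> * g \<xi>) = (LINT x|lebesgue. f x * conj_fourier g x)"
proof -
  have c: "continuous_on UNIV (\<lambda>p::'a \<times> 'a. cis (fst p \<bullet> snd p))"
    by (intro continuous_intros)
  have "(LINT \<xi>|lebesgue. (LINT x|lebesgue. cis (x \<bullet> \<xi>) * f x) * g \<xi>) =
      (LINT x|lebesgue. f x * (LINT \<xi>|lebesgue. cis (x \<bullet> \<xi>) * g \<xi>))"
    using Fubini_bounded_kernel[OF assms c, of 1] by simp
  then show ?thesis by (simp add: conj_fourier_def inner_commute)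
qed

lemma integrable_mult_L2:
  fixes f g :: "'a \<Rightarrow> complex"
  assumes [measurable]: "f \<in> borel_measurable M" "g \<in> borel_measurable M"
    and f: "integrable M (\<lambda>x. (norm (f x))\<^sup>2)" and g: "integrable M (\<lambda>x. (norm (g x))\<^sup>2)"
  shows "integrable M (\<lambda>x. f x * g x)"
proof (rule Bochner_Integration.integrable_bound[OF Bochner_Integration.integrable_add[OF f g]])
  show "AE x in M. norm (f x * g x) \<le> norm ((norm (f x))\<^sup>2 + (norm (g x))\<^sup>2)"
  proof (intro AE_I2)
    fix x
    have "2 * (norm (f x) * norm (g x)) \<le> (norm (f x))\<^sup>2 + (norm (g x))\<^sup>2"
      using sum_squares_bound[of "norm (f x)" "norm (g x)"] by simp
    moreover have "0 \<le> norm (f x) * norm (g x)" by simp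
    ultimately show "norm (f x * g x) \<le> norm ((norm (f x))\<^sup>2 + (norm (g x))\<^sup>2)"
      unfolding norm_mult real_norm_def by linarith
  qed
qed measurable

lemma integrable_mult_bounded:
  fixes f k :: "'a \<Rightarrow> complex"
  assumes f: "integrable M f" and [measurable]: "k \<in> borel_measurable M" and k: "\<And>x. norm (k x) \<le> B"
  shows "integrable M (\<lambda>x. f x * k x)"
proof (rule Bochner_Integration.integrable_bound)
  note [measurable] = borel_measurable_integrable[OF f]
  show "integrable M (\<lambda>x. B * norm (f x))"
    by (intro integrable_mult_right integrable_norm f)
  show "(\<lambda>x. f x * k x) \<in> borel_measurable M" by measurable
  show "AE x in M. norm (f x * k x) \<le> norm (B * norm (f x))"
  proof (intro AE_I2)
    fix x
    have "norm (f x * k x) \<le> norm (f x) * B"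
      unfolding norm_mult by (intro mult_left_mono k) auto
    then show "norm (f x * k x) \<le> norm (B * norm (f x))"
      unfolding real_norm_def mult.commute[of B] by linarith
  qed
qed

section \<open>Gaussian kernels and the Plancherel inequality\<close>

lemma integral_gauss_affine:
  fixes x :: "'a::euclidean_space"
  assumes d: "\<delta> > 0"
  shows "has_bochner_integral lebesgue (\<lambda>y. gauss ((y - x) /\<^sub>R \<delta>)) ((sqrt (2 * pi) * \<delta>) ^ DIM('a))"
proof -
  have g: "integrable lborel (gauss :: 'a \<Rightarrow> real)" "(LINT y|lborel. gauss (y::'a)) = sqrt (2 * pi) ^ DIM('a)"
  proof -
    have "has_bochner_integral lborel (\<lambda>y::'a. complex_of_real (gauss y)) (of_real (sqrt (2 * pi) ^ DIM('a)))"
      using has_bochner_integral_gauss_cis[of "0::'a"] by simp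
    then show "integrable lborel (gauss :: 'a \<Rightarrow> real)"
      "(LINT y|lborel. gauss (y::'a)) = sqrt (2 * pi) ^ DIM('a)"
      unfolding has_bochner_integral_iff complex_of_real_integrable_eq integral_complex_of_real of_real_eq_iff
      by blast+
  qed
  have s: "gauss (- (x /\<^sub>R \<delta>) + (1 / \<delta>) *\<^sub>R y) = gauss ((y - x) /\<^sub>R \<delta>)" for y
    by (simp add: algebra_simps divide_inverse)
  have "integrable lborel (\<lambda>y. gauss ((y - x) /\<^sub>R \<delta>))"
    using integral_lborel_scale(2)[of "1 / \<delta>" "gauss :: 'a \<Rightarrow> real" "- (x /\<^sub>R \<delta>)"] g(1) d
    unfolding s by simp
  moreover have "(LINT y|lborel. gauss ((y - x) /\<^sub>R \<delta>)) = (sqrt (2 * pi) * \<delta>) ^ DIM('a)"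
    using integral_lborel_scale(1)[of "1 / \<delta>" "gauss :: 'a \<Rightarrow> real" "- (x /\<^sub>R \<delta>)"] g(2) d
    unfolding s by (simp add: field_simps)
  ultimately show ?thesis
    by (simp add: has_bochner_integral_iff integrable_completion integral_completion)
qed

lemma nn_integral_gauss_affine:
  fixes x :: "'a::euclidean_space"
  assumes d: "\<delta> > 0"
  shows "(\<integral>\<^sup>+ y. ennreal (gauss ((y - x) /\<^sub>R \<delta>)) \<partial>lebesgue) = ennreal ((sqrt (2 * pi) * \<delta>) ^ DIM('a))"
  using integral_gauss_affine[OF d, of x]
  by (subst nn_integral_eq_integral) (auto simp: has_bochner_integral_iff)

text \<open>Modulation turns into translation: the result is a bump of width \<open>\<delta>\<close>
  around \<open>x\<close> whose total mass is \<open>(2 * pi) ^ n\<close> for every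
  \<open>\<delta>\<close>.\<close>

lemma conj_fourier_gauss:
  fixes x y :: "'a::euclidean_space"
  assumes d: "\<delta> > 0"
  shows "conj_fourier (\<lambda>\<xi>. cis (- (\<xi> \<bullet> x)) * of_real (gauss (\<delta> *\<^sub>R \<xi>))) y =
    of_real ((sqrt (2 * pi) / \<delta>) ^ DIM('a) * gauss ((y - x) /\<^sub>R \<delta>))"
proof -
  have "cis (\<xi> \<bullet> y) * (cis (- (\<xi> \<bullet> x)) * of_real (gauss (\<delta> *\<^sub>R \<xi>))) =
      cis ((y - x) \<bullet> \<xi>) * complex_of_real (gauss (\<delta> *\<^sub>R \<xi>))" for \<xi>
  proof -
    have "cis (\<xi> \<bullet> y) * cis (- (\<xi> \<bullet> x)) = cis ((y - x) \<bullet> \<xi>)"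
      by (simp only: cis_mult) (simp add: inner_commute inner_diff_right)
    then show ?thesis by (simp only: mult.assoc[symmetric])
  qed
  then have "conj_fourier (\<lambda>\<xi>. cis (- (\<xi> \<bullet> x)) * of_real (gauss (\<delta> *\<^sub>R \<xi>))) y =
      (LINT \<xi>|lebesgue. cis ((y - x) \<bullet> \<xi>) * complex_of_real (gauss (\<delta> *\<^sub>R \<xi>)))"
    unfolding conj_fourier_def by (simp only:)
  then show ?thesis
    using has_bochner_integral_gauss_cis_scaled[OF d, of "y - x"]
    by (simp only: has_bochner_integral_iff)
qed

lemma integrable_bounded_gauss:
  fixes f :: "'a::euclidean_space \<Rightarrow> complex"
  assumes d: "\<delta> > 0" and m: "f \<in> borel_measurable lebesgue" and B: "\<And>\<xi>. norm (f \<xi>) \<le> B"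
  shows "integrable lebesgue (\<lambda>\<xi>. f \<xi> * of_real (gauss (\<delta> *\<^sub>R \<xi>)))"
proof -
  have "integrable lebesgue (\<lambda>\<xi>::'a. complex_of_real (gauss (\<delta> *\<^sub>R \<xi>)))"
    unfolding complex_of_real_integrable_eq by (rule integrable_gauss_scaled[OF d])
  from integrable_mult_bounded[OF this m B] show ?thesis by (simp add: mult.commute)
qed

text \<open>Schur's test: half the sum of squares bounds the product \<open>f x * f y\<close>, the
  symmetry of the kernel makes the two halves equal, and the kernel has the same integral in every
  row.\<close>

lemma schur_gauss:
  fixes f :: "'a::euclidean_space \<Rightarrow> real"
  assumes d: "\<delta> > 0" and [measurable]: "f \<in> borel_measurable lebesgue" and f0: "\<And>x. 0 \<le> f x"
  shows "(\<integral>\<^sup>+ x. \<integral>\<^sup>+ y. ennreal (f x * f y * gauss ((y - x) /\<^sub>R \<delta>)) \<partial>lebesgue \<partial>lebesgue)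
    \<le> ennreal ((sqrt (2 * pi) * \<delta>) ^ DIM('a)) * (\<integral>\<^sup>+ x. ennreal ((f x)\<^sup>2) \<partial>lebesgue)"
proof -
  let ?G = "\<lambda>x y :: 'a. ennreal (gauss ((y - x) /\<^sub>R \<delta>))"
  let ?c = "ennreal ((sqrt (2 * pi) * \<delta>) ^ DIM('a))"
  let ?h = "\<lambda>x. ennreal ((f x)\<^sup>2 / 2)"
  have "continuous_on UNIV (\<lambda>p::'a \<times> 'a. gauss ((snd p - fst p) /\<^sub>R \<delta>))"
    by (intro continuous_intros)
  note G[measurable] = borel_measurable_continuous_lebesgue_pair[OF this]
  have G1: "(\<lambda>y. gauss ((y - x) /\<^sub>R \<delta>)) \<in> borel_measurable lebesgue" for x :: 'a
    by (intro borel_measurable_continuous_lebesgue continuous_intros)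
  have G2: "(\<lambda>x. gauss ((y - x) /\<^sub>R \<delta>)) \<in> borel_measurable lebesgue" for y :: 'a
    by (intro borel_measurable_continuous_lebesgue continuous_intros)
  note [measurable] = G1 G2
  have Gsym: "?G x y = ?G y x" for x y
    by (simp add: gauss_def norm_minus_commute)
  have "(\<integral>\<^sup>+ x. \<integral>\<^sup>+ y. ennreal (f x * f y * gauss ((y - x) /\<^sub>R \<delta>)) \<partial>lebesgue \<partial>lebesgue)
     \<le> (\<integral>\<^sup>+ x. \<integral>\<^sup>+ y. ?h x * ?G x y + ?h y * ?G x y \<partial>lebesgue \<partial>lebesgue)"
  proof (intro nn_integral_mono)
    fix x y :: 'a
    have "f x * f y \<le> (f x)\<^sup>2 / 2 + (f y)\<^sup>2 / 2"
      using sum_squares_bound[of "f x" "f y"] by simp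
    then have "f x * f y * gauss ((y - x) /\<^sub>R \<delta>) \<le> ((f x)\<^sup>2 / 2 + (f y)\<^sup>2 / 2) * gauss ((y - x) /\<^sub>R \<delta>)"
      by (rule mult_right_mono) simp
    then show "ennreal (f x * f y * gauss ((y - x) /\<^sub>R \<delta>)) \<le> ?h x * ?G x y + ?h y * ?G x y"
      by (simp add: ennreal_mult[symmetric] ennreal_plus[symmetric] distrib_right ennreal_leI del: ennreal_plus)
  qed
  also have "\<dots> = (\<integral>\<^sup>+ x. (\<integral>\<^sup>+ y. ?h x * ?G x y \<partial>lebesgue) + (\<integral>\<^sup>+ y. ?h y * ?G x y \<partial>lebesgue) \<partial>lebesgue)"
    by (intro nn_integral_cong nn_integral_add) measurable
  also have "\<dots> = (\<integral>\<^sup>+ x. \<integral>\<^sup>+ y. ?h x * ?G x y \<partial>lebesgue \<partial>lebesgue) + (\<integral>\<^sup>+ x. \<integral>\<^sup>+ y. ?h y * ?G x y \<partial>lebesgue \<partial>lebesgue)"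
  proof (intro nn_integral_add lebesgue.borel_measurable_nn_integral)
    show "(\<lambda>(x, y). ?h x * ?G x y) \<in> borel_measurable (lebesgue \<Otimes>\<^sub>M lebesgue)"
      using G by (auto simp: split_beta')
    show "(\<lambda>(x, y). ?h y * ?G x y) \<in> borel_measurable (lebesgue \<Otimes>\<^sub>M lebesgue)"
      using G by (auto simp: split_beta')
  qed
  also have "(\<integral>\<^sup>+ x. \<integral>\<^sup>+ y. ?h y * ?G x y \<partial>lebesgue \<partial>lebesgue) = (\<integral>\<^sup>+ y. \<integral>\<^sup>+ x. ?h y * ?G x y \<partial>lebesgue \<partial>lebesgue)"
  proof (intro lebesgue_pair.Fubini'[symmetric])
    show "(\<lambda>(x, y). ?h y * ?G x y) \<in> borel_measurable (lebesgue \<Otimes>\<^sub>M lebesgue)"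
      using G by (auto simp: split_beta')
  qed
  also have "\<dots> = (\<integral>\<^sup>+ x. \<integral>\<^sup>+ y. ?h x * ?G x y \<partial>lebesgue \<partial>lebesgue)"
    by (simp only: Gsym)
  also have "(\<integral>\<^sup>+ x. \<integral>\<^sup>+ y. ?h x * ?G x y \<partial>lebesgue \<partial>lebesgue) = (\<integral>\<^sup>+ x. ?h x * ?c \<partial>lebesgue)"
    by (intro nn_integral_cong) (subst nn_integral_cmult, measurable, simp only: nn_integral_gauss_affine[OF d])
  also have "\<dots> + \<dots> = (\<integral>\<^sup>+ x. ?h x * ?c + ?h x * ?c \<partial>lebesgue)"
    by (intro nn_integral_add[symmetric]) measurable
  also have "\<dots> = (\<integral>\<^sup>+ x. ?c * ennreal ((f x)\<^sup>2) \<partial>lebesgue)"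
  proof (intro nn_integral_cong)
    fix x
    have "ennreal ((f x)\<^sup>2) = ?h x + ?h x"
      by (simp add: ennreal_plus[symmetric] del: ennreal_plus)
    then show "?h x * ?c + ?h x * ?c = ?c * ennreal ((f x)\<^sup>2)"
      by (simp only: distrib_left distrib_right mult.commute)
  qed
  also have "\<dots> = ?c * (\<integral>\<^sup>+ x. ennreal ((f x)\<^sup>2) \<partial>lebesgue)"
    by (rule nn_integral_cmult) measurable
  finally show ?thesis .
qed

text \<open>The damping factor makes the square of the transform integrable. The multiplication
  formula, used twice, rewrites the damped square norm as a quadratic form in \<open>f\<close> with
  Gaussian kernel, to which Schur's test applies.\<close>

lemma nn_integral_conj_fourier_gauss_le:
  fixes f :: "'a::euclidean_space \<Rightarrow> complex"
  assumes f: "integrable lebesgue f" and d: "\<delta> > 0"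
  shows "(\<integral>\<^sup>+ \<xi>. ennreal ((norm (conj_fourier f \<xi>))\<^sup>2 * gauss (\<delta> *\<^sub>R \<xi>)) \<partial>lebesgue)
    \<le> ennreal ((2 * pi) ^ DIM('a)) * (\<integral>\<^sup>+ x. ennreal ((norm (f x))\<^sup>2) \<partial>lebesgue)"
proof -
  let ?F = "conj_fourier f" and ?c = "(sqrt (2 * pi) / \<delta>) ^ DIM('a)"
  let ?h = "\<lambda>x y. norm (f x) * norm (f y) * gauss ((y - x) /\<^sub>R \<delta>)"
  let ?E = "\<lambda>x \<xi>. cis (- (\<xi> \<bullet> x)) * complex_of_real (gauss (\<delta> *\<^sub>R \<xi>))"
  let ?I = "\<integral>\<^sup>+ x. ennreal ((norm (f x))\<^sup>2) \<partial>lebesgue"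
  define B where "B = (LINT x|lebesgue. norm (f x))"
  have B: "norm (?F \<xi>) \<le> B" for \<xi>
    unfolding B_def by (rule norm_conj_fourier_le[OF f])
  note [measurable] = borel_measurable_conj_fourier[OF f] borel_measurable_integrable[OF f]
  \<comment> \<open>The transform of \<open>f\<close> is tested against its own damped conjugate;
    the conjugate of the transform of \<open>?G\<close> is the convolution of \<open>f\<close> with
    a bump.\<close>
  let ?G = "\<lambda>\<xi>. cnj (?F \<xi>) * of_real (gauss (\<delta> *\<^sub>R \<xi>))"
  have "(\<lambda>\<xi>. cnj (?F \<xi>)) \<in> borel_measurable lebesgue"
    by (rule measurable_compose[OF borel_measurable_conj_fourier[OF f]])
       (intro borel_measurable_continuous_onI continuous_intros)
  then have G: "integrable lebesgue ?G"
    using B by (intro integrable_bounded_gauss[OF d, of _ B]) auto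
  have GF: "?F \<xi> * ?G \<xi> = of_real ((norm (?F \<xi>))\<^sup>2 * gauss (\<delta> *\<^sub>R \<xi>))" for \<xi>
    by (simp add: complex_norm_square[symmetric] mult.assoc[symmetric])
  have int: "integrable lebesgue (\<lambda>\<xi>. (norm (?F \<xi>))\<^sup>2 * gauss (\<delta> *\<^sub>R \<xi>))"
  proof -
    have "integrable lebesgue (\<lambda>\<xi>. (of_real ((norm (?F \<xi>))\<^sup>2) :: complex) * of_real (gauss (\<delta> *\<^sub>R \<xi>)))"
      using B by (intro integrable_bounded_gauss[OF d, of _ "B\<^sup>2"]) (auto simp: norm_power intro!: power_mono)
    then show ?thesis
      by (simp only: of_real_mult[symmetric] complex_of_real_integrable_eq)
  qed
  let ?J = "LINT \<xi>|lebesgue. (norm (?F \<xi>))\<^sup>2 * gauss (\<delta> *\<^sub>R \<xi>)"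
  have hatG: "conj_fourier ?G x = cnj (LINT y|lebesgue. f y * of_real (?c * gauss ((y - x) /\<^sub>R \<delta>)))" for x
  proof -
    have K: "integrable lebesgue (\<lambda>\<xi>. cis (- (\<xi> \<bullet> x)) * complex_of_real (gauss (\<delta> *\<^sub>R \<xi>)))"
      by (intro integrable_bounded_gauss[OF d, of _ 1] borel_measurable_continuous_lebesgue continuous_intros) auto
    have "conj_fourier ?G x = (LINT \<xi>|lebesgue. cnj (?F \<xi> * ?E x \<xi>))"
      unfolding conj_fourier_def by (intro Bochner_Integration.integral_cong) (auto simp: cis_cnj)
    also have "\<dots> = cnj (LINT \<xi>|lebesgue. ?F \<xi> * ?E x \<xi>)"
      by (rule Bochner_Integration.integral_cnj)
    also have "(LINT \<xi>|lebesgue. ?F \<xi> * ?E x \<xi>) =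
        (LINT y|lebesgue. f y * of_real (?c * gauss ((y - x) /\<^sub>R \<delta>)))"
      by (subst conj_fourier_mult_formula[OF f K]) (simp only: conj_fourier_gauss[OF d])
    finally show ?thesis .
  qed
  have "ennreal ?J = ennreal (norm (complex_of_real ?J))"
    by (simp add: integral_nonneg_AE)
  also have "complex_of_real ?J = (LINT x|lebesgue. f x * conj_fourier ?G x)"
    unfolding conj_fourier_mult_formula[OF f G, symmetric] GF by (simp only: integral_complex_of_real)
  also have "ennreal (norm \<dots>) \<le> (\<integral>\<^sup>+ x. ennreal (norm (f x * conj_fourier ?G x)) \<partial>lebesgue)"
  proof (intro integral_norm_bound_ennreal integrable_mult_bounded[OF f])
    show "conj_fourier ?G \<in> borel_measurable lebesgue" by (rule borel_measurable_conj_fourier[OF G])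
    show "norm (conj_fourier ?G x) \<le> (LINT \<xi>|lebesgue. norm (?G \<xi>))" for x
      by (rule norm_conj_fourier_le[OF G])
  qed
  also have "\<dots> \<le> (\<integral>\<^sup>+ x. \<integral>\<^sup>+ y. ennreal ?c * ennreal (?h x y) \<partial>lebesgue \<partial>lebesgue)"
  proof (intro nn_integral_mono)
    fix x :: 'a
    let ?k = "\<lambda>y. complex_of_real (?c * gauss ((y - x) /\<^sub>R \<delta>))"
    have k: "?k \<in> borel_measurable lebesgue"
      by (intro borel_measurable_continuous_lebesgue continuous_intros)
    have "norm (?k y) \<le> ?c" for y
    proof -
      have "norm (?k y) = ?c * gauss ((y - x) /\<^sub>R \<delta>)"
        unfolding norm_of_real using d by (intro abs_of_nonneg mult_nonneg_nonneg) auto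
      also have "\<dots> \<le> ?c" using d by (intro mult_left_le) auto
      finally show ?thesis .
    qed
    then have fk: "integrable lebesgue (\<lambda>y. f y * ?k y)"
      by (intro integrable_mult_bounded[OF f k])
    then have "ennreal (norm (conj_fourier ?G x)) \<le> (\<integral>\<^sup>+ y. ennreal (norm (f y * ?k y)) \<partial>lebesgue)"
      unfolding hatG complex_mod_cnj by (rule integral_norm_bound_ennreal)
    then have "ennreal (norm (f x)) * ennreal (norm (conj_fourier ?G x)) \<le>
        ennreal (norm (f x)) * (\<integral>\<^sup>+ y. ennreal (norm (f y * ?k y)) \<partial>lebesgue)"
      by (rule mult_left_mono) simp
    also have "\<dots> = (\<integral>\<^sup>+ y. ennreal (norm (f x)) * ennreal (norm (f y * ?k y)) \<partial>lebesgue)"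
      by (intro nn_integral_cmult[symmetric]
          measurable_compose[OF borel_measurable_integrable[OF integrable_norm[OF fk]] measurable_ennreal])
    also have "\<dots> = (\<integral>\<^sup>+ y. ennreal ?c * ennreal (?h x y) \<partial>lebesgue)"
      using d by (intro nn_integral_cong) (simp add: ennreal_mult'[symmetric] norm_mult norm_power norm_divide mult_ac)
    finally show "ennreal (norm (f x * conj_fourier ?G x)) \<le> \<dots>"
      by (simp add: norm_mult ennreal_mult)
  qed
  also have "\<dots> = ennreal ?c * (\<integral>\<^sup>+ x. \<integral>\<^sup>+ y. ennreal (?h x y) \<partial>lebesgue \<partial>lebesgue)"
  proof -
    have "continuous_on UNIV (\<lambda>p::'a \<times> 'a. gauss ((snd p - fst p) /\<^sub>R \<delta>))"
      by (intro continuous_intros)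
    note G[measurable] = borel_measurable_continuous_lebesgue_pair[OF this]
    have [measurable]: "(\<lambda>y. gauss ((y - x) /\<^sub>R \<delta>)) \<in> borel_measurable lebesgue" for x :: 'a
      by (intro borel_measurable_continuous_lebesgue continuous_intros)
    have m: "(\<lambda>(x, y). ennreal (?h x y)) \<in> borel_measurable (lebesgue \<Otimes>\<^sub>M lebesgue)"
      using G by (auto simp: split_beta')
    have "(\<integral>\<^sup>+ y. ennreal ?c * ennreal (?h x y) \<partial>lebesgue) =
      ennreal ?c * (\<integral>\<^sup>+ y. ennreal (?h x y) \<partial>lebesgue)" for x
      by (rule nn_integral_cmult) measurable
    moreover have "(\<integral>\<^sup>+ x. ennreal ?c * (\<integral>\<^sup>+ y. ennreal (?h x y) \<partial>lebesgue) \<partial>lebesgue)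
      = ennreal ?c * (\<integral>\<^sup>+ x. \<integral>\<^sup>+ y. ennreal (?h x y) \<partial>lebesgue \<partial>lebesgue)"
      by (intro nn_integral_cmult lebesgue.borel_measurable_nn_integral m)
    ultimately show ?thesis by (simp only:)
  qed
  also have "\<dots> \<le> ennreal ?c * (ennreal ((sqrt (2 * pi) * \<delta>) ^ DIM('a)) * ?I)"
    by (intro mult_left_mono schur_gauss d) auto
  \<comment> \<open>The height of the bump and its integral depend on \<open>\<delta>\<close> in
    opposite ways, so the bound is uniform in \<open>\<delta>\<close>.\<close>
  also have "\<dots> = ennreal ((2 * pi) ^ DIM('a)) * ?I"
  proof -
    have "?c * (sqrt (2 * pi) * \<delta>) ^ DIM('a) = (2 * pi) ^ DIM('a)"
      using d by (subst power_mult_distrib[symmetric]) simp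
    moreover have "ennreal ?c * ennreal ((sqrt (2 * pi) * \<delta>) ^ DIM('a)) = ennreal (?c * (sqrt (2 * pi) * \<delta>) ^ DIM('a))"
      using d by (intro ennreal_mult[symmetric]) auto
    ultimately show ?thesis
      by (simp only: mult.assoc[symmetric])
  qed
  finally show ?thesis
    using int by (subst nn_integral_eq_integral) auto
qed

text \<open>As the bound does not depend on the damping, Fatou's lemma removes it along widths
  tending to 0.\<close>

lemma nn_integral_conj_fourier_le:
  fixes f :: "'a::euclidean_space \<Rightarrow> complex"
  assumes f: "integrable lebesgue f"
  shows "(\<integral>\<^sup>+ \<xi>. ennreal ((norm (conj_fourier f \<xi>))\<^sup>2) \<partial>lebesgue)
    \<le> ennreal ((2 * pi) ^ DIM('a)) * (\<integral>\<^sup>+ x. ennreal ((norm (f x))\<^sup>2) \<partial>lebesgue)" (is "_ \<le> ?R")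
proof -
  let ?d = "\<lambda>k. 1 / real (Suc k)"
  let ?u = "\<lambda>k \<xi>. ennreal ((norm (conj_fourier f \<xi>))\<^sup>2 * gauss (?d k *\<^sub>R \<xi>))"
  note [measurable] = borel_measurable_conj_fourier[OF f]
  have lim: "(\<lambda>k. ?u k \<xi>) \<longlonglongrightarrow> ennreal ((norm (conj_fourier f \<xi>))\<^sup>2)" for \<xi>
  proof -
    have "isCont (gauss :: 'a \<Rightarrow> real) 0"
      using continuous_on_gauss[OF continuous_on_id, of "UNIV :: 'a set"] by (simp add: continuous_on_eq_continuous_at)
    moreover have "(\<lambda>k. ?d k *\<^sub>R \<xi>) \<longlonglongrightarrow> 0 *\<^sub>R \<xi>"
      by (intro tendsto_scaleR tendsto_const LIMSEQ_Suc lim_1_over_n)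
    ultimately have "(\<lambda>k. gauss (?d k *\<^sub>R \<xi>)) \<longlonglongrightarrow> 1"
      using isCont_tendsto_compose[of 0 gauss "\<lambda>k. ?d k *\<^sub>R \<xi>"] by simp
    then have "(\<lambda>k. (norm (conj_fourier f \<xi>))\<^sup>2 * gauss (?d k *\<^sub>R \<xi>)) \<longlonglongrightarrow> (norm (conj_fourier f \<xi>))\<^sup>2 * 1"
      by (intro tendsto_mult tendsto_const)
    then show ?thesis by (simp add: tendsto_ennrealI)
  qed
  have [measurable]: "?u k \<in> borel_measurable lebesgue" for k
  proof -
    have "continuous_on UNIV (\<lambda>\<xi>::'a. gauss (?d k *\<^sub>R \<xi>))" by (intro continuous_intros)
    note [measurable] = borel_measurable_continuous_lebesgue[OF this]
    show ?thesis by measurable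
  qed
  have "(\<integral>\<^sup>+ \<xi>. ennreal ((norm (conj_fourier f \<xi>))\<^sup>2) \<partial>lebesgue) = (\<integral>\<^sup>+ \<xi>. liminf (\<lambda>k. ?u k \<xi>) \<partial>lebesgue)"
    by (intro nn_integral_cong lim_imp_Liminf[OF sequentially_bot lim, symmetric])
  also have "\<dots> \<le> liminf (\<lambda>k. \<integral>\<^sup>+ \<xi>. ?u k \<xi> \<partial>lebesgue)"
    by (rule nn_integral_liminf) measurable
  also have "\<dots> \<le> liminf (\<lambda>k. ?R)"
    by (intro Liminf_mono always_eventually allI nn_integral_conj_fourier_gauss_le f) simp
  finally show ?thesis by (simp add: Liminf_const)
qed

subsection \<open>A weak type estimate for functions in \<open>H\<^sup>s\<close>\<close>

lemma square_integrable_conj_fourier: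
  fixes f :: "real ^ 'n::finite \<Rightarrow> complex"
  assumes f: "integrable lebesgue f" and f2: "integrable lebesgue (\<lambda>x. (norm (f x))\<^sup>2)"
  shows "square_integrable (conj_fourier f)"
    and "(LINT \<xi>|lebesgue. (norm (conj_fourier f \<xi>))\<^sup>2) \<le> (2 * pi) ^ CARD('n) * (LINT x|lebesgue. (norm (f x))\<^sup>2)"
proof -
  note [measurable] = borel_measurable_conj_fourier[OF f]
  have le: "(\<integral>\<^sup>+ \<xi>. ennreal ((norm (conj_fourier f \<xi>))\<^sup>2) \<partial>lebesgue)
    \<le> ennreal ((2 * pi) ^ CARD('n) * (LINT x|lebesgue. (norm (f x))\<^sup>2))"
    using nn_integral_conj_fourier_le[OF f] f2
    by (simp add: nn_integral_eq_integral ennreal_mult')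
  have i: "integrable lebesgue (\<lambda>\<xi>. (norm (conj_fourier f \<xi>))\<^sup>2)"
  proof (rule integrableI_bounded)
    show "(\<integral>\<^sup>+ \<xi>. ennreal (norm ((norm (conj_fourier f \<xi>))\<^sup>2)) \<partial>lebesgue) < \<infinity>"
      using le by (simp add: order_le_less_trans)
  qed measurable
  then show "square_integrable (conj_fourier f)"
    by (simp add: square_integrable_def)
  show "(LINT \<xi>|lebesgue. (norm (conj_fourier f \<xi>))\<^sup>2) \<le> (2 * pi) ^ CARD('n) * (LINT x|lebesgue. (norm (f x))\<^sup>2)"
    using le i by (subst (asm) nn_integral_eq_integral) auto
qed

text \<open>It provides a majorant decaying separately in \<open>y\<close> and \<open>z\<close> for
  products in which one Gaussian sits at a point within \<open>norm z\<close> of \<open>y\<close>.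
  The factor 1/2 is the loss in width that makes the quadratic form in \<open>norm x\<close> and
  \<open>norm z\<close> positive.\<close>

lemma gauss_shift_le:
  fixes x y z :: "'a::euclidean_space"
  assumes "norm y \<le> norm x + norm z"
  shows "gauss x * gauss z \<le> gauss ((1 / 2) *\<^sub>R y) * gauss ((1 / 2) *\<^sub>R z)"
proof -
  have "(norm y)\<^sup>2 \<le> (norm x + norm z)\<^sup>2"
    using assms by (intro power_mono) auto
  moreover have "0 \<le> 3 * (norm x - norm z / 3)\<^sup>2 + 5 / 3 * (norm z)\<^sup>2" by simp
  ultimately have "(norm y)\<^sup>2 / 8 + (norm z)\<^sup>2 / 8 \<le> (norm x)\<^sup>2 / 2 + (norm z)\<^sup>2 / 2"
    by (simp add: power2_eq_square field_simps)
  then show ?thesis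
    by (simp add: gauss_def exp_add[symmetric] power_divide)
qed

text \<open>Two Gaussian factors are demanded so that one can be divided off and spent elsewhere
  while the quotient remains integrable.\<close>

lemma integrable_gauss_dominated:
  fixes \<psi> :: "real ^ 'n::finite \<Rightarrow> complex"
  assumes \<psi>: "continuous_on UNIV \<psi>" "\<And>x. norm (\<psi> x) \<le> M * (gauss x * gauss x)"
  shows "integrable lebesgue (\<lambda>x. \<psi> x / of_real (gauss x))"
    and "integrable lebesgue \<psi>"
    and "integrable lebesgue (\<lambda>x. (norm (\<psi> x))\<^sup>2)"
proof -
  have M0: "M \<ge> 0" using \<psi>(2)[of 0] order_trans[OF norm_ge_zero] by fastforce
  have \<psi>m[measurable]: "\<psi> \<in> borel_measurable lebesgue"
    using \<psi>(1) by (rule borel_measurable_continuous_lebesgue)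
  have gsc: "(\<lambda>x :: real^'n. complex_of_real (gauss (c *\<^sub>R x))) \<in> borel_measurable lebesgue" for c
    by (intro borel_measurable_continuous_lebesgue continuous_intros)
  let ?\<psi>0 = "\<lambda>x. \<psi> x / of_real (gauss x)"
  have \<psi>0c: "continuous_on UNIV ?\<psi>0"
    using gauss_pos by (intro continuous_intros \<psi>(1)) auto
  have \<psi>0: "norm (?\<psi>0 x) \<le> M * gauss x" for x
    using \<psi>(2)[of x] gauss_pos[of x] by (simp add: norm_divide divide_le_eq mult.assoc)
  have \<psi>0i: "integrable lebesgue ?\<psi>0"
  proof (rule Bochner_Integration.integrable_bound)
    show "integrable lebesgue (\<lambda>x::real^'n. M * gauss x)"
      using integrable_mult_right[OF integrable_gauss_scaled[of 1, where 'a="real^'n"], of M] by simp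
    show "AE x in lebesgue. norm (?\<psi>0 x) \<le> norm (M * gauss x)"
      using \<psi>0 order_trans[OF _ abs_ge_self] by (intro AE_I2) (auto simp: M0 abs_mult)
  qed (rule borel_measurable_continuous_lebesgue[OF \<psi>0c])
  have \<psi>i: "integrable lebesgue \<psi>"
    using integrable_mult_bounded[OF \<psi>0i gsc[of 1], of 1] gauss_pos by simp
  have \<psi>2: "integrable lebesgue (\<lambda>x. (norm (\<psi> x))\<^sup>2)"
  proof (rule Bochner_Integration.integrable_bound)
    show "integrable lebesgue (\<lambda>x::real^'n. M * norm (\<psi> x))"
      by (intro integrable_mult_right integrable_norm \<psi>i)
    show "AE x in lebesgue. norm ((norm (\<psi> x))\<^sup>2) \<le> norm (M * norm (\<psi> x))"
    proof (intro AE_I2)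
      fix x
      have "norm (\<psi> x) \<le> M"
        using \<psi>(2)[of x] mult_left_le[of "gauss x * gauss x" M] M0 by (simp add: mult_le_one order_trans)
      then show "norm ((norm (\<psi> x))\<^sup>2) \<le> norm (M * norm (\<psi> x))"
        using M0 by (simp add: power2_eq_square abs_mult mult_right_mono)
    qed
  qed measurable
  show "integrable lebesgue ?\<psi>0" "integrable lebesgue \<psi>" "integrable lebesgue (\<lambda>x. (norm (\<psi> x))\<^sup>2)"
    by (fact \<psi>0i \<psi>i \<psi>2)+
qed

text \<open>Since \<open>\<psi>\<close> is merely continuous, \<open>pair\<close> is applied to
  modulated Gaussians instead. Their transforms are bumps around \<open>x\<close>; integrating
  against \<open>\<psi>\<close> in \<open>x\<close> smooths \<open>\<psi>\<close>, and the smoothing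
  disappears in the limit.\<close>

lemma fourier_pairing:
  fixes u g \<psi> :: "real ^ 'n::finite \<Rightarrow> complex"
  assumes u: "square_integrable u" and g: "square_integrable g"
    and pair: "\<And>\<phi>. schwartz \<phi> \<Longrightarrow> (LINT \<xi>|lebesgue. g \<xi> * \<phi> \<xi>) = (LINT x|lebesgue. u x * fourier \<phi> x)"
    and \<psi>: "continuous_on UNIV \<psi>" "\<And>x. norm (\<psi> x) \<le> M * (gauss x * gauss x)"
  shows "(LINT \<xi>|lebesgue. conj_fourier \<psi> \<xi> * g \<xi>) = of_real ((2 * pi) ^ CARD('n)) * (LINT x|lebesgue. u x * \<psi> x)"
proof -
  let ?c = "sqrt (2 * pi) ^ CARD('n)"
  have M0: "M \<ge> 0" using \<psi>(2)[of 0] order_trans[OF norm_ge_zero] by fastforce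
  have um[measurable]: "u \<in> borel_measurable lebesgue" and gm[measurable]: "g \<in> borel_measurable lebesgue"
    and u2: "integrable lebesgue (\<lambda>x. (norm (u x))\<^sup>2)" and g2: "integrable lebesgue (\<lambda>x. (norm (g x))\<^sup>2)"
    using u g by (auto simp: square_integrable_def)
  have [measurable]: "\<psi> \<in> borel_measurable lebesgue"
    using \<psi>(1) by (rule borel_measurable_continuous_lebesgue)
  have gsc: "(\<lambda>x :: real^'n. complex_of_real (gauss (c *\<^sub>R x))) \<in> borel_measurable lebesgue" for c
    by (intro borel_measurable_continuous_lebesgue continuous_intros)
  have gsc2: "integrable lebesgue (\<lambda>x :: real^'n. (norm (complex_of_real (gauss (c *\<^sub>R x))))\<^sup>2)" if "c > 0" for c
  proof -
    have "(norm (complex_of_real (gauss (c *\<^sub>R x))))\<^sup>2 = gauss ((c * sqrt 2) *\<^sub>R x)" for x :: "real^'n"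
      by (simp add: gauss_def exp_double[symmetric] power_mult_distrib mult_ac power2_eq_square[of "exp _"] exp_add[symmetric])
    then show ?thesis using integrable_gauss_scaled[of "c * sqrt 2"] that by simp
  qed
  let ?\<psi>0 = "\<lambda>x. \<psi> x / of_real (gauss x)"
  note \<psi>0i = integrable_gauss_dominated(1)[OF \<psi>] and \<psi>i = integrable_gauss_dominated(2)[OF \<psi>]
    and \<psi>2 = integrable_gauss_dominated(3)[OF \<psi>]
  have F2: "conj_fourier \<psi> \<in> borel_measurable lebesgue" "integrable lebesgue (\<lambda>x. (norm (conj_fourier \<psi> x))\<^sup>2)"
    using square_integrable_conj_fourier(1)[OF \<psi>i \<psi>2] by (auto simp: square_integrable_def)
  have Fg: "integrable lebesgue (\<lambda>\<xi>. conj_fourier \<psi> \<xi> * g \<xi>)"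
    by (rule integrable_mult_L2[OF F2(1) gm F2(2) g2])

  have smoothed: "(LINT \<xi>|lebesgue. conj_fourier \<psi> \<xi> * (g \<xi> * of_real (gauss (\<epsilon> *\<^sub>R \<xi>)))) =
      (LINT y|lebesgue. u y * (of_real ?c * (LINT z|lebesgue. \<psi> (y + \<epsilon> *\<^sub>R z) * of_real (gauss z))))"
    if e: "0 < \<epsilon>" "\<epsilon> \<le> 1" for \<epsilon>
  proof -
    let ?G = "\<lambda>\<xi>. g \<xi> * complex_of_real (gauss (\<epsilon> *\<^sub>R \<xi>))"
    let ?ce = "(sqrt (2 * pi) / \<epsilon>) ^ CARD('n)"
    let ?K = "\<lambda>x y :: real^'n. complex_of_real (?ce * gauss ((x - y) /\<^sub>R \<epsilon>))"
    have G: "integrable lebesgue ?G"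
      by (rule integrable_mult_L2[OF gm gsc g2 gsc2[OF e(1)]])
    have FG: "conj_fourier ?G x = (LINT y|lebesgue. ?K x y * u y)" for x
    proof -
      let ?\<phi> = "\<lambda>\<xi>. cis (x \<bullet> \<xi>) * complex_of_real (gauss (\<epsilon> *\<^sub>R \<xi>))"
      have "fourier ?\<phi> y = conj_fourier (\<lambda>\<xi>. cis (- (\<xi> \<bullet> y)) * of_real (gauss (\<epsilon> *\<^sub>R \<xi>))) x" for y
        unfolding fourier_def conj_fourier_def by (simp add: mult_ac inner_commute)
      then have phi: "fourier ?\<phi> y = ?K x y" for y
        using conj_fourier_gauss[OF e(1), of y x] by simp
      have "conj_fourier ?G x = (LINT \<xi>|lebesgue. g \<xi> * ?\<phi> \<xi>)"
        unfolding conj_fourier_def by (simp add: mult_ac inner_commute)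
      also have "\<dots> = (LINT y|lebesgue. u y * ?K x y)"
        by (subst pair[OF schwartz_gauss_cis[OF e(1)]]) (simp only: phi)
      finally show ?thesis by (simp add: mult.commute)
    qed
    \<comment> \<open>\<open>u\<close> is only square integrable, so Fubini needs a weight:
      \<open>u\<close> receives \<open>gauss ((1 / 2) *\<^sub>R y)\<close>, and the compensating
      quotient in the kernel is kept bounded by the factor \<open>gauss x\<close> taken out of
      \<open>\<psi>\<close>.\<close>
    let ?u = "\<lambda>y. u y * complex_of_real (gauss ((1 / 2) *\<^sub>R y))"
    let ?k = "\<lambda>p. ?K (snd p) (fst p) * of_real (gauss (snd p)) / of_real (gauss ((1 / 2) *\<^sub>R fst p))"
    have ui: "integrable lebesgue ?u"
      by (rule integrable_mult_L2[OF um gsc u2 gsc2]) simp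
    have kc: "continuous_on UNIV ?k"
      using gauss_pos by (intro continuous_intros) auto
    \<comment> \<open>Because \<open>\<epsilon> \<le> 1\<close>, the bump is dominated by the
      Gaussian of unit width, which \<open>gauss_shift_le\<close> can handle.\<close>
    have kb: "norm (?k p) \<le> ?ce" for p
    proof -
      obtain y x where p: "p = (y, x)" by force
      have "gauss ((x - y) /\<^sub>R \<epsilon>) \<le> gauss (x - y)"
      proof -
        have "norm (x - y) \<le> norm ((x - y) /\<^sub>R \<epsilon>)"
          using e mult_right_mono[of 1 "inverse \<epsilon>" "norm (x - y)"]
          by (simp only: norm_scaleR) (simp add: one_le_inverse)
        then show ?thesis unfolding gauss_def by (simp add: power_mono)
      qed
      then have "gauss x * gauss ((x - y) /\<^sub>R \<epsilon>) \<le> gauss x * gauss (x - y)"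
        by (intro mult_left_mono) auto
      also have "\<dots> \<le> gauss ((1 / 2) *\<^sub>R y) * gauss ((1 / 2) *\<^sub>R (x - y))" using norm_triangle_ineq4[of x "x - y"] by (intro gauss_shift_le) simp
      also have "\<dots> \<le> gauss ((1 / 2) *\<^sub>R y)" by (intro mult_left_le) auto
      finally have "gauss x * gauss ((x - y) /\<^sub>R \<epsilon>) / gauss ((1 / 2) *\<^sub>R y) \<le> 1"
        by (simp only: divide_le_eq_1_pos gauss_pos)
      then have "?ce * (gauss x * gauss ((x - y) /\<^sub>R \<epsilon>) / gauss ((1 / 2) *\<^sub>R y)) \<le> ?ce"
        using e by (intro mult_left_le) auto
      then show ?thesis
        using e unfolding p by (simp add: norm_mult norm_divide norm_power mult_ac)
    qed
    have "(LINT \<xi>|lebesgue. conj_fourier \<psi> \<xi> * ?G \<xi>) = (LINT x|lebesgue. \<psi> x * (LINT y|lebesgue. ?K x y * u y))"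
      by (subst conj_fourier_mult_formula[OF \<psi>i G]) (simp only: FG)
    also have "\<dots> = (LINT x|lebesgue. (LINT y|lebesgue. ?k (y, x) * ?u y) * ?\<psi>0 x)"
    proof (intro Bochner_Integration.integral_cong refl)
      fix x :: "real^'n"
      have "(LINT y|lebesgue. ?k (y, x) * ?u y) = (LINT y|lebesgue. of_real (gauss x) * (?K x y * u y))"
        using gauss_pos by (intro Bochner_Integration.integral_cong refl) simp
      also have "\<dots> = of_real (gauss x) * (LINT y|lebesgue. ?K x y * u y)"
        by (rule integral_mult_right_zero)
      finally show "\<psi> x * (LINT y|lebesgue. ?K x y * u y) = (LINT y|lebesgue. ?k (y, x) * ?u y) * ?\<psi>0 x"
        by (simp only:) simp
    qed
    also have "\<dots> = (LINT y|lebesgue. ?u y * (LINT x|lebesgue. ?k (y, x) * ?\<psi>0 x))"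
      by (rule Fubini_bounded_kernel[OF ui \<psi>0i kc kb])
    also have "\<dots> = (LINT y|lebesgue. u y * (of_real ?c * (LINT z|lebesgue. \<psi> (y + \<epsilon> *\<^sub>R z) * of_real (gauss z))))"
    proof (intro Bochner_Integration.integral_cong refl)
      fix y :: "real^'n"
      let ?f = "\<lambda>x. \<psi> x * of_real (gauss ((x - y) /\<^sub>R \<epsilon>))"
      let ?f' = "\<lambda>z. \<psi> (y + \<epsilon> *\<^sub>R z) * of_real (gauss z)"
      have fm: "?f \<in> borel_measurable borel" 
        by (intro borel_measurable_continuous_onI continuous_intros \<psi>(1))
      have fm': "?f' \<in> borel_measurable borel" 
        by (intro borel_measurable_continuous_onI continuous_intros continuous_on_compose2[OF \<psi>(1)]) auto
      have ff': "?f (y + \<epsilon> *\<^sub>R z) = ?f' z" for z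
        using e by simp
      have "(LINT x|lebesgue. ?k (y, x) * ?\<psi>0 x) = (LINT x|lebesgue. of_real (?ce / gauss ((1 / 2) *\<^sub>R y)) * ?f x)"
        using gauss_pos by (intro Bochner_Integration.integral_cong refl) simp
      also have "\<dots> = of_real (?ce / gauss ((1 / 2) *\<^sub>R y)) * (LINT x|lebesgue. ?f x)"
        by (rule integral_mult_right_zero)
      also have "(LINT x|lebesgue. ?f x) = (LINT x|lborel. ?f x)"
        using fm by (simp add: integral_completion)
      also have "\<dots> = \<epsilon> ^ CARD('n) *\<^sub>R (LINT x|lborel. ?f' x)"
        using integral_lborel_scale(1)[OF _ fm, of \<epsilon> y] e unfolding ff' by simp
      also have "(LINT x|lborel. ?f' x) = (LINT x|lebesgue. ?f' x)"
        using fm' by (simp add: integral_completion)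
      finally have "?u y * (LINT x|lebesgue. ?k (y, x) * ?\<psi>0 x) =
        ?u y * (of_real (?ce / gauss ((1 / 2) *\<^sub>R y)) * (\<epsilon> ^ CARD('n) *\<^sub>R (LINT x|lebesgue. ?f' x)))"
        by (simp only:)
      also have "\<dots> = u y * (of_real (?ce * \<epsilon> ^ CARD('n)) * (LINT x|lebesgue. ?f' x))"
        using gauss_pos[of "(1 / 2) *\<^sub>R y"] by (simp add: scaleR_conv_of_real)
      also have "?ce * \<epsilon> ^ CARD('n) = ?c"
        using e by (simp add: power_divide)
      finally show "?u y * (LINT x|lebesgue. ?k (y, x) * ?\<psi>0 x) =
        u y * (of_real ?c * (LINT x|lebesgue. ?f' x))" .
    qed
    finally show ?thesis .
  qed

  let ?e = "\<lambda>k. 1 / real (Suc k)"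
  have e: "0 < ?e k" "?e k \<le> 1" for k by auto
  have e0: "?e \<longlonglongrightarrow> 0" by (rule LIMSEQ_Suc[OF lim_1_over_n])
  let ?G = "\<lambda>k \<xi>. conj_fourier \<psi> \<xi> * (g \<xi> * of_real (gauss (?e k *\<^sub>R \<xi>)))"
  let ?p = "\<lambda>k y z. \<psi> (y + ?e k *\<^sub>R z) * of_real (gauss z)"
  let ?b = "\<lambda>y z. M * (gauss ((1 / 2) *\<^sub>R y) * gauss ((1 / 2) *\<^sub>R (z::real^'n)))"
  let ?ug = "\<lambda>y. u y * complex_of_real (gauss ((1 / 2) *\<^sub>R y))"
  have L1: "(\<lambda>k. LINT \<xi>|lebesgue. ?G k \<xi>) \<longlonglongrightarrow>
      (LINT \<xi>|lebesgue. conj_fourier \<psi> \<xi> * g \<xi>)"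
  proof (rule integral_dominated_convergence)
    show "integrable lebesgue (\<lambda>\<xi>. norm (conj_fourier \<psi> \<xi> * g \<xi>))"
      using Fg by (rule integrable_norm)
    show "(\<lambda>\<xi>. ?G k \<xi>) \<in> borel_measurable lebesgue" for k
      using F2(1) gm gsc by (intro borel_measurable_times)
    show "AE \<xi> in lebesgue. (\<lambda>k. ?G k \<xi>) \<longlonglongrightarrow> conj_fourier \<psi> \<xi> * g \<xi>"
    proof (intro AE_I2)
      fix \<xi> :: "real^'n"
      have "continuous_on UNIV (\<lambda>t. gauss (t *\<^sub>R \<xi>))" by (intro continuous_intros)
      then have "(\<lambda>k. gauss (?e k *\<^sub>R \<xi>)) \<longlonglongrightarrow> gauss (0 *\<^sub>R \<xi>)"
        by (intro isCont_tendsto_compose[OF _ e0, of "\<lambda>t. gauss (t *\<^sub>R \<xi>)"]) (simp add: continuous_on_eq_continuous_at)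
      then have "(\<lambda>k. ?G k \<xi>) \<longlonglongrightarrow>
        conj_fourier \<psi> \<xi> * (g \<xi> * of_real (gauss (0 *\<^sub>R \<xi>)))"
        by (intro tendsto_intros)
      then show "(\<lambda>k. ?G k \<xi>) \<longlonglongrightarrow> conj_fourier \<psi> \<xi> * g \<xi>"
        by simp
    qed
    show "AE \<xi> in lebesgue. norm (?G k \<xi>) \<le> norm (conj_fourier \<psi> \<xi> * g \<xi>)" for k
      by (intro AE_I2) (simp add: norm_mult mult_left_le mult.assoc[symmetric])
  qed (use F2(1) gm in measurable)
  let ?I = "\<lambda>k y. LINT z|lebesgue. ?p k y z"
  let ?C = "LINT z|lebesgue. gauss ((1 / 2) *\<^sub>R (z::real^'n))"
  \<comment> \<open>The majorant is independent of \<open>k\<close>: it serves for dominated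
    convergence in \<open>z\<close> and, after integration in \<open>z\<close>, for dominated
    convergence in \<open>y\<close>.\<close>
  have bound: "norm (?p k y z) \<le> M * (gauss ((1 / 2) *\<^sub>R y) * gauss ((1 / 2) *\<^sub>R z))" for k y z
  proof -
    let ?x = "y + ?e k *\<^sub>R z"
    have "norm (\<psi> ?x * of_real (gauss z)) \<le> M * (gauss ?x * gauss z)"
    proof -
      have "norm (\<psi> ?x) \<le> M * (gauss ?x * gauss ?x)" by (rule \<psi>)
      also have "\<dots> \<le> M * gauss ?x" by (intro mult_left_mono mult_left_le M0) auto
      finally have "norm (\<psi> ?x) * gauss z \<le> M * gauss ?x * gauss z"
        by (rule mult_right_mono) simp
      then show ?thesis by (simp add: norm_mult mult.assoc)
    qed
    moreover have "gauss ?x * gauss z \<le> gauss ((1 / 2) *\<^sub>R y) * gauss ((1 / 2) *\<^sub>R z)"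
    proof -
      have nz: "norm (?e k *\<^sub>R z) \<le> norm z"
        using mult_right_mono[OF e(2)[of k], of "norm z"] by simp
      have "norm y \<le> norm ?x + norm z"
        using norm_triangle_ineq4[of ?x "?e k *\<^sub>R z"] nz by simp
      then show ?thesis by (rule gauss_shift_le)
    qed
    ultimately show ?thesis
      using M0 by (meson mult_left_mono order_trans)
  qed
  have half: "integrable lebesgue (\<lambda>z::real^'n. gauss ((1 / 2) *\<^sub>R z))"
    by (rule integrable_gauss_scaled) simp
  have \<psi>t: "(\<lambda>z. \<psi> (y + c *\<^sub>R z) * of_real (gauss z)) \<in> borel_measurable lebesgue" for y c
    by (intro borel_measurable_continuous_lebesgue continuous_intros continuous_on_compose2[OF \<psi>(1)]) auto
  have cint: "(LINT z|lebesgue. complex_of_real (gauss (z::real^'n))) = of_real ?c"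
    using has_bochner_integral_gauss_cis_scaled[of 1 "0::real^'n"] by (simp add: has_bochner_integral_iff)
  have Ilim: "(\<lambda>k. ?I k y) \<longlonglongrightarrow> \<psi> y * of_real ?c" for y
  proof -
    have "(\<lambda>k. ?I k y) \<longlonglongrightarrow> (LINT z|lebesgue. \<psi> y * of_real (gauss (z::real^'n)))"
    proof (rule integral_dominated_convergence)
      show "integrable lebesgue (\<lambda>z::real^'n. ?b y z)"
        by (intro integrable_mult_right half)
      show "AE z in lebesgue. (\<lambda>k. ?p k y z) \<longlonglongrightarrow> \<psi> y * of_real (gauss z)"
      proof (intro AE_I2)
        fix z :: "real^'n"
        have "(\<lambda>k. y + ?e k *\<^sub>R z) \<longlonglongrightarrow> y + 0 *\<^sub>R z" by (intro tendsto_intros e0)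
        then have "(\<lambda>k. \<psi> (y + ?e k *\<^sub>R z)) \<longlonglongrightarrow> \<psi> y"
          using \<psi>(1) by (intro isCont_tendsto_compose[of y \<psi>]) (simp_all add: continuous_on_eq_continuous_at)
        then show "(\<lambda>k. ?p k y z) \<longlonglongrightarrow> \<psi> y * of_real (gauss z)"
          by (intro tendsto_intros)
      qed
      show "AE z in lebesgue. norm (?p k y z) \<le> M * (gauss ((1 / 2) *\<^sub>R y) * gauss ((1 / 2) *\<^sub>R z))" for k
        by (intro AE_I2 bound)
    qed (use \<psi>t[of y 0] \<psi>t in simp_all)
    also have "(LINT z|lebesgue. \<psi> y * of_real (gauss (z::real^'n))) = \<psi> y * of_real ?c"
      by (subst integral_mult_right_zero) (simp only: cint)
    finally show ?thesis .
  qed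
  have Ib: "norm (?I k y) \<le> M * (gauss ((1 / 2) *\<^sub>R y) * ?C)" for k y
  proof -
    have b: "integrable lebesgue (\<lambda>z::real^'n. ?b y z)"
      by (intro integrable_mult_right half)
    have "norm (?I k y) \<le> (LINT z|lebesgue. norm (?p k y z))"
      by (rule integral_norm_bound)
    also have "\<dots> \<le> (LINT z|lebesgue. ?b y z)"
      using bound order_trans[OF bound abs_ge_self]
      by (intro integral_mono b integrable_norm Bochner_Integration.integrable_bound[OF b \<psi>t] AE_I2) auto
    also have "\<dots> = M * (gauss ((1 / 2) *\<^sub>R y) * ?C)"
      by (simp only: integral_mult_right_zero)
    finally show ?thesis .
  qed
  have Im[measurable]: "?I k \<in> borel_measurable lebesgue" for k
  proof (rule lebesgue.borel_measurable_lebesgue_integral)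
    have "continuous_on UNIV (\<lambda>p. \<psi> (fst p + ?e k *\<^sub>R snd p) * of_real (gauss (snd p)))"
      by (intro continuous_intros continuous_on_compose2[OF \<psi>(1)]) auto
    then show "(\<lambda>(y, z). ?p k y z) \<in> borel_measurable (lebesgue \<Otimes>\<^sub>M lebesgue)"
      by (intro borel_measurable_continuous_lebesgue_pair) (simp add: split_beta')
  qed
  have L2: "(\<lambda>k. LINT y|lebesgue. u y * (of_real ?c * ?I k y)) \<longlonglongrightarrow>
      (LINT y|lebesgue. u y * (of_real ?c * (\<psi> y * of_real ?c)))"
  proof (rule integral_dominated_convergence)
    have "integrable lebesgue (\<lambda>y. norm (?ug y))"
      by (intro integrable_norm integrable_mult_L2[OF um gsc u2 gsc2]) simp
    then show "integrable lebesgue (\<lambda>y. ?c * (M * ?C) * norm (?ug y))"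
      by (rule integrable_mult_right)
    show "AE y in lebesgue. (\<lambda>k. u y * (of_real ?c * ?I k y)) \<longlonglongrightarrow> u y * (of_real ?c * (\<psi> y * of_real ?c))"
      by (intro AE_I2 tendsto_mult tendsto_const Ilim)
    show "AE y in lebesgue. norm (u y * (of_real ?c * ?I k y)) \<le> ?c * (M * ?C) * norm (?ug y)" for k
    proof (intro AE_I2)
      fix y
      have "norm (u y) * ?c * norm (?I k y) \<le> norm (u y) * ?c * (M * (gauss ((1 / 2) *\<^sub>R y) * ?C))"
        by (intro mult_left_mono Ib) auto
      then show "norm (u y * (of_real ?c * ?I k y)) \<le> ?c * (M * ?C) * norm (?ug y)"
        by (simp add: norm_mult norm_power mult_ac)
    qed
  qed measurable
  have "(LINT \<xi>|lebesgue. conj_fourier \<psi> \<xi> * g \<xi>) = (LINT y|lebesgue. u y * (of_real ?c * (\<psi> y * of_real ?c)))"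
    using L1 L2 unfolding smoothed[OF e] by (rule LIMSEQ_unique)
  also have "\<dots> = (LINT y|lebesgue. of_real (?c * ?c) * (u y * \<psi> y))"
    by (simp add: mult_ac)
  also have "\<dots> = of_real (?c * ?c) * (LINT y|lebesgue. u y * \<psi> y)"
    by (rule integral_mult_right_zero)
  \<comment> \<open>One factor \<open>?c\<close> is the normalization of the smoothing kernel, the
    other is the integral of \<open>gauss\<close>.\<close>
  also have "?c * ?c = (2 * pi) ^ CARD('n)"
    by (subst power_mult_distrib[symmetric]) simp
  finally show ?thesis .
qed

text \<open>On the dyadic layer where \<open>f\<close> lies between \<open>2 ^ k\<close> and
  \<open>2 ^ Suc k\<close> the integral is at most a constant times
  \<open>(2 powr (b - q)) ^ k\<close>, a convergent geometric series. The measure is general because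
  the lemma serves Lebesgue measure on balls as well as the measure with density
  \<open>norm (F y)\<close>.\<close>

lemma nn_integral_powr_finite_if_weak_type:
  fixes f :: "'a \<Rightarrow> real"
  assumes [measurable]: "f \<in> borel_measurable M" and f0: "\<And>x. 0 \<le> f x"
    and fin: "emeasure M (space M) < \<infinity>" and C: "C \<ge> 0"
    and weak: "\<And>t. t \<ge> 1 \<Longrightarrow> emeasure M {x \<in> space M. t < f x} \<le> ennreal (C * t powr (- q))"
    and b: "0 < b" "b < q"
  shows "(\<integral>\<^sup>+ x. ennreal (f x powr b) \<partial>M) < \<infinity>"
proof -
  let ?A = "\<lambda>k::nat. {x \<in> space M. 2 ^ k < f x}"
  let ?w = "\<lambda>k::nat. (2 powr b) ^ Suc k"
  have pt: "ennreal (f x powr b) \<le> 1 + (\<Sum>k. ennreal (?w k) * indicator (?A k) x)" if x: "x \<in> space M" for x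
  proof (cases "f x \<le> 1")
    case True
    then have "f x powr b \<le> 1 powr b" using b f0 by (intro powr_mono2) auto
    then have "ennreal (f x powr b) \<le> 1" by (simp add: ennreal_le_1)
    then show ?thesis by (rule order_trans) simp
  next
    case False
    obtain k0 where "f x < 2 ^ k0" using real_arch_pow[of 2 "f x"] by auto
    then have ex: "\<exists>k. f x \<le> 2 ^ k" by (auto intro: less_imp_le)
    \<comment> \<open>Minimality puts \<open>f x\<close> into the layer above \<open>2 ^ j\<close>
      and up to \<open>2 ^ Suc j\<close>; there is a predecessor \<open>j\<close> because
      \<open>f x\<close> exceeds 1.\<close>
    define k where "k = (LEAST k. f x \<le> 2 ^ k)"
    have k: "f x \<le> 2 ^ k" unfolding k_def using ex by (rule LeastI_ex)
    with False obtain j where j: "k = Suc j" by (cases k) auto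
    have "\<not> f x \<le> 2 ^ j" using not_less_Least[of j "\<lambda>k. f x \<le> 2 ^ k"] j k_def by auto
    then have xj: "x \<in> ?A j" using x by simp
    have "f x powr b \<le> (2 ^ Suc j) powr b"
      using k j b f0 by (intro powr_mono2) auto
    also have "\<dots> = ?w j" by (simp only: powr_realpow[symmetric] zero_less_numeral powr_gt_zero powr_powr mult.commute)
    finally have "ennreal (f x powr b) \<le> ennreal (?w j) * indicator (?A j) x"
      using xj by (simp add: ennreal_leI)
    also have "\<dots> = (\<Sum>k\<in>{j}. ennreal (?w k) * indicator (?A k) x)"
      by (simp only: sum.insert finite.emptyI empty_iff not_False_eq_True sum.empty add_0_right)
    also have "\<dots> \<le> (\<Sum>k. ennreal (?w k) * indicator (?A k) x)"
      by (rule sum_le_suminf) auto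
    finally show ?thesis by (rule order_trans) simp
  qed
  have "(\<integral>\<^sup>+ x. ennreal (f x powr b) \<partial>M) \<le> (\<integral>\<^sup>+ x. 1 + (\<Sum>k. ennreal (?w k) * indicator (?A k) x) \<partial>M)"
    by (intro nn_integral_mono pt)
  also have "\<dots> = (\<integral>\<^sup>+ x. 1 \<partial>M) + (\<integral>\<^sup>+ x. (\<Sum>k. ennreal (?w k) * indicator (?A k) x) \<partial>M)"
    by (rule nn_integral_add) measurable
  also have "(\<integral>\<^sup>+ x. (\<Sum>k. ennreal (?w k) * indicator (?A k) x) \<partial>M) = (\<Sum>k. \<integral>\<^sup>+ x. ennreal (?w k) * indicator (?A k) x \<partial>M)"
    by (rule nn_integral_suminf) measurable
  also have "\<dots> = (\<Sum>k. ennreal (?w k) * emeasure M (?A k))"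
    by (intro suminf_cong nn_integral_cmult_indicator) measurable
  also have "\<dots> \<le> (\<Sum>k. ennreal (C * 2 powr b * (2 powr (b - q)) ^ k))"
  proof (intro suminf_le summableI)
    fix k
    have "ennreal (?w k) * emeasure M (?A k) \<le> ennreal (?w k) * ennreal (C * (2 ^ k) powr (- q))"
      by (intro mult_left_mono weak) auto
    also have "\<dots> = ennreal (?w k * (C * (2 ^ k) powr (- q)))"
      by (rule ennreal_mult[symmetric]) (auto simp: C)
    also have "?w k * (C * (2 ^ k) powr (- q)) = C * 2 powr b * ((2 powr b) ^ k * (2 ^ k) powr (- q))"
      by simp
    also have "(2 ^ k) powr (- q) = (2 powr (- q)) ^ k"
      by (simp only: powr_realpow[symmetric] zero_less_numeral powr_gt_zero powr_powr mult.commute)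
    also have "(2 powr b) ^ k * (2 powr (- q)) ^ k = (2 powr (b - q)) ^ k"
      by (simp only: power_mult_distrib[symmetric] powr_add[symmetric]) simp
    finally show "ennreal (?w k) * emeasure M (?A k) \<le> ennreal (C * 2 powr b * (2 powr (b - q)) ^ k)" .
  qed
  also have "\<dots> = ennreal (\<Sum>k. C * 2 powr b * (2 powr (b - q)) ^ k)"
  proof (intro suminf_ennreal2 summable_mult summable_geometric)
    have "2 powr (b - q) < 2 powr 0" using b by (intro powr_less_mono) auto
    then show "norm (2 powr (b - q)) < 1" by simp
  qed (use C in auto)
  finally show ?thesis using fin by (auto simp: order_le_less_trans ennreal_add_less_top)
qed

text \<open>On the Fourier side, frequencies below \<open>\<mu>\<close> are paid for by the supremum
  of the transform of \<open>\<psi>\<close>, those above by the Sobolev weight. The free parameter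
  \<open>t\<close> balances the two factors of the high-frequency part.\<close>

lemma sobolev_pairing_bound:
  fixes u :: "real ^ 'n::finite \<Rightarrow> complex"
  assumes "sobolev_H s u" and s: "0 < s"
  obtains A where "A \<ge> 0"
    and "\<forall>\<psi> \<mu> t M. continuous_on UNIV \<psi> \<longrightarrow> (\<forall>x. norm (\<psi> x) \<le> M * (gauss x * gauss x)) \<longrightarrow> \<mu> > 0 \<longrightarrow> t > 0 \<longrightarrow>
      norm (LINT x|lebesgue. u x * \<psi> x) \<le> A * (\<mu> powr (real CARD('n) / 2) * (LINT x|lebesgue. norm (\<psi> x))
        + t * \<mu> powr (- 2 * s) + (LINT x|lebesgue. (norm (\<psi> x))\<^sup>2) / t)"
proof -
  let ?n = "real CARD('n)"
  obtain g where u: "square_integrable u" and g: "square_integrable g"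
    and gs: "integrable lebesgue (\<lambda>\<xi>. (1 + (norm \<xi>)\<^sup>2) powr s * (norm (g \<xi>))\<^sup>2)"
    and pair: "\<And>\<phi>. schwartz \<phi> \<Longrightarrow> (LINT \<xi>|lebesgue. g \<xi> * \<phi> \<xi>) = (LINT x|lebesgue. u x * fourier \<phi> x)"
    using assms(1) by (auto simp: sobolev_H_def)
  have gm[measurable]: "g \<in> borel_measurable lebesgue" and g2: "integrable lebesgue (\<lambda>\<xi>. (norm (g \<xi>))\<^sup>2)"
    using g by (auto simp: square_integrable_def)
  define G where "G = (LINT \<xi>|lebesgue. (norm (g \<xi>))\<^sup>2)"
  define Gs where "Gs = (LINT \<xi>|lebesgue. (1 + (norm \<xi>)\<^sup>2) powr s * (norm (g \<xi>))\<^sup>2)"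
  define \<omega> where "\<omega> = measure lebesgue (ball (0 :: real^'n) 1)"
  have nonneg: "G \<ge> 0" "Gs \<ge> 0" "\<omega> \<ge> 0" by (auto simp: G_def Gs_def \<omega>_def)
  define A where "A = G + \<omega> + Gs + (2 * pi) ^ CARD('n)"
  have A: "G + \<omega> \<le> A" "Gs \<le> A" "(2 * pi) ^ CARD('n) \<le> A" "0 \<le> A"
    using nonneg by (auto simp: A_def)
  have bound: "norm (LINT x|lebesgue. u x * \<psi> x) \<le> A * (\<mu> powr (?n / 2) * (LINT x|lebesgue. norm (\<psi> x))
      + t * \<mu> powr (- 2 * s) + (LINT x|lebesgue. (norm (\<psi> x))\<^sup>2) / t)"
    if \<psi>: "continuous_on UNIV \<psi>" "\<And>x. norm (\<psi> x) \<le> M * (gauss x * gauss x)" and \<mu>: "\<mu> > 0" and t: "t > 0" for \<psi> \<mu> t M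
  proof -
    have \<psi>i: "integrable lebesgue \<psi>" and \<psi>2: "integrable lebesgue (\<lambda>x. (norm (\<psi> x))\<^sup>2)"
      by (fact integrable_gauss_dominated[OF \<psi>])+
    let ?F = "conj_fourier \<psi>"
    let ?P = "LINT x|lebesgue. norm (\<psi> x)"
    let ?P2 = "LINT x|lebesgue. (norm (\<psi> x))\<^sup>2" and ?F2 = "LINT \<xi>|lebesgue. (norm (?F \<xi>))\<^sup>2"
    let ?gs = "\<lambda>\<xi>. (1 + (norm \<xi>)\<^sup>2) powr s * (norm (g \<xi>))\<^sup>2"
    \<comment> \<open>The weights \<open>\<mu> powr (?n / 2)\<close> and its inverse are balanced:
      as the ball has volume proportional to \<open>\<mu> powr ?n\<close>, both summands integrate
      to multiples of \<open>\<mu> powr (?n / 2)\<close>.\<close>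
    let ?gl = "\<lambda>\<xi>. ?P * (\<mu> powr (?n / 2) * (norm (g \<xi>))\<^sup>2 + \<mu> powr (- (?n / 2)) * indicator (ball 0 \<mu>) \<xi>)"
    have P0: "?P \<ge> 0" by simp
    note Fm[measurable] = borel_measurable_conj_fourier[OF \<psi>i]
    have F2: "integrable lebesgue (\<lambda>\<xi>. (norm (?F \<xi>))\<^sup>2)"
      and F2le: "?F2 \<le> (2 * pi) ^ CARD('n) * ?P2"
      using square_integrable_conj_fourier[OF \<psi>i \<psi>2] by (auto simp: square_integrable_def)
    let ?B = "ball (0 :: real^'n) \<mu>"
    let ?U = "\<lambda>\<xi>. ?gl \<xi>
        + (t * \<mu> powr (- 2 * s) * ?gs \<xi> + (norm (?F \<xi>))\<^sup>2 / t)"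
    have amgm: "a * b \<le> r * b\<^sup>2 + a\<^sup>2 / r" if "r > 0" for a b r :: real
    proof -
      have "0 \<le> (sqrt r * b - a / sqrt r)\<^sup>2 + r * b\<^sup>2 + a\<^sup>2 / r" using that by simp
      also have "\<dots> = 2 * (r * b\<^sup>2 + a\<^sup>2 / r - a * b)"
        using that by (simp add: power2_eq_square field_simps)
      finally show ?thesis by simp
    qed
    have pt: "norm (?F \<xi> * g \<xi>) \<le> ?U \<xi>" for \<xi>
    proof (cases "\<xi> \<in> ?B")
      case True
      have "norm (?F \<xi> * g \<xi>) \<le> ?P * (1 * norm (g \<xi>))"
        unfolding norm_mult mult_1_left by (intro mult_right_mono norm_conj_fourier_le \<psi>i) auto
      also have "\<dots> \<le> ?P * (\<mu> powr (?n / 2) * (norm (g \<xi>))\<^sup>2 + 1\<^sup>2 / \<mu> powr (?n / 2))"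
        using \<mu> by (intro mult_left_mono amgm P0) auto
      also have "\<dots> = ?gl \<xi>"
        using True by (simp add: powr_minus field_simps)
      also have "\<dots> \<le> ?U \<xi>" using t by simp
      finally show ?thesis .
    next
      case False
      \<comment> \<open>Beyond radius \<open>\<mu>\<close> the weight
        \<open>(1 + (norm \<xi>)\<^sup>2) powr s\<close> is at least
        \<open>\<mu> powr (2 * s)\<close>, which yields the gain
        \<open>\<mu> powr (- 2 * s)\<close>.\<close>
      then have "\<mu> \<le> norm \<xi>" by simp
      then have "\<mu>\<^sup>2 \<le> (norm \<xi>)\<^sup>2"
        using \<mu> by (intro power_mono) auto
      then have "\<mu>\<^sup>2 \<le> 1 + (norm \<xi>)\<^sup>2" by simp
      then have "(\<mu>\<^sup>2) powr s \<le> (1 + (norm \<xi>)\<^sup>2) powr s"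
        using \<mu> s by (intro powr_mono2) auto
      moreover have "(\<mu>\<^sup>2) powr s = \<mu> powr (2 * s)"
        using \<mu> by (simp add: powr_powr flip: powr_numeral)
      ultimately have "\<mu> powr (- 2 * s) * \<mu> powr (2 * s) \<le> \<mu> powr (- 2 * s) * (1 + (norm \<xi>)\<^sup>2) powr s"
        by (intro mult_left_mono) auto
      then have "1 \<le> \<mu> powr (- 2 * s) * (1 + (norm \<xi>)\<^sup>2) powr s"
        using \<mu> by (simp add: powr_add[symmetric])
      then have "t * (norm (g \<xi>))\<^sup>2 * 1 \<le> t * (norm (g \<xi>))\<^sup>2 * (\<mu> powr (- 2 * s) * (1 + (norm \<xi>)\<^sup>2) powr s)"
        using t by (intro mult_left_mono) auto
      moreover have "norm (?F \<xi> * g \<xi>) \<le> t * (norm (g \<xi>))\<^sup>2 + (norm (?F \<xi>))\<^sup>2 / t"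
        unfolding norm_mult by (rule amgm[OF t])
      ultimately have "norm (?F \<xi> * g \<xi>) \<le> t * \<mu> powr (- 2 * s) * ?gs \<xi> + (norm (?F \<xi>))\<^sup>2 / t"
        by (simp add: mult_ac)
      then show ?thesis by (rule order_trans) (use P0 in simp)
    qed
    have B: "?B \<in> lmeasurable" by simp
    have Bi: "integrable lebesgue (\<lambda>\<xi>. indicator ?B \<xi> :: real)"
      using B by (simp add: lmeasurable_iff_integrable)
    have mB: "measure lebesgue ?B = \<mu> powr ?n * \<omega>"
      using content_ball_conv_unit_ball[of \<mu> "0::real^'n"] \<mu> unfolding \<omega>_def
      by (simp add: powr_realpow)
    have i1: "integrable lebesgue (\<lambda>\<xi>. ?gl \<xi>)"
      by (intro integrable_mult_right Bochner_Integration.integrable_add g2 Bi)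
    have i2: "integrable lebesgue (\<lambda>\<xi>. t * \<mu> powr (- 2 * s) * ?gs \<xi> + (norm (?F \<xi>))\<^sup>2 / t)"
      by (intro integrable_mult_right Bochner_Integration.integrable_add gs integrable_divide F2)
    have Ui: "integrable lebesgue ?U"
      by (intro Bochner_Integration.integrable_add i1 i2)
    have "(LINT \<xi>|lebesgue. ?U \<xi>) = ?P * (\<mu> powr (?n / 2) * G + \<mu> powr (- (?n / 2)) * measure lebesgue ?B)
        + (t * \<mu> powr (- 2 * s) * Gs + ?F2 / t)"
      unfolding G_def Gs_def
      using g2 gs F2 Bi by (simp add: Bochner_Integration.integral_add[OF i1 i2])
    also have "\<mu> powr (- (?n / 2)) * measure lebesgue ?B = \<mu> powr (?n / 2) * \<omega>"
      unfolding mB mult.assoc[symmetric] powr_add[symmetric] by simp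
    also have "?P * (\<mu> powr (?n / 2) * G + \<mu> powr (?n / 2) * \<omega>) + (t * \<mu> powr (- 2 * s) * Gs + ?F2 / t)
      \<le> ?P * (\<mu> powr (?n / 2) * A) + (t * \<mu> powr (- 2 * s) * A + A * ?P2 / t)"
    proof (intro add_mono mult_left_mono divide_right_mono P0)
      show "\<mu> powr (?n / 2) * G + \<mu> powr (?n / 2) * \<omega> \<le> \<mu> powr (?n / 2) * A"
        unfolding distrib_left[symmetric] by (intro mult_left_mono A) auto
      show "?F2 \<le> A * ?P2"
        using F2le by (rule order_trans) (intro mult_right_mono A, simp)
    qed (use t A in auto)
    also have "\<dots> = A * (\<mu> powr (?n / 2) * ?P + t * \<mu> powr (- 2 * s) + ?P2 / t)" (is "_ = ?R")
      by (simp add: algebra_simps)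
    finally have UR: "(LINT \<xi>|lebesgue. ?U \<xi>) \<le> ?R" .
    have eq: "(LINT \<xi>|lebesgue. ?F \<xi> * g \<xi>) = of_real ((2 * pi) ^ CARD('n)) * (LINT x|lebesgue. u x * \<psi> x)"
      by (rule fourier_pairing[OF u g pair \<psi>])
    have one: "1 \<le> (2 * pi) ^ CARD('n)"
      using pi_gt3 by (intro one_le_power) auto
    have "norm (LINT x|lebesgue. u x * \<psi> x) \<le> (2 * pi) ^ CARD('n) * norm (LINT x|lebesgue. u x * \<psi> x)"
      using mult_right_mono[OF one, of "norm (LINT x|lebesgue. u x * \<psi> x)"] by simp
    also have "\<dots> = norm (LINT \<xi>|lebesgue. ?F \<xi> * g \<xi>)"
      unfolding eq norm_mult norm_of_real by simp
    also have "\<dots> \<le> (LINT \<xi>|lebesgue. ?U \<xi>)"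
      by (rule Bochner_Integration.integral_norm_bound_integral[OF _ Ui pt])
         (intro Bochner_Integration.integrable_bound[OF Ui], measurable, rule AE_I2, rule order_trans[OF pt], simp)
    finally show ?thesis using UR by simp
  qed
  show thesis
    by (rule that[OF A(4)], intro allI impI, rule bound) auto
qed

text \<open>The indicator of \<open>K\<close> is a limit of continuous cut-offs with a common
  bounded support. The set must be nonempty since \<open>infdist\<close> to the empty set is 0,
  which would turn every cut-off into the constant 1.\<close>

lemma sobolev_compact_bound:
  fixes u :: "real ^ 'n::finite \<Rightarrow> complex"
  assumes "sobolev_H s u" and s: "0 < s"
  obtains A where "A \<ge> 0"
    and "\<forall>K \<mu> t. compact K \<longrightarrow> K \<noteq> {} \<longrightarrow> \<mu> > 0 \<longrightarrow> t > 0 \<longrightarrow>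
      norm (LINT x|lebesgue. u x * indicator K x) \<le> A * (\<mu> powr (real CARD('n) / 2) * measure lebesgue K
        + t * \<mu> powr (- 2 * s) + measure lebesgue K / t)"
proof -
  let ?n = "real CARD('n)"
  obtain A where A0: "A \<ge> 0" and A': "\<forall>\<psi> \<mu> t M. continuous_on UNIV \<psi> \<longrightarrow> (\<forall>x. norm (\<psi> x) \<le> M * (gauss x * gauss x)) \<longrightarrow> \<mu> > 0 \<longrightarrow> t > 0 \<longrightarrow>
      norm (LINT x|lebesgue. u x * \<psi> x) \<le> A * (\<mu> powr (real CARD('n) / 2) * (LINT x|lebesgue. norm (\<psi> x))
        + t * \<mu> powr (- 2 * s) + (LINT x|lebesgue. (norm (\<psi> x))\<^sup>2) / t)"
    by (rule sobolev_pairing_bound[OF assms])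
  note A = A'[THEN spec, THEN spec, THEN spec, THEN spec, THEN mp, THEN mp, THEN mp, THEN mp]
  have um: "u \<in> borel_measurable lebesgue" and u2: "integrable lebesgue (\<lambda>x. (norm (u x))\<^sup>2)"
    using assms(1) by (auto simp: sobolev_H_def square_integrable_def)
  have bound: "norm (LINT x|lebesgue. u x * indicator K x) \<le> A * (\<mu> powr (?n / 2) * measure lebesgue K
      + t * \<mu> powr (- 2 * s) + measure lebesgue K / t)"
    if K: "compact K" "K \<noteq> {}" and \<mu>: "\<mu> > 0" and t: "t > 0" for K \<mu> t
  proof -
    obtain \<rho> where "\<forall>x\<in>K. norm x \<le> \<rho>"
      using compact_imp_bounded[OF K(1)] by (auto simp: bounded_iff)
    then have \<rho>: "K \<subseteq> cball 0 \<rho>" by auto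
    let ?B = "cball (0::real^'n) (\<rho> + 1)"
    define \<psi> where "\<psi> j x = complex_of_real (max 0 (1 - real (Suc j) * infdist x K))" for j :: nat and x
    have \<psi>c: "continuous_on UNIV (\<psi> j)" for j
      unfolding \<psi>_def by (intro continuous_intros)
    have \<psi>1: "norm (\<psi> j x) \<le> 1" for j x
      by (simp add: \<psi>_def infdist_nonneg)
    have \<psi>supp: "\<psi> j x = 0" if "x \<notin> ?B" for j x
    proof -
      have "1 \<le> dist x a" if "a \<in> K" for a
      proof -
        have "norm a \<le> \<rho>" using \<rho> that by auto
        moreover have "norm x \<le> norm a + dist x a"
          using norm_triangle_sub[of x a] by (simp add: dist_norm)
        ultimately show ?thesis using \<open>x \<notin> ?B\<close> by simp
      qed
      then have "1 \<le> infdist x K"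
        using K(2) by (auto simp: infdist_notempty intro!: cINF_greatest)
      then have "1 \<le> real (Suc j) * infdist x K"
        using mult_mono[of 1 "real (Suc j)" 1 "infdist x K"] by simp
      then show ?thesis by (simp add: \<psi>_def)
    qed
    have \<psi>B: "norm (\<psi> j x) \<le> indicator ?B x" for j x
      using \<psi>1[of j x] \<psi>supp[of x j] by (auto simp: indicator_def)
    \<comment> \<open>On the support \<open>gauss x * gauss x\<close> is at least
      \<open>exp (- (\<rho> + 1)\<^sup>2)\<close>, whence the constant.\<close>
    have \<psi>g: "norm (\<psi> j x) \<le> exp ((\<rho> + 1)\<^sup>2) * (gauss x * gauss x)" for j x
    proof (cases "x \<in> ?B")
      case True
      then have "(norm x)\<^sup>2 \<le> (\<rho> + 1)\<^sup>2" by (intro power_mono) auto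
      then have "1 \<le> exp ((\<rho> + 1)\<^sup>2) * (gauss x * gauss x)"
        by (simp add: gauss_def exp_add[symmetric])
      with \<psi>1[of j x] show ?thesis by simp
    next
      case False
      then show ?thesis by (simp add: \<psi>supp)
    qed
    have ni: "norm (indicator S x :: complex) = indicator S x" for S and x :: "real^'n"
      by (simp split: split_indicator)
    have lim: "(\<lambda>j. \<psi> j x) \<longlonglongrightarrow> indicator K x" for x
    proof (cases "x \<in> K")
      case True
      then show ?thesis by (simp add: \<psi>_def)
    next
      case False
      then have pos: "infdist x K > 0"
        using K by (intro infdist_pos_not_in_closed compact_imp_closed) auto
      obtain N :: nat where N: "1 / infdist x K < real N" using reals_Archimedean2 by blast
      have "\<psi> j x = 0" if "j \<ge> N" for j
      proof -
        have "1 / infdist x K \<le> real (Suc j)" using N that by simp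
        then have "1 \<le> real (Suc j) * infdist x K" using pos by (simp add: field_simps)
        then show ?thesis by (simp add: \<psi>_def)
      qed
      then have "eventually (\<lambda>j. \<psi> j x = 0) sequentially"
        by (auto simp: eventually_sequentially)
      then show ?thesis using False by (simp add: tendsto_eventually)
    qed
    have \<psi>m: "\<psi> j \<in> borel_measurable lebesgue" for j
      by (rule borel_measurable_continuous_lebesgue[OF \<psi>c])
    note [measurable] = \<psi>m
    have \<psi>nm: "(\<lambda>x. norm (\<psi> j x)) \<in> borel_measurable lebesgue"
      and \<psi>nm2: "(\<lambda>x. (norm (\<psi> j x))\<^sup>2) \<in> borel_measurable lebesgue" for j
      by measurable
    have Km: "K \<in> lmeasurable" using K(1) by (rule lmeasurable_compact)
    have Bi: "integrable lebesgue (indicator ?B :: _ \<Rightarrow> real)"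
      using lmeasurable_cball[of "0::real^'n" "\<rho> + 1"] by (simp add: lmeasurable_iff_integrable)
    have Bm: "(\<lambda>x. indicator ?B x :: complex) \<in> borel_measurable lebesgue"
      by (intro borel_measurable_indicator) simp
    have Kmi: "(\<lambda>x. indicator K x :: 'b::real_normed_algebra_1) \<in> borel_measurable lebesgue"
      using Km by (intro borel_measurable_indicator) auto
    have uB: "integrable lebesgue (\<lambda>x. u x * indicator ?B x)"
    proof (rule integrable_mult_L2[OF um Bm u2])
      show "integrable lebesgue (\<lambda>x. (norm (indicator ?B x :: complex))\<^sup>2)"
        using Bi by (rule back_subst[of "integrable lebesgue"]) (auto simp: indicator_def)
    qed
    have l1: "(\<lambda>j. LINT x|lebesgue. u x * \<psi> j x) \<longlonglongrightarrow> (LINT x|lebesgue. u x * indicator K x)"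
    proof (rule integral_dominated_convergence[OF _ _ integrable_norm[OF uB]])
      show "AE x in lebesgue. (\<lambda>j. u x * \<psi> j x) \<longlonglongrightarrow> u x * indicator K x"
        by (intro AE_I2 tendsto_mult tendsto_const lim)
      show "AE x in lebesgue. norm (u x * \<psi> j x) \<le> norm (u x * indicator ?B x)" for j
        using \<psi>B by (intro AE_I2) (auto simp: norm_mult ni intro!: mult_left_mono)
    qed (intro borel_measurable_times um \<psi>m Kmi)+
    have l2: "(\<lambda>j. LINT x|lebesgue. norm (\<psi> j x)) \<longlonglongrightarrow> (LINT x|lebesgue. indicator K x)"
    proof (rule integral_dominated_convergence[OF _ _ Bi])
      show "AE x in lebesgue. (\<lambda>j. norm (\<psi> j x)) \<longlonglongrightarrow> indicator K x"
        using tendsto_norm[OF lim] by (intro AE_I2) (simp add: ni)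
      show "AE x in lebesgue. norm (norm (\<psi> j x)) \<le> indicator ?B x" for j
        using \<psi>B by (intro AE_I2) simp
    qed (rule Kmi \<psi>nm)+
    have l3: "(\<lambda>j. LINT x|lebesgue. (norm (\<psi> j x))\<^sup>2) \<longlonglongrightarrow> (LINT x|lebesgue. indicator K x)"
    proof (rule integral_dominated_convergence[OF _ _ Bi])
      show "AE x in lebesgue. (\<lambda>j. (norm (\<psi> j x))\<^sup>2) \<longlonglongrightarrow> indicator K x"
      proof (intro AE_I2)
        fix x
        have "(\<lambda>j. (norm (\<psi> j x))\<^sup>2) \<longlonglongrightarrow> (norm (indicator K x :: complex))\<^sup>2"
          by (intro tendsto_power tendsto_norm lim)
        moreover have "(norm (indicator K x :: complex))\<^sup>2 = indicator K x"
          by (simp split: split_indicator)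
        ultimately show "(\<lambda>j. (norm (\<psi> j x))\<^sup>2) \<longlonglongrightarrow> indicator K x"
          by (simp only:)
      qed
      show "AE x in lebesgue. norm ((norm (\<psi> j x))\<^sup>2) \<le> indicator ?B x" for j
      proof (intro AE_I2)
        fix x
        have "(norm (\<psi> j x))\<^sup>2 \<le> norm (\<psi> j x)"
          using \<psi>1[of j x] by (simp add: power2_eq_square mult_left_le)
        then show "norm ((norm (\<psi> j x))\<^sup>2) \<le> indicator ?B x"
          using \<psi>B[of j x] by simp
      qed
    qed (rule Kmi \<psi>nm2)+
    have Kint: "(LINT x|lebesgue. indicator K x) = measure lebesgue K"
      using Km by simp
    show ?thesis
    proof (rule LIMSEQ_le)
      show "(\<lambda>j. norm (LINT x|lebesgue. u x * \<psi> j x)) \<longlonglongrightarrow> norm (LINT x|lebesgue. u x * indicator K x)"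
        by (intro tendsto_norm l1)
      show "(\<lambda>j. A * (\<mu> powr (?n / 2) * (LINT x|lebesgue. norm (\<psi> j x))
          + t * \<mu> powr (- 2 * s) + (LINT x|lebesgue. (norm (\<psi> j x))\<^sup>2) / t)) \<longlonglongrightarrow>
         A * (\<mu> powr (?n / 2) * measure lebesgue K + t * \<mu> powr (- 2 * s) + measure lebesgue K / t)"
        using l2 l3 t unfolding Kint by (intro tendsto_intros) auto
      show "\<exists>N. \<forall>j\<ge>N. norm (LINT x|lebesgue. u x * \<psi> j x) \<le> A * (\<mu> powr (?n / 2) * (LINT x|lebesgue. norm (\<psi> j x))
          + t * \<mu> powr (- 2 * s) + (LINT x|lebesgue. (norm (\<psi> j x))\<^sup>2) / t)"
        by (intro exI allI impI, rule A[OF \<psi>c _ \<mu> t]) (rule allI, rule \<psi>g)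
    qed
  qed
  show thesis
    by (rule that[OF A0], intro allI impI, rule bound) auto
qed

text \<open>Inner regularity: up to a null set \<open>E\<close> is an increasing union of compact
  sets.\<close>

lemma emeasure_lebesgue_le_if_compact_le:
  fixes E :: "'a::euclidean_space set"
  assumes E: "E \<in> sets lebesgue" and le: "\<And>K. compact K \<Longrightarrow> K \<subseteq> E \<Longrightarrow> measure lebesgue K \<le> c"
  shows "emeasure lebesgue E \<le> ennreal c"
proof -
  obtain N C where N: "negligible N" and C: "\<And>n::nat. compact (C n)" and EN: "E = (\<Union>n. C n) \<union> N"
    using lebesgue_regular_inner[OF E] by metis
  let ?U = "\<lambda>m. \<Union>n\<le>m. C n"
  have U: "compact (?U m)" for m by (intro compact_UN C) auto
  have inc: "incseq ?U" by (intro incseq_SucI) (auto simp: atMost_Suc)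
  have "N \<in> null_sets lebesgue" using N by (simp add: negligible_iff_null_sets)
  then have "emeasure lebesgue E = emeasure lebesgue (\<Union>n. C n)"
    unfolding EN using C by (intro emeasure_Un_null_set sets.countable_UN) (auto dest: lmeasurable_compact)
  also have "(\<Union>n. C n) = (\<Union>m. ?U m)" by auto
  also have "emeasure lebesgue (\<Union>m. ?U m) = (SUP m. emeasure lebesgue (?U m))"
    using U inc by (intro SUP_emeasure_incseq[symmetric]) (auto dest: lmeasurable_compact simp: fmeasurable_def)
  also have "\<dots> \<le> ennreal c"
  proof (intro SUP_least)
    fix m
    have "emeasure lebesgue (?U m) = ennreal (measure lebesgue (?U m))"
      using lmeasurable_compact[OF U] by (intro emeasure_eq_measure2) auto
    also have "\<dots> \<le> ennreal c"
      using U EN by (intro ennreal_leI le) auto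
    finally show "emeasure lebesgue (?U m) \<le> ennreal c" .
  qed
  finally show ?thesis .
qed

text \<open>If \<open>Re (c * u x)\<close> exceeds \<open>\<tau>\<close> on a compact
  \<open>K\<close>, then the integral of \<open>u\<close> over \<open>K\<close> has modulus at least
  \<open>\<tau>\<close> times the measure of \<open>K\<close>. In the upper bound the terms
  proportional to the measure are absorbed, and \<open>t * \<mu> powr (- 2 * s)\<close> alone
  decides the exponent.\<close>

lemma sobolev_weak_type:
  fixes u :: "real ^ 'n::finite \<Rightarrow> complex"
  assumes H: "sobolev_H s u" and s: "0 < s"
  obtains C where "C \<ge> 0"
    and "\<And>\<tau>. \<tau> > 0 \<Longrightarrow> emeasure lebesgue {x. \<tau> < norm (u x)} \<le> ennreal (C * \<tau> powr (- (2 + 4 * s / CARD('n))))"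
proof -
  let ?n = "real CARD('n)"
  obtain A where A0: "A \<ge> 0" and A': "\<forall>K \<mu> t. compact K \<longrightarrow> K \<noteq> {} \<longrightarrow> \<mu> > 0 \<longrightarrow> t > 0 \<longrightarrow>
      norm (LINT x|lebesgue. u x * indicator K x) \<le> A * (\<mu> powr (real CARD('n) / 2) * measure lebesgue K
        + t * \<mu> powr (- 2 * s) + measure lebesgue K / t)"
    by (rule sobolev_compact_bound[OF assms])
  note A = A'[rule_format]
  have um[measurable]: "u \<in> borel_measurable lebesgue" and u2: "integrable lebesgue (\<lambda>x. (norm (u x))\<^sup>2)"
    using H by (auto simp: sobolev_H_def square_integrable_def)
  \<comment> \<open>The factor 4 is what the absorption requires; the summand 1 keeps
    \<open>a\<close> positive when \<open>A\<close> is 0.\<close>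
  define a where "a = 4 * (A + 1)"
  have a: "a > 0" "A \<le> a / 4" using A0 by (auto simp: a_def)
  let ?q = "2 + 4 * s / ?n"
  let ?C = "2 * a\<^sup>2 * a powr (4 * s / ?n)"
  have part: "emeasure lebesgue {x. \<tau> < Re (c * u x)} \<le> ennreal (?C * \<tau> powr (- ?q))"
    if c: "norm c = 1" and \<tau>: "\<tau> > 0" for c :: complex and \<tau>
  proof (rule emeasure_lebesgue_le_if_compact_le)
    have "(\<lambda>x. Re (c * u x)) \<in> borel_measurable lebesgue"
      by (intro measurable_compose[OF _ borel_measurable_Re] borel_measurable_times um) simp
    then have "{x \<in> space lebesgue. \<tau> < Re (c * u x)} \<in> sets lebesgue" by measurable
    then show "{x. \<tau> < Re (c * u x)} \<in> sets lebesgue" by simp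
    fix K assume K: "compact K" "K \<subseteq> {x. \<tau> < Re (c * u x)}"
    have Km: "K \<in> lmeasurable" using K(1) by (rule lmeasurable_compact)
    show "measure lebesgue K \<le> ?C * \<tau> powr (- ?q)"
    proof (cases "K = {}")
      case True
      then show ?thesis using a by simp
    next
      case False
      let ?m = "measure lebesgue K"
      \<comment> \<open>Both \<open>\<mu> powr (?n / 2)\<close> and \<open>1 / t\<close> become
        \<open>\<tau> / a\<close>, so with \<open>A \<le> a / 4\<close> the terms carrying
        \<open>?m\<close> add up to \<open>\<tau> * ?m / 2\<close>. This can be subtracted because
        \<open>?m\<close> is a real number. The remaining term is of order \<open>\<tau>\<close> to
        the power -1 - 4s/n.\<close>
      define \<mu> where "\<mu> = (\<tau> / a) powr (2 / ?n)"
      define t where "t = a / \<tau>"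
      have \<mu>: "\<mu> > 0" using \<tau> a by (simp add: \<mu>_def)
      have t: "t > 0" using \<tau> a by (simp add: t_def)
      have \<mu>1: "\<mu> powr (?n / 2) = \<tau> / a"
        using \<tau> a by (simp add: \<mu>_def powr_powr)
      have \<mu>2: "\<mu> powr (- 2 * s) = (\<tau> / a) powr (- (4 * s / ?n))"
        by (simp add: \<mu>_def powr_powr)
      have uK: "integrable lebesgue (\<lambda>x. u x * indicator K x)"
      proof (rule integrable_mult_L2[OF um _ u2])
        show "(\<lambda>x. indicator K x :: complex) \<in> borel_measurable lebesgue"
          using Km by (intro borel_measurable_indicator) auto
        have "integrable lebesgue (indicator K :: _ \<Rightarrow> real)"
          using Km by (simp add: lmeasurable_iff_integrable)
        then show "integrable lebesgue (\<lambda>x. (norm (indicator K x :: complex))\<^sup>2)"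
          by (rule back_subst[of "integrable lebesgue"]) (auto simp: indicator_def)
      qed
      have cuK: "integrable lebesgue (\<lambda>x. c * (u x * indicator K x))"
        using uK by (rule integrable_mult_right)
      have "\<tau> * ?m = (LINT x|lebesgue. \<tau> * indicator K x)"
        using Km by simp
      also have "\<dots> \<le> (LINT x|lebesgue. Re (c * (u x * indicator K x)))"
      proof (intro integral_mono)
        show "integrable lebesgue (\<lambda>x. \<tau> * indicator K x)"
          using Km by (intro integrable_mult_right) (simp add: lmeasurable_iff_integrable)
        show "integrable lebesgue (\<lambda>x. Re (c * (u x * indicator K x)))"
          using cuK by (rule integrable_Re)
        show "\<tau> * indicator K x \<le> Re (c * (u x * indicator K x))" for x
          using K(2) by (auto simp: indicator_def)
      qed
      also have "\<dots> = Re (c * (LINT x|lebesgue. u x * indicator K x))"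
        using integral_Re[OF cuK] by (simp only: integral_mult_right_zero)
      also have "\<dots> \<le> norm (c * (LINT x|lebesgue. u x * indicator K x))"
        by (rule complex_Re_le_cmod)
      also have "\<dots> = norm (LINT x|lebesgue. u x * indicator K x)"
        by (simp add: norm_mult c)
      also have "\<dots> \<le> A * (\<mu> powr (?n / 2) * ?m + t * \<mu> powr (- 2 * s) + ?m / t)"
        by (rule A[OF K(1) False \<mu> t])
      also have "\<dots> \<le> a / 4 * (\<mu> powr (?n / 2) * ?m + t * \<mu> powr (- 2 * s) + ?m / t)"
        using t by (intro mult_right_mono a) auto
      also have "\<dots> = \<tau> * ?m / 2 + a\<^sup>2 / (4 * \<tau>) * (\<tau> / a) powr (- (4 * s / ?n))"
        unfolding \<mu>1 \<mu>2 t_def using a \<tau> by (simp add: field_simps power2_eq_square)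
      finally have "\<tau> * ?m / 2 \<le> a\<^sup>2 / (4 * \<tau>) * (\<tau> / a) powr (- (4 * s / ?n))" by simp
      also have "(\<tau> / a) powr (- (4 * s / ?n)) = \<tau> powr (- (4 * s / ?n)) * a powr (4 * s / ?n)"
        using a \<tau> by (simp add: powr_divide powr_minus field_simps)
      finally have "?m \<le> a\<^sup>2 / (2 * \<tau>\<^sup>2) * (\<tau> powr (- (4 * s / ?n)) * a powr (4 * s / ?n))"
        using \<tau> by (simp add: field_simps power2_eq_square)
      also have "\<dots> \<le> 2 * a\<^sup>2 / \<tau>\<^sup>2 * (\<tau> powr (- (4 * s / ?n)) * a powr (4 * s / ?n))"
        using \<tau> a by (intro mult_right_mono) (auto simp: field_simps)
      also have "\<dots> = ?C * (\<tau> powr (- 2) * \<tau> powr (- (4 * s / ?n)))"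
        using \<tau> by (simp add: powr_minus field_simps)
      also have "\<tau> powr (- 2) * \<tau> powr (- (4 * s / ?n)) = \<tau> powr (- ?q)"
        by (simp add: powr_add[symmetric])
      finally show ?thesis .
    qed
  qed
  have "emeasure lebesgue {x. \<tau> < norm (u x)} \<le> ennreal (4 * ?C * 2 powr ?q * \<tau> powr (- ?q))" if \<tau>: "\<tau> > 0" for \<tau>
  proof -
    let ?S = "\<lambda>c. {x. \<tau> / 2 < Re (c * u x)}"
    let ?c = "ennreal (?C * (\<tau> / 2) powr (- ?q))"
    have S: "?S c \<in> sets lebesgue" for c
    proof -
      have "(\<lambda>x. Re (c * u x)) \<in> borel_measurable lebesgue"
        by (intro measurable_compose[OF _ borel_measurable_Re] borel_measurable_times um) simp
      then have "{x \<in> space lebesgue. \<tau> / 2 < Re (c * u x)} \<in> sets lebesgue" by measurable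
      then show ?thesis by simp
    qed
    have le: "emeasure lebesgue (?S c) \<le> ?c" if "norm c = 1" for c
      using \<tau> by (intro part[OF that]) simp
    \<comment> \<open>If the modulus exceeds \<open>\<tau>\<close>, then the real or the imaginary
      part exceeds \<open>\<tau> / 2\<close> in absolute value, and four unimodular factors detect
      all signs.\<close>
    have "{x. \<tau> < norm (u x)} \<subseteq> (?S 1 \<union> ?S (-1)) \<union> (?S \<i> \<union> ?S (-\<i>))"
    proof
      fix x assume "x \<in> {x. \<tau> < norm (u x)}"
      then have "\<tau> < \<bar>Re (u x)\<bar> + \<bar>Im (u x)\<bar>"
        using cmod_le[of "u x"] by simp
      then show "x \<in> (?S 1 \<union> ?S (-1)) \<union> (?S \<i> \<union> ?S (-\<i>))" by auto
    qed
    then have "emeasure lebesgue {x. \<tau> < norm (u x)} \<le> emeasure lebesgue ((?S 1 \<union> ?S (-1)) \<union> (?S \<i> \<union> ?S (-\<i>)))"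
      by (intro emeasure_mono sets.Un S)
    also have "\<dots> \<le> (emeasure lebesgue (?S 1) + emeasure lebesgue (?S (-1))) + (emeasure lebesgue (?S \<i>) + emeasure lebesgue (?S (-\<i>)))"
      using S by (intro order_trans[OF emeasure_subadditive] add_mono emeasure_subadditive sets.Un)
    also have "\<dots> \<le> (?c + ?c) + (?c + ?c)"
      by (intro add_mono le) auto
    also have "\<dots> = ennreal (4 * ?C * 2 powr ?q * \<tau> powr (- ?q))"
    proof -
      have "(\<tau> / 2) powr (- ?q) = 2 powr ?q * \<tau> powr (- ?q)"
      proof -
        have "(\<tau> / 2) powr (- r) = 2 powr r * \<tau> powr (- r)" for r
          using \<tau> by (simp add: powr_divide powr_minus field_simps)
        then show ?thesis .
      qed
      then have 4: "4 * ?C * 2 powr ?q * \<tau> powr (- ?q) = 4 * (?C * (\<tau> / 2) powr (- ?q))"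
        by (simp only: mult.assoc)
      have "ennreal x + ennreal x + (ennreal x + ennreal x) = ennreal (4 * x)" if "x \<ge> 0" for x
      proof -
        have "ennreal (x + x + (x + x)) = ennreal x + ennreal x + (ennreal x + ennreal x)"
          using that by (simp only: ennreal_plus add_nonneg_nonneg)
        then show ?thesis by simp
      qed
      then show ?thesis
        unfolding 4 using a by (meson mult_nonneg_nonneg powr_ge_zero zero_le_power2 zero_le_numeral)
    qed
    finally show ?thesis .
  qed
  moreover have "4 * ?C * 2 powr ?q \<ge> 0" using a by simp
  ultimately show thesis by (intro that[of "4 * ?C * 2 powr ?q"])
qed

subsection \<open>Vanishing of infinite order of the source\<close>

text \<open>Young's inequality for the conjugate exponents \<open>1 + 1 / \<sigma>\<close> and
  \<open>1 + \<sigma>\<close> with weight \<open>\<eta>\<close>. The power of \<open>w\<close> is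
  then split at two levels: below \<open>\<kappa>\<close> it is small, between the levels the square
  of \<open>w\<close> dominates it, above \<open>T\<close> the higher power \<open>b\<close>
  does.\<close>

lemma young_split:
  fixes v w \<eta> \<kappa> T \<sigma> b :: real
  assumes v: "0 \<le> v" and w: "0 \<le> w" and pos: "0 < \<eta>" "0 < \<kappa>" "0 < T" "0 < \<sigma>" and b: "1 + \<sigma> < b"
  shows "v * w \<le> \<eta> * v powr (1 + 1 / \<sigma>) + \<eta> powr (- \<sigma>) *
     (\<kappa> powr (1 + \<sigma>) + \<kappa> powr (- 2) * T powr (1 + \<sigma>) * w\<^sup>2 + T powr (1 + \<sigma> - b) * w powr b)"
proof -
  let ?a = "1 + \<sigma>"
  have wa: "w powr ?a \<le> \<kappa> powr ?a + \<kappa> powr (- 2) * T powr ?a * w\<^sup>2 + T powr (?a - b) * w powr b"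
  proof -
    have nn: "0 \<le> \<kappa> powr ?a" "0 \<le> \<kappa> powr (- 2) * T powr ?a * w\<^sup>2" "0 \<le> T powr (?a - b) * w powr b" by auto
    consider "w \<le> \<kappa>" | "\<kappa> < w" "w \<le> T" | "T < w" by linarith
    then show ?thesis
    proof cases
      case 1
      then have "w powr ?a \<le> \<kappa> powr ?a" using w pos by (intro powr_mono2) auto
      then show ?thesis using nn by linarith
    next
      case 2
      have "w powr ?a \<le> 1 * T powr ?a" using 2 w pos by (auto intro!: powr_mono2)
      also have "\<dots> \<le> (\<kappa> powr (- 2) * w\<^sup>2) * T powr ?a"
      proof (intro mult_right_mono)
        have "\<kappa>\<^sup>2 \<le> w\<^sup>2" using 2 pos by (intro power_mono) auto
        then show "1 \<le> \<kappa> powr (- 2) * w\<^sup>2"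
          using pos by (simp add: powr_minus powr_numeral field_simps)
      qed simp
      also have "\<dots> = \<kappa> powr (- 2) * T powr ?a * w\<^sup>2" by (simp add: mult_ac)
      finally show ?thesis using nn by linarith
    next
      case 3
      have "w powr ?a = w powr (?a - b) * w powr b"
        by (simp add: powr_add[symmetric])
      also have "\<dots> \<le> T powr (?a - b) * w powr b"
        using 3 pos b by (intro mult_right_mono powr_mono2') auto
      finally show ?thesis using nn by linarith
    qed
  qed
  have nn: "0 \<le> \<eta> * v powr (1 + 1 / \<sigma>)" "0 \<le> \<eta> powr (- \<sigma>) * w powr ?a" using pos by auto
  have "v * w \<le> \<eta> * v powr (1 + 1 / \<sigma>) + \<eta> powr (- \<sigma>) * w powr ?a"
  proof (cases "v = 0")
    case True
    then show ?thesis using nn by simp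
  next
    case False
    then have v0: "v > 0" using v by simp
    show ?thesis
    proof (cases "w \<le> \<eta> * v powr (1 / \<sigma>)")
      case True
      have "v * w \<le> v * (\<eta> * v powr (1 / \<sigma>))" using True v by (rule mult_left_mono)
      also have "\<dots> = \<eta> * v powr (1 + 1 / \<sigma>)"
        using v0 by (simp add: powr_add)
      finally show ?thesis using nn by linarith
    next
      case False
      then have w0: "w > 0" using pos v0 by (smt (verit) powr_ge_zero mult_nonneg_nonneg)
      have "v powr (1 / \<sigma>) \<le> w / \<eta>" using False pos by (simp add: field_simps)
      then have "(v powr (1 / \<sigma>)) powr \<sigma> \<le> (w / \<eta>) powr \<sigma>"
        using pos by (intro powr_mono2) auto
      then have "v \<le> (w / \<eta>) powr \<sigma>"
        using v0 pos by (simp add: powr_powr)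
      then have "v * w \<le> (w / \<eta>) powr \<sigma> * w" using w by (rule mult_right_mono)
      also have "\<dots> = \<eta> powr (- \<sigma>) * w powr ?a"
        using w0 pos by (simp add: powr_divide powr_add powr_minus field_simps)
      finally show ?thesis using nn by linarith
    qed
  qed
  also have "\<dots> \<le> \<eta> * v powr (1 + 1 / \<sigma>) + \<eta> powr (- \<sigma>) *
     (\<kappa> powr ?a + \<kappa> powr (- 2) * T powr ?a * w\<^sup>2 + T powr (?a - b) * w powr b)"
    by (intro add_left_mono mult_left_mono wa) auto
  finally show ?thesis .
qed

text \<open>Infinite-order vanishing is available for the square of \<open>w\<close> only. Letting
  the parameters of \<open>young_split\<close> be powers of the radius transfers it to the product,
  at the price of fixed integrals of the higher powers.\<close>

lemma infinite_order_vanishing_mult: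
  fixes v w :: "'a::euclidean_space \<Rightarrow> real"
  assumes [measurable]: "v \<in> borel_measurable lebesgue" "w \<in> borel_measurable lebesgue"
    and v0: "\<And>x. 0 \<le> v x" and w0: "\<And>x. 0 \<le> w x" and supp: "\<And>x. x \<notin> ball 0 \<rho> \<Longrightarrow> v x = 0"
    and \<sigma>: "0 < \<sigma>" "1 + \<sigma> < b" and \<rho>: "\<rho> > 0"
    and vp: "integrable lebesgue (\<lambda>x. v x powr (1 + 1 / \<sigma>))"
    and w2: "integrable lebesgue (\<lambda>x. (w x)\<^sup>2)"
    and wb: "integrable lebesgue (\<lambda>x. indicator (ball 0 \<rho>) x * w x powr b)"
    and van: "\<And>M. M > 0 \<Longrightarrow> \<exists>C\<ge>0. \<exists>r0>0. \<forall>r. 0 < r \<longrightarrow> r < r0 \<longrightarrow>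
      (LINT x|lebesgue. indicator (ball 0 r) x * (w x)\<^sup>2) \<le> C * r powr M"
  shows "integrable lebesgue (\<lambda>x. v x * w x)"
    and "N > 0 \<Longrightarrow> \<exists>C\<ge>0. \<forall>r>0. (LINT x|lebesgue. indicator (ball 0 r) x * (v x * w x)) \<le> C * r powr N"
proof -
  let ?B = "ball (0::'a) \<rho>"
  have Bm: "?B \<in> lmeasurable" by simp
  let ?U = "\<lambda>\<eta> \<kappa> T r x. \<eta> * v x powr (1 + 1 / \<sigma>) + \<eta> powr (- \<sigma>) * (\<kappa> powr (1 + \<sigma>) * indicator ?B x +
      \<kappa> powr (- 2) * T powr (1 + \<sigma>) * (indicator (ball 0 r) x * (w x)\<^sup>2) + T powr (1 + \<sigma> - b) * (indicator ?B x * w x powr b))"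
  have Bi: "integrable lebesgue (indicator ?B :: 'a \<Rightarrow> real)"
    using Bm by (simp add: lmeasurable_iff_integrable)
  have [measurable]: "ball (0::'a) r \<in> sets lebesgue" for r by simp
  have rw2: "integrable lebesgue (\<lambda>x. indicator (ball 0 r) x * (w x)\<^sup>2)" for r
    by (rule Bochner_Integration.integrable_bound[OF w2]) (auto split: split_indicator)
  have split: "v x * w x \<le> ?U \<eta> \<kappa> T r x"
    if "\<eta> > 0" "\<kappa> > 0" "T > 0" "x \<in> ball 0 r \<or> x \<notin> ?B" for \<eta> \<kappa> T r x
  proof (cases "x \<in> ?B")
    case True
    with that show ?thesis using young_split[OF v0 w0 that(1-3) \<sigma>, of x x] by simp
  next
    case False
    then show ?thesis using that supp[OF False] by simp
  qed
  show i: "integrable lebesgue (\<lambda>x. v x * w x)"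
  proof (rule Bochner_Integration.integrable_bound)
    show "integrable lebesgue (\<lambda>x. ?U 1 1 1 \<rho> x)"
      by (intro Bochner_Integration.integrable_add integrable_mult_right vp Bi rw2 wb)
    show "AE x in lebesgue. norm (v x * w x) \<le> norm (?U 1 1 1 \<rho> x)"
      (is "AE x in lebesgue. _ \<le> norm (?U x)")
    proof (intro AE_I2)
      fix x
      have "v x * w x \<le> ?U x" by (rule split) auto
      moreover have "0 \<le> v x * w x" using v0 w0 by simp
      ultimately show "norm (v x * w x) \<le> norm (?U x)" unfolding real_norm_def by linarith
    qed
  qed measurable
  assume N: "N > 0"
  \<comment> \<open>With \<open>\<eta> = r powr N\<close>, \<open>\<kappa> = r powr k\<close> and
    \<open>T = r powr (- l)\<close>, these exponents are the solutions of the equations saying that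
    each of the four terms is a multiple of \<open>r powr N\<close>.\<close>
  define k where "k = (N + \<sigma> * N) / (1 + \<sigma>)"
  define l where "l = (N + \<sigma> * N) / (b - (1 + \<sigma>))"
  define M where "M = N + \<sigma> * N + 2 * k + l * (1 + \<sigma>)"
  have kl: "k > 0" "l > 0" using N \<sigma> by (auto simp: k_def l_def add_pos_pos)
  have M: "M > 0" unfolding M_def using N \<sigma> kl by (intro add_pos_pos mult_pos_pos) auto
  obtain C r0 where C: "C \<ge> 0" and r0: "r0 > 0" and Cr: "\<And>r. 0 < r \<Longrightarrow> r < r0 \<Longrightarrow>
      (LINT x|lebesgue. indicator (ball 0 r) x * (w x)\<^sup>2) \<le> C * r powr M"
    using van[OF M] by blast
  let ?A = "LINT x|lebesgue. v x powr (1 + 1 / \<sigma>)" and ?W = "LINT x|lebesgue. indicator ?B x * w x powr b"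
  let ?I = "\<lambda>r. LINT x|lebesgue. indicator (ball 0 r) x * (v x * w x)"
  have nonneg: "?A \<ge> 0" "?W \<ge> 0" "measure lebesgue ?B \<ge> 0"
    by (auto intro!: integral_nonneg_AE)
  let ?T = "LINT x|lebesgue. v x * w x"
  have T0: "?T \<ge> 0" using v0 w0 by (intro integral_nonneg_AE) simp
  have ri: "integrable lebesgue (\<lambda>x. indicator (ball 0 r) x * (v x * w x))" for r
    by (rule Bochner_Integration.integrable_bound[OF i]) (auto split: split_indicator)
  have small: "?I r \<le> (?A + measure lebesgue ?B + C + ?W) * r powr N" if r: "0 < r" "r < r0" for r
  proof -
    let ?\<eta> = "r powr N" and ?\<kappa> = "r powr k" and ?T = "r powr (- l)"
    let ?U = "\<lambda>x. ?\<eta> * v x powr (1 + 1 / \<sigma>) + ?\<eta> powr (- \<sigma>) * (?\<kappa> powr (1 + \<sigma>) * indicator ?B x +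
      ?\<kappa> powr (- 2) * ?T powr (1 + \<sigma>) * (indicator (ball 0 r) x * (w x)\<^sup>2) + ?T powr (1 + \<sigma> - b) * (indicator ?B x * w x powr b))"
    have i1: "integrable lebesgue (\<lambda>x. ?\<eta> * v x powr (1 + 1 / \<sigma>))"
      by (intro integrable_mult_right vp)
    have i2: "integrable lebesgue (\<lambda>x. ?\<kappa> powr (1 + \<sigma>) * indicator ?B x)"
      by (intro integrable_mult_right Bi)
    have i3: "integrable lebesgue (\<lambda>x. ?\<kappa> powr (- 2) * ?T powr (1 + \<sigma>) * (indicator (ball 0 r) x * (w x)\<^sup>2))"
      by (intro integrable_mult_right rw2)
    have i4: "integrable lebesgue (\<lambda>x. ?T powr (1 + \<sigma> - b) * (indicator ?B x * w x powr b))"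
      by (intro integrable_mult_right wb)
    note i23 = Bochner_Integration.integrable_add[OF i2 i3]
    note i234 = Bochner_Integration.integrable_add[OF i23 i4]
    note i5 = integrable_mult_right[OF i234, of "?\<eta> powr (- \<sigma>)"]
    have "?I r \<le> (LINT x|lebesgue. ?U x)"
    proof (intro integral_mono ri Bochner_Integration.integrable_add i1 i5)
      fix x
      have U0: "0 \<le> ?U x" using r by (intro add_nonneg_nonneg mult_nonneg_nonneg) auto
      show "indicator (ball 0 r) x * (v x * w x) \<le> ?U x"
      proof (cases "x \<in> ball 0 r")
        case True
        have "v x * w x \<le> ?U x" using r True by (intro split) auto
        then show ?thesis using True by simp
      next
        case False
        then show ?thesis using U0 by simp
      qed
    qed
    also have "\<dots> = ?\<eta> * ?A + ?\<eta> powr (- \<sigma>) * (?\<kappa> powr (1 + \<sigma>) * measure lebesgue ?B +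
        ?\<kappa> powr (- 2) * ?T powr (1 + \<sigma>) * (LINT x|lebesgue. indicator (ball 0 r) x * (w x)\<^sup>2) + ?T powr (1 + \<sigma> - b) * ?W)"
      using Bm by (simp only: Bochner_Integration.integral_add[OF i1 i5] integral_mult_right_zero
          Bochner_Integration.integral_add[OF i23 i4] Bochner_Integration.integral_add[OF i2 i3])
        (simp add: lmeasurable_iff_integrable)
    also have "\<dots> \<le> ?\<eta> * ?A + ?\<eta> powr (- \<sigma>) * (?\<kappa> powr (1 + \<sigma>) * measure lebesgue ?B +
        ?\<kappa> powr (- 2) * ?T powr (1 + \<sigma>) * (C * r powr M) + ?T powr (1 + \<sigma> - b) * ?W)"
      using Cr[OF r] by (intro add_left_mono mult_left_mono add_right_mono) auto
    also have "\<dots> = ?\<eta> * ?A + (?\<eta> powr (- \<sigma>) * ?\<kappa> powr (1 + \<sigma>)) * measure lebesgue ?B +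
        (?\<eta> powr (- \<sigma>) * ?\<kappa> powr (- 2) * ?T powr (1 + \<sigma>) * r powr M) * C + (?\<eta> powr (- \<sigma>) * ?T powr (1 + \<sigma> - b)) * ?W"
      by (simp add: algebra_simps)
    also have "?\<eta> powr (- \<sigma>) * ?\<kappa> powr (1 + \<sigma>) = ?\<eta>"
    proof -
      have "k * (1 + \<sigma>) = N + \<sigma> * N" using \<sigma> by (simp add: k_def)
      then show ?thesis by (simp only: powr_powr powr_add[symmetric]) (simp add: mult.commute)
    qed
    also have "?\<eta> powr (- \<sigma>) * ?\<kappa> powr (- 2) * ?T powr (1 + \<sigma>) * r powr M = ?\<eta>"
    proof -
      have "N * (- \<sigma>) + k * (- 2) + (- l) * (1 + \<sigma>) + M = N"
        unfolding M_def by (simp add: algebra_simps)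
      then show ?thesis by (simp only: powr_powr powr_add[symmetric])
    qed
    also have "?\<eta> powr (- \<sigma>) * ?T powr (1 + \<sigma> - b) = ?\<eta>"
    proof -
      have "l * (b - (1 + \<sigma>)) = N + \<sigma> * N" using \<sigma> by (simp add: l_def)
      moreover have "(- l) * (1 + \<sigma> - b) = l * (b - (1 + \<sigma>))" by (simp add: algebra_simps)
      ultimately have "N * (- \<sigma>) + (- l) * (1 + \<sigma> - b) = N" by (simp add: mult.commute)
      then show ?thesis by (simp only: powr_powr powr_add[symmetric])
    qed
    finally show ?thesis by (simp add: algebra_simps)
  qed
  \<comment> \<open>The bound is wanted for every radius; from \<open>r0\<close> on, the total
    integral is already below a multiple of \<open>r powr N\<close>.\<close>
  have large: "?I r \<le> (?T * r0 powr (- N)) * r powr N" if r: "r0 \<le> r" for r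
  proof -
    have "?I r \<le> ?T"
      using v0 w0 by (intro integral_mono ri i) (auto split: split_indicator)
    also have "\<dots> \<le> ?T * (r0 powr (- N) * r powr N)"
    proof -
      have "r0 powr N \<le> r powr N" using r r0 N by (intro powr_mono2) auto
      then have "1 \<le> r0 powr (- N) * r powr N" using r0 by (simp add: powr_minus field_simps)
      then show ?thesis using mult_left_mono[OF _ T0] by fastforce
    qed
    finally show ?thesis by (simp add: mult.assoc)
  qed
  define C' where "C' = max (?A + measure lebesgue ?B + C + ?W) (?T * r0 powr (- N))"
  have "?I r \<le> C' * r powr N" if r: "r > 0" for r
  proof (cases "r < r0")
    case True
    from small[OF r True] show ?thesis
      by (rule order_trans) (intro mult_right_mono, auto simp: C'_def)
  next
    case False
    then have "r0 \<le> r" by simp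
    from large[OF this] show ?thesis
      by (rule order_trans) (intro mult_right_mono, auto simp: C'_def)
  qed
  moreover have "C' \<ge> 0" using nonneg C by (auto simp: C'_def le_max_iff_disj)
  ultimately show "\<exists>C\<ge>0. \<forall>r>0. ?I r \<le> C * r powr N" by blast
qed

lemma vanishes_infinite_order_L2D:
  assumes van: "vanishes_infinite_order_L2 u" and "M > 0"
  shows "\<exists>C\<ge>0. \<exists>r0>0. \<forall>r. 0 < r \<longrightarrow> r < r0 \<longrightarrow> (LINT x|lebesgue. indicator (ball 0 r) x * (norm (u x))\<^sup>2) \<le> C * r powr M"
proof -
  have "(\<lambda>r. LINT x|lebesgue_on (ball 0 r). (norm (u x))\<^sup>2) \<in> O[at_right 0](\<lambda>r. r powr M)"
    using van assms by (simp add: vanishes_infinite_order_L2_def)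
  then obtain C where C: "C > 0" "eventually (\<lambda>r. norm (LINT x|lebesgue_on (ball 0 r). (norm (u x))\<^sup>2) \<le> C * norm (r powr M)) (at_right 0)"
    by (elim landau_o.bigE)
  then obtain r0 where r0: "r0 > 0" "\<And>r. 0 < r \<Longrightarrow> r < r0 \<Longrightarrow> norm (LINT x|lebesgue_on (ball 0 r). (norm (u x))\<^sup>2) \<le> C * norm (r powr M)"
    unfolding eventually_at_right_field by auto
  have "(LINT x|lebesgue. indicator (ball 0 r) x * (norm (u x))\<^sup>2) \<le> C * r powr M" if "0 < r" "r < r0" for r
  proof -
    have "(LINT x|lebesgue_on (ball 0 r). (norm (u x))\<^sup>2) = (LINT x|lebesgue. indicator (ball 0 r) x *\<^sub>R (norm (u x))\<^sup>2)"
      by (rule integral_restrict_space) auto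
    then show ?thesis using r0(2)[OF that] by simp
  qed
  with C(1) r0(1) show ?thesis by (intro exI[of _ C] conjI exI[of _ r0]) auto
qed

text \<open>\<open>infinite_order_vanishing_mult\<close> applies to \<open>norm (V x)\<close>, cut
  off to the ball containing the support of \<open>chi\<close>, and to \<open>norm (u x)\<close>;
  the weak type estimate supplies the higher power.\<close>

lemma cutoff_source_estimates:
  fixes \<Omega> :: "(real ^ 'n::finite) set" and V u chi F :: "real ^ 'n \<Rightarrow> complex"
  assumes n: "CARD('n) \<ge> 3" and s: "0 < s" "s < 1"
    and V: "Lp_loc (real CARD('n) / (2 * s)) \<Omega> V"
    and H: "sobolev_H s u" and van: "vanishes_infinite_order_L2 u"
    and R: "R > 0" "closure (ball 0 (4 * R)) \<subseteq> \<Omega>"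
    and chi: "test_function (ball 0 (3 * R)) chi"
    and F: "F = (\<lambda>x. chi x * V x * u x)"
  shows "integrable lebesgue F"
    and "N > 0 \<Longrightarrow> \<exists>C\<ge>0. \<forall>r>0. (LINT x|lebesgue. indicator (ball 0 r) x * norm (F x)) \<le> C * r powr N"
proof -
  let ?n = "real CARD('n)"
  let ?B = "ball (0 :: real^'n) (3 * R)"
  have n3: "?n \<ge> 3" using n by simp
  have um[measurable]: "u \<in> borel_measurable lebesgue" and u2: "integrable lebesgue (\<lambda>x. (norm (u x))\<^sup>2)"
    using H by (auto simp: sobolev_H_def square_integrable_def)
  have Bm[measurable]: "?B \<in> sets lebesgue" by simp
  have KO: "cball 0 (3 * R) \<subseteq> \<Omega>"
    using R by (auto simp: subset_iff)
  have chic: "continuous_on UNIV chi"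
  proof -
    have "iter_partial [] chi differentiable (at x)" for x
      using chi unfolding test_function_def smooth_def by blast
    then show ?thesis
      by (auto simp: iter_partial_def continuous_on_eq_continuous_at intro!: differentiable_imp_continuous_within)
  qed
  have chim[measurable]: "chi \<in> borel_measurable lebesgue"
    by (rule borel_measurable_continuous_lebesgue[OF chic])
  have chi0: "chi x = 0" if "x \<notin> ?B" for x
  proof (rule ccontr)
    assume "chi x \<noteq> 0"
    then have "x \<in> closure {x. chi x \<noteq> 0}" using closure_subset[of "{x. chi x \<noteq> 0}"] by auto
    with chi that show False by (auto simp: test_function_def)
  qed
  obtain X where X: "\<And>x. norm (chi x) \<le> X" "X \<ge> 0"
  proof -
    have "compact (chi ` closure {x. chi x \<noteq> 0})"
      using chi by (intro compact_continuous_image continuous_on_subset[OF chic]) (auto simp: test_function_def)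
    from compact_imp_bounded[OF this]
    obtain X where X: "\<forall>z\<in>chi ` closure {x. chi x \<noteq> 0}. norm z \<le> X"
      unfolding bounded_iff by blast
    have "norm (chi x) \<le> max X 0" for x
    proof (cases "chi x = 0")
      case False
      then have "x \<in> closure {x. chi x \<noteq> 0}" using closure_subset[of "{x. chi x \<noteq> 0}"] by auto
      with X show ?thesis by (auto simp: le_max_iff_disj)
    qed simp
    then show thesis by (intro that[of "max X 0"]) auto
  qed
  define v where "v x = norm (V x) * indicator ?B x" for x
  define w where "w x = norm (u x)" for x
  define p where "p = ?n / (2 * s)"
  \<comment> \<open>This makes \<open>1 + 1 / \<sigma>\<close> equal to \<open>p\<close> and
    \<open>1 + \<sigma>\<close> equal to its conjugate exponent n/(n-2s).\<close>
  define \<sigma> where "\<sigma> = 1 / (p - 1)"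
  have p1: "p > 1" using n3 s by (simp add: p_def field_simps)
  have \<sigma>: "\<sigma> > 0" "1 + 1 / \<sigma> = p" using p1 by (auto simp: \<sigma>_def)
  have \<sigma>q: "1 + \<sigma> < 2 + 4 * s / ?n"
  proof -
    have "1 + \<sigma> = ?n / (?n - 2 * s)" using s n3 by (simp add: \<sigma>_def p_def field_simps)
    moreover have "2 + 4 * s / ?n = 2 * (?n + 2 * s) / ?n" using n3 by (simp add: field_simps)
    \<comment> \<open>The required strict inequality of exponents after clearing denominators; the
      right-hand side is 2n^2 - 8s^2.\<close>
    moreover have "?n * ?n < 2 * (?n + 2 * s) * (?n - 2 * s)"
    proof -
      have "s * s < 1 * 1" using s by (intro mult_strict_mono) auto
      moreover have "3 * 3 \<le> ?n * ?n" using n3 by (intro mult_mono) auto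
      ultimately show ?thesis by (simp add: algebra_simps)
    qed
    then have "?n / (?n - 2 * s) < 2 * (?n + 2 * s) / ?n"
      using s n3 by (simp add: field_simps)
    ultimately show ?thesis by (simp only:)
  qed
  obtain b where b: "1 + \<sigma> < b" "b < 2 + 4 * s / ?n" using dense[OF \<sigma>q] by blast
  \<comment> \<open>\<open>V\<close> is measurable only as a function on \<open>\<Omega>\<close>, so
    it enters through its extension by 0 from the ball.\<close>
  have Vm: "(\<lambda>x. indicator ?B x *\<^sub>R V x) \<in> borel_measurable lebesgue"
  proof -
    have "V \<in> borel_measurable (lebesgue_on \<Omega>)" using V by (simp add: Lp_loc_def)
    then have "V \<in> borel_measurable (lebesgue_on ?B)"
      by (rule measurable_restrict_mono) (use KO ball_subset_cball in blast)
    then show ?thesis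
      by (subst (asm) borel_measurable_restrict_space_iff) auto
  qed
  have vm: "v \<in> borel_measurable lebesgue"
  proof -
    have "v = (\<lambda>x. norm (indicator ?B x *\<^sub>R V x))" by (auto simp: v_def)
    then show ?thesis using measurable_compose[OF Vm borel_measurable_norm] by (simp only:)
  qed
  have wm: "w \<in> borel_measurable lebesgue" unfolding w_def by measurable
  have vp: "integrable lebesgue (\<lambda>x. v x powr (1 + 1 / \<sigma>))"
  proof -
    have "integrable (lebesgue_on (cball 0 (3 * R))) (\<lambda>x. norm (V x) powr p)"
      using V KO by (auto simp: Lp_loc_def p_def)
    then have "integrable lebesgue (\<lambda>x. indicator (cball 0 (3 * R)) x *\<^sub>R norm (V x) powr p)"
      by (subst (asm) integrable_restrict_space) auto
    then show ?thesis
    proof (rule Bochner_Integration.integrable_bound)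
      show "(\<lambda>x. v x powr (1 + 1 / \<sigma>)) \<in> borel_measurable lebesgue" using vm by measurable
      show "AE x in lebesgue. norm (v x powr (1 + 1 / \<sigma>)) \<le> norm (indicator (cball 0 (3 * R)) x *\<^sub>R norm (V x) powr p)"
        using p1 by (intro AE_I2) (auto simp: v_def \<sigma> split: split_indicator)
    qed
  qed
  have w2: "integrable lebesgue (\<lambda>x. (w x)\<^sup>2)" using u2 by (simp add: w_def)
  have wb: "integrable lebesgue (\<lambda>x. indicator ?B x * w x powr b)"
  proof -
    obtain C where C: "C \<ge> 0" "\<And>\<tau>. \<tau> > 0 \<Longrightarrow> emeasure lebesgue {x. \<tau> < norm (u x)} \<le> ennreal (C * \<tau> powr (- (2 + 4 * s / ?n)))"
      using sobolev_weak_type[OF H s(1)] by blast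
    have "(\<integral>\<^sup>+ x. ennreal (w x powr b) \<partial>lebesgue_on ?B) < \<infinity>"
    proof (rule nn_integral_powr_finite_if_weak_type[where q = "2 + 4 * s / ?n" and C = C])
      show "w \<in> borel_measurable (lebesgue_on ?B)" using wm by (rule measurable_restrict_space1)
      show "emeasure (lebesgue_on ?B) (space (lebesgue_on ?B)) < \<infinity>"
        using emeasure_lborel_ball_finite[of "0::real^'n" "3 * R"] by (simp add: emeasure_restrict_space)
      show "emeasure (lebesgue_on ?B) {x \<in> space (lebesgue_on ?B). t < w x} \<le> ennreal (C * t powr (- (2 + 4 * s / ?n)))"
        if "t \<ge> 1" for t
      proof -
        have sm: "{x. t < norm (u x)} \<in> sets lebesgue"
        proof -
          have "{x \<in> space lebesgue. t < norm (u x)} \<in> sets lebesgue" by measurable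
          then show ?thesis by simp
        qed
        have eq: "{x \<in> space (lebesgue_on ?B). t < w x} = {x. t < norm (u x)} \<inter> ?B"
          by (auto simp: w_def)
        have "emeasure (lebesgue_on ?B) {x \<in> space (lebesgue_on ?B). t < w x} = emeasure lebesgue ({x. t < norm (u x)} \<inter> ?B)"
          unfolding eq by (intro emeasure_restrict_space) auto
        also have "\<dots> \<le> emeasure lebesgue {x. t < norm (u x)}"
          using sm by (intro emeasure_mono) auto
        also have "\<dots> \<le> ennreal (C * t powr (- (2 + 4 * s / ?n)))"
          using that by (intro C) simp
        finally show ?thesis .
      qed
    qed (use C b \<sigma> in \<open>auto simp: w_def\<close>)
    then have "(\<integral>\<^sup>+ x. ennreal (w x powr b) * indicator ?B x \<partial>lebesgue) < \<infinity>"
      by (subst (asm) nn_integral_restrict_space) auto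
    moreover have "ennreal (w x powr b) * indicator ?B x = ennreal (norm (indicator ?B x * w x powr b))" for x
      by (auto split: split_indicator)
    moreover have "(\<lambda>x. indicator ?B x * w x powr b) \<in> borel_measurable lebesgue"
      using wm by measurable
    ultimately show ?thesis
      by (intro integrableI_bounded) (assumption, simp only:)
  qed
  have van': "\<exists>C\<ge>0. \<exists>r0>0. \<forall>r. 0 < r \<longrightarrow> r < r0 \<longrightarrow> (LINT x|lebesgue. indicator (ball 0 r) x * (w x)\<^sup>2) \<le> C * r powr M"
    if "M > 0" for M
    using vanishes_infinite_order_L2D[OF van that] by (simp only: w_def)
  note est = infinite_order_vanishing_mult[OF vm wm _ _ _ \<sigma>(1) b(1) _ vp w2 wb van']
  have vwi: "integrable lebesgue (\<lambda>x. v x * w x)"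
    by (rule est(1)) (use R in \<open>auto simp: v_def w_def\<close>)
  have FB: "norm (F x) \<le> X * (v x * w x)" for x
  proof (cases "x \<in> ?B")
    case True
    have "norm (chi x) * (norm (V x) * norm (u x)) \<le> X * (norm (V x) * norm (u x))"
      by (intro mult_right_mono X) auto
    then show ?thesis using True by (simp add: F v_def w_def norm_mult mult.assoc)
  next
    case False
    then show ?thesis using chi0[OF False] X by (simp add: F v_def)
  qed
  have Fm: "F \<in> borel_measurable lebesgue"
  proof -
    have "F = (\<lambda>x. chi x * (indicator ?B x *\<^sub>R V x) * u x)"
      using chi0 by (auto simp: F split: split_indicator)
    then show ?thesis by (simp only:) (intro borel_measurable_times chim um Vm)
  qed
  show Fi: "integrable lebesgue F"
    using FB order_trans[OF FB abs_ge_self]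
    by (intro Bochner_Integration.integrable_bound[OF integrable_mult_right[OF vwi, of X] Fm] AE_I2) auto
  assume N: "N > 0"
  have "\<exists>C\<ge>0. \<forall>r>0. (LINT x|lebesgue. indicator (ball 0 r) x * (v x * w x)) \<le> C * r powr N"
    by (rule est(2)) (use R N in \<open>auto simp: v_def w_def\<close>)
  then obtain C where C: "C \<ge> 0" "\<And>r. r > 0 \<Longrightarrow> (LINT x|lebesgue. indicator (ball 0 r) x * (v x * w x)) \<le> C * r powr N"
    by blast
  have "(LINT x|lebesgue. indicator (ball 0 r) x * norm (F x)) \<le> (X * C) * r powr N" if r: "r > 0" for r
  proof -
    have [measurable]: "ball (0::real^'n) r \<in> sets lebesgue" by simp
    have m1: "(\<lambda>x. indicator (ball 0 r) x * norm (F x)) \<in> borel_measurable lebesgue"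
      and m2: "(\<lambda>x. indicator (ball 0 r) x * (v x * w x)) \<in> borel_measurable lebesgue"
      using Fm vm wm by measurable
    have i1: "integrable lebesgue (\<lambda>x. indicator (ball 0 r) x * norm (F x))"
      by (rule Bochner_Integration.integrable_bound[OF Fi m1]) (auto split: split_indicator)
    have i2: "integrable lebesgue (\<lambda>x. indicator (ball 0 r) x * (v x * w x))"
      by (rule Bochner_Integration.integrable_bound[OF vwi m2]) (auto split: split_indicator)
    have "(LINT x|lebesgue. indicator (ball 0 r) x * norm (F x)) \<le> (LINT x|lebesgue. X * (indicator (ball 0 r) x * (v x * w x)))"
      using FB by (intro integral_mono i1 integrable_mult_right i2) (auto split: split_indicator)
    also have "\<dots> = X * (LINT x|lebesgue. indicator (ball 0 r) x * (v x * w x))"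
      by (rule integral_mult_right_zero)
    also have "\<dots> \<le> X * (C * r powr N)"
      using C(2)[OF r] X by (intro mult_left_mono)
    finally show ?thesis by (simp add: mult.assoc)
  qed
  then show "\<exists>C\<ge>0. \<forall>r>0. (LINT x|lebesgue. indicator (ball 0 r) x * norm (F x)) \<le> C * r powr N"
    using X C by (intro exI[of _ "X * C"]) auto
qed

subsection \<open>Derivatives of the Riesz kernel\<close>

text \<open>With \<open>D r = |r x - y|\<^sup>2\<close> one has \<open>D' r = 2 x \<bullet> (r x - y)\<close> and \<open>D'' = 2 |x|\<^sup>2\<close>, so the \<open>j\<close>-th
  derivative of \<open>D powr \<gamma>\<close> is a combination of the terms \<open>(D'/2)\<^sup>a |x|\<^bsup>2i\<^esup> D powr (\<gamma> - a - i)\<close>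
  with \<open>a + 2 i = j\<close>.\<close>
inductive radial_jet :: "real \<Rightarrow> nat \<Rightarrow> ('a::euclidean_space \<Rightarrow> 'a \<Rightarrow> real \<Rightarrow> real) \<Rightarrow> bool"
  for \<gamma> :: real where
  monomial: "radial_jet \<gamma> (a + 2 * i) (\<lambda>x y r. (x \<bullet> (r *\<^sub>R x - y)) ^ a * (x \<bullet> x) ^ i *
    ((r *\<^sub>R x - y) \<bullet> (r *\<^sub>R x - y)) powr (\<gamma> - real a - real i))"
| scale: "radial_jet \<gamma> j G \<Longrightarrow> radial_jet \<gamma> j (\<lambda>x y r. c * G x y r)"
| add: "radial_jet \<gamma> j G \<Longrightarrow> radial_jet \<gamma> j H \<Longrightarrow> radial_jet \<gamma> j (\<lambda>x y r. G x y r + H x y r)"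

text \<open>Differentiating the power of the inner product sends the indices (a, i) to (a-1, i+1),
  differentiating the real power sends them to (a+1, i); either way \<open>a + 2 * i\<close> grows
  by one. Points with \<open>r *\<^sub>R x = y\<close> are excluded because the real power is
  singular there.\<close>

lemma radial_jet_deriv:
  fixes G :: "'a::euclidean_space \<Rightarrow> 'a \<Rightarrow> real \<Rightarrow> real"
  assumes "radial_jet \<gamma> j G"
  shows "\<exists>G'. radial_jet \<gamma> (Suc j) G' \<and>
    (\<forall>x y r. r *\<^sub>R x \<noteq> y \<longrightarrow> (G x y has_real_derivative G' x y r) (at r))"
  using assms
proof induction
  case (monomial a i)
  let ?T = "\<lambda>a i (x::'a) y r. (x \<bullet> (r *\<^sub>R x - y)) ^ a * (x \<bullet> x) ^ i *
    ((r *\<^sub>R x - y) \<bullet> (r *\<^sub>R x - y)) powr (\<gamma> - real a - real i)"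
  \<comment> \<open>For \<open>a = 0\<close> the truncated difference \<open>a - 1\<close> does no
    harm, since the coefficient \<open>real a\<close> vanishes.\<close>
  let ?G' = "\<lambda>x y r. real a * ?T (a - 1) (i + 1) x y r + 2 * (\<gamma> - real a - real i) * ?T (a + 1) i x y r"
  have "radial_jet \<gamma> (Suc (a + 2 * i)) (\<lambda>x y r. real a * ?T (a - 1) (i + 1) x y r)"
  proof (cases a)
    case 0
    show ?thesis
      using scale[OF radial_jet.monomial[of \<gamma> 1 i], of 0] by (simp add: 0)
  next
    case (Suc a')
    show ?thesis
      using scale[OF radial_jet.monomial[of \<gamma> a' "i + 1"], of "real a"] by (simp add: Suc)
  qed
  moreover have "radial_jet \<gamma> (Suc (a + 2 * i)) (\<lambda>x y r. 2 * (\<gamma> - real a - real i) * ?T (a + 1) i x y r)"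
    using scale[OF radial_jet.monomial[of \<gamma> "a + 1" i], of "2 * (\<gamma> - real a - real i)"] by simp
  ultimately have "radial_jet \<gamma> (Suc (a + 2 * i)) ?G'"
    by (rule add)
  moreover have "(?T a i x y has_real_derivative ?G' x y r) (at r)" if "r *\<^sub>R x \<noteq> y" for x y r
  proof -
    let ?e = "\<gamma> - real a - real i"
    let ?D = "\<lambda>r. (r *\<^sub>R x - y) \<bullet> (r *\<^sub>R x - y)" and ?D' = "\<lambda>r. x \<bullet> (r *\<^sub>R x - y)"
    have pos: "0 < ?D r" using that by simp
    have d1: "((\<lambda>r. ?D' r ^ a) has_real_derivative real a * ?D' r ^ (a - 1) * (x \<bullet> x)) (at r)"
      by (auto intro!: derivative_eq_intros simp: inner_diff_right)
    have "((?D) has_real_derivative 2 * ?D' r) (at r)"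
      unfolding inner_diff_right inner_diff_left inner_scaleR_left inner_scaleR_right
      by (auto intro!: derivative_eq_intros simp: inner_commute algebra_simps)
    then have "((\<lambda>r. ?D r powr ?e) has_real_derivative
        ?e * ?D r powr (?e - 1) * (2 * ?D' r)) (at r)"
      using DERIV_fun_powr[where g = "?D" and x = r and r = ?e, OF _ pos] by simp
    from DERIV_mult[OF DERIV_cmult_right[OF d1, of "(x \<bullet> x) ^ i"] this]
    have "(?T a i x y has_real_derivative
        real a * ?D' r ^ (a - 1) * (x \<bullet> x) * (x \<bullet> x) ^ i * ?D r powr ?e +
        ?e * ?D r powr (?e - 1) * (2 * ?D' r) *
        (?D' r ^ a * (x \<bullet> x) ^ i)) (at r)"
      by (simp only: mult.assoc)
    moreover have "real a * ?T (a - 1) (i + 1) x y r =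
        real a * ?D' r ^ (a - 1) * (x \<bullet> x) * (x \<bullet> x) ^ i * ?D r powr ?e"
      by (cases a) (auto simp: diff_diff_eq add_ac)
    moreover have "2 * ?e * ?T (a + 1) i x y r = ?e * ?D r powr (?e - 1) * (2 * ?D' r) *
        (?D' r ^ a * (x \<bullet> x) ^ i)"
    proof -
      have "\<gamma> - real (a + 1) - real i = ?e - 1" by simp
      then show ?thesis by (simp only: power_add power_one_right mult_ac)
    qed
    ultimately show ?thesis by (simp only:)
  qed
  ultimately show ?case by (intro exI[of _ ?G'] conjI allI impI)
next
  case (scale j G c)
  then obtain G' where "radial_jet \<gamma> (Suc j) G'"
    "\<And>x y r. r *\<^sub>R x \<noteq> y \<Longrightarrow> (G x y has_real_derivative G' x y r) (at r)" by blast
  then show ?case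
    by (intro exI[of _ "\<lambda>x y r. c * G' x y r"] conjI allI impI radial_jet.scale DERIV_cmult) auto
next
  case (add j G H)
  then obtain G' H' where "radial_jet \<gamma> (Suc j) G'" "radial_jet \<gamma> (Suc j) H'"
    "\<And>x y r. r *\<^sub>R x \<noteq> y \<Longrightarrow> (G x y has_real_derivative G' x y r) (at r)"
    "\<And>x y r. r *\<^sub>R x \<noteq> y \<Longrightarrow> (H x y has_real_derivative H' x y r) (at r)" by blast
  then show ?case
    by (intro exI[of _ "\<lambda>x y r. G' x y r + H' x y r"] conjI allI impI radial_jet.add DERIV_add) auto
qed

text \<open>By Cauchy-Schwarz a monomial is at most \<open>norm x\<close> to the power a + 2i times
  \<open>norm (r *\<^sub>R x - y)\<close> to the power a + 2(\<gamma> - a - i), and the latter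
  exponent is 2\<gamma> - (a + 2i).\<close>

lemma radial_jet_bound:
  fixes G :: "'a::euclidean_space \<Rightarrow> 'a \<Rightarrow> real \<Rightarrow> real"
  assumes "radial_jet \<gamma> j G"
  shows "\<exists>C\<ge>0. \<forall>x y r. r *\<^sub>R x \<noteq> y \<longrightarrow> \<bar>G x y r\<bar> \<le> C * norm x ^ j * norm (r *\<^sub>R x - y) powr (2 * \<gamma> - real j)"
  using assms
proof induction
  case (monomial a i)
  have "\<bar>(x \<bullet> (r *\<^sub>R x - y)) ^ a * (x \<bullet> x) ^ i * ((r *\<^sub>R x - y) \<bullet> (r *\<^sub>R x - y)) powr (\<gamma> - real a - real i)\<bar>
      \<le> 1 * norm x ^ (a + 2 * i) * norm (r *\<^sub>R x - y) powr (2 * \<gamma> - real (a + 2 * i))"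
    if "r *\<^sub>R x \<noteq> y" for x y :: 'a and r
  proof -
    let ?z = "r *\<^sub>R x - y"
    have N: "norm ?z > 0" using that by simp
    have "\<bar>x \<bullet> ?z\<bar> ^ a \<le> (norm x * norm ?z) ^ a"
      by (intro power_mono Cauchy_Schwarz_ineq2) auto
    then have "\<bar>(x \<bullet> ?z) ^ a * (x \<bullet> x) ^ i * (?z \<bullet> ?z) powr (\<gamma> - real a - real i)\<bar> \<le>
        (norm x * norm ?z) ^ a * (x \<bullet> x) ^ i * (?z \<bullet> ?z) powr (\<gamma> - real a - real i)"
      by (simp add: abs_mult power_abs mult_right_mono)
    also have "\<dots> = (norm x ^ a * norm ?z powr real a) * norm x ^ (2 * i) * norm ?z powr (2 * (\<gamma> - real a - real i))"
    proof -
      have "(x \<bullet> x) ^ i = norm x ^ (2 * i)"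
      by (simp add: power_mult power2_norm_eq_inner)
      moreover have "(?z \<bullet> ?z) powr (\<gamma> - real a - real i) = norm ?z powr (2 * (\<gamma> - real a - real i))"
      proof -
        have "?z \<bullet> ?z = norm ?z powr 2" using N by (simp add: power2_norm_eq_inner powr_numeral)
        then show ?thesis by (simp only: powr_powr)
      qed
      moreover have "(norm x * norm ?z) ^ a = norm x ^ a * norm ?z powr real a"
        using N by (simp add: power_mult_distrib powr_realpow)
      ultimately show ?thesis by (simp only:)
    qed
    also have "\<dots> = norm x ^ (a + 2 * i) * (norm ?z powr real a * norm ?z powr (2 * (\<gamma> - real a - real i)))"
      by (simp add: power_add)
    also have "norm ?z powr real a * norm ?z powr (2 * (\<gamma> - real a - real i)) = norm ?z powr (2 * \<gamma> - real (a + 2 * i))"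
      by (simp add: powr_add[symmetric] algebra_simps)
    finally show ?thesis by (simp only: mult_1_left)
  qed
  then show ?case by (intro exI[of _ 1]) (simp only: zero_le_one, blast)
next
  case (scale j G c)
  then obtain C where C: "C \<ge> 0" "\<And>x y r. r *\<^sub>R x \<noteq> y \<Longrightarrow> \<bar>G x y r\<bar> \<le> C * norm x ^ j * norm (r *\<^sub>R x - y) powr (2 * \<gamma> - real j)"
    by blast
  have "\<bar>c * G x y r\<bar> \<le> (\<bar>c\<bar> * C) * norm x ^ j * norm (r *\<^sub>R x - y) powr (2 * \<gamma> - real j)" if "r *\<^sub>R x \<noteq> y" for x y r
    using mult_left_mono[OF C(2)[OF that], of "\<bar>c\<bar>"] by (simp add: abs_mult mult.assoc)
  with C(1) show ?case by (intro exI[of _ "\<bar>c\<bar> * C"]) auto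
next
  case (add j G H)
  then obtain C C' where C: "C \<ge> 0" "\<And>x y r. r *\<^sub>R x \<noteq> y \<Longrightarrow> \<bar>G x y r\<bar> \<le> C * norm x ^ j * norm (r *\<^sub>R x - y) powr (2 * \<gamma> - real j)"
    and C': "C' \<ge> 0" "\<And>x y r. r *\<^sub>R x \<noteq> y \<Longrightarrow> \<bar>H x y r\<bar> \<le> C' * norm x ^ j * norm (r *\<^sub>R x - y) powr (2 * \<gamma> - real j)"
    by blast
  have "\<bar>G x y r + H x y r\<bar> \<le> (C + C') * norm x ^ j * norm (r *\<^sub>R x - y) powr (2 * \<gamma> - real j)" if "r *\<^sub>R x \<noteq> y" for x y r
    using C(2)[OF that] C'(2)[OF that] by (simp add: distrib_right)
  with C(1) C'(1) show ?case by (intro exI[of _ "C + C'"]) auto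
qed

text \<open>At \<open>r = 0\<close> the vector \<open>r *\<^sub>R x - y\<close> no longer involves
  \<open>x\<close>, which leaves a + 2i factors linear in \<open>x\<close>.\<close>

lemma radial_jet_homogeneous:
  assumes "radial_jet \<gamma> j G" shows "G (t *\<^sub>R x) y 0 = t ^ j * G x y 0"
  using assms
proof induction
  case (monomial a i)
  have "(t *\<^sub>R x) \<bullet> (0 *\<^sub>R (t *\<^sub>R x) - y) = t * (x \<bullet> (0 *\<^sub>R x - y))"
    "(t *\<^sub>R x) \<bullet> (t *\<^sub>R x) = t * (t * (x \<bullet> x))"
    "(0 *\<^sub>R (t *\<^sub>R x) - y) \<bullet> (0 *\<^sub>R (t *\<^sub>R x) - y) = (0 *\<^sub>R x - y) \<bullet> (0 *\<^sub>R x - y)"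
    by simp_all
  then show ?case
    by (simp only: power_mult_distrib power_add mult_2 mult_2_right mult_ac)
qed (simp_all add: algebra_simps)

lemma radial_jet_measurable:
  assumes "radial_jet \<gamma> j G" shows "(\<lambda>p. G (fst p) (snd p) 0) \<in> borel_measurable borel"
  using assms
proof induction
  case (monomial a i)
  have [measurable]: "(\<lambda>p :: 'a \<times> 'a. fst p \<bullet> (0 *\<^sub>R fst p - snd p)) \<in> borel_measurable borel"
    "(\<lambda>p :: 'a \<times> 'a. fst p \<bullet> fst p) \<in> borel_measurable borel"
    "(\<lambda>p :: 'a \<times> 'a. (0 *\<^sub>R fst p - snd p) \<bullet> (0 *\<^sub>R fst p - snd p)) \<in> borel_measurable borel"
    by (intro borel_measurable_continuous_onI continuous_intros)+
  show ?case by measurable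
next
  case (scale j G c)
  then show ?case by (intro borel_measurable_times borel_measurable_const)
next
  case (add j G H)
  then show ?case by (intro borel_measurable_add)
qed

text \<open>The parameter is \<open>\<beta> / 2\<close> because the kernel is a power of the squared
  distance. The sequence arises by dependent choice from \<open>radial_jet_deriv\<close> and gives
  closed forms for the iterated \<open>deriv\<close>.\<close>

lemma radial_jet_sequence:
  obtains G :: "nat \<Rightarrow> 'a::euclidean_space \<Rightarrow> 'a \<Rightarrow> real \<Rightarrow> real" where
    "\<And>j. radial_jet (\<beta> / 2) j (G j)"
    and "\<And>x y r. G 0 x y r = norm (r *\<^sub>R x - y) powr \<beta>"
    and "\<And>j x y r. r *\<^sub>R x \<noteq> y \<Longrightarrow> (G j x y has_real_derivative G (Suc j) x y r) (at r)"
    and "\<And>j x y r. r *\<^sub>R x \<noteq> y \<Longrightarrow> (deriv ^^ j) (\<lambda>r. norm (r *\<^sub>R x - y) powr \<beta>) r = G j x y r"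
proof -
  let ?P = "\<lambda>j G. radial_jet (\<beta> / 2) j G \<and> (j = 0 \<longrightarrow> G = (\<lambda>(x::'a) y r. norm (r *\<^sub>R x - y) powr \<beta>))"
  let ?Q = "\<lambda>j (G :: 'a \<Rightarrow> 'a \<Rightarrow> real \<Rightarrow> real) G'. \<forall>x y r. r *\<^sub>R x \<noteq> y \<longrightarrow> (G x y has_real_derivative G' x y r) (at r)"
  have "\<exists>G. \<forall>j. ?P j (G j) \<and> ?Q j (G j) (G (Suc j))"
  proof (rule dependent_nat_choice[where P = ?P and Q = ?Q])
    have "norm z powr \<beta> = (z \<bullet> z) powr (\<beta> / 2)" for z :: 'a
    proof -
      have "z \<bullet> z = norm z powr 2" by (simp add: power2_norm_eq_inner powr_numeral)
      then show ?thesis by (simp only: powr_powr) simp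
    qed
    then show "\<exists>G. ?P 0 G"
      using radial_jet.monomial[of "\<beta> / 2" 0 0, where 'a = 'a] by auto
    show "\<exists>G'. ?P (Suc j) G' \<and> ?Q j G G'" if "?P j G" for G j
      using radial_jet_deriv[of "\<beta> / 2" j G] that by auto
  qed
  then obtain G where G: "\<And>j. ?P j (G j)" and GD: "\<And>j. ?Q j (G j) (G (Suc j))" by blast
  have "(deriv ^^ j) (\<lambda>r. norm (r *\<^sub>R x - y) powr \<beta>) r = G j x y r" if "r *\<^sub>R x \<noteq> y" for j x y r
    using that
  proof (induction j arbitrary: r)
    case 0
    then show ?case using G[of 0] by simp
  next
    case (Suc j)
    \<comment> \<open>To differentiate once more, equality with \<open>G j\<close> must hold in a
      neighbourhood of \<open>r\<close> and not just at \<open>r\<close>.\<close>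
    have "open {r. r *\<^sub>R x \<noteq> y}"
      by (intro open_Collect_neq continuous_intros)
    then have "eventually (\<lambda>r. r *\<^sub>R x \<noteq> y) (nhds r)"
      using Suc.prems by (auto simp: eventually_nhds)
    then have "eventually (\<lambda>r. (deriv ^^ j) (\<lambda>r. norm (r *\<^sub>R x - y) powr \<beta>) r = G j x y r) (nhds r)"
      by eventually_elim (rule Suc.IH)
    then have "deriv ((deriv ^^ j) (\<lambda>r. norm (r *\<^sub>R x - y) powr \<beta>)) r = deriv (G j x y) r"
      by (rule deriv_cong_ev) simp
    also have "\<dots> = G (Suc j) x y r"
      using GD[of j] Suc.prems by (intro DERIV_imp_deriv) blast
    finally show ?case by simp
  qed
  moreover have "G 0 x y r = norm (r *\<^sub>R x - y) powr \<beta>" for x y r using G[of 0] by simp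
  ultimately show thesis using that[of G] G GD by blast
qed

text \<open>This reproduces the factor in the integrand of \<open>riesz_taylor\<close>. No estimate
  is made for it at \<open>y = 0\<close>; that point is discarded as a null set.\<close>

abbreviation riesz_jet :: "real \<Rightarrow> nat \<Rightarrow> 'a::euclidean_space \<Rightarrow> 'a \<Rightarrow> real" where
  "riesz_jet \<beta> j x y \<equiv> (deriv ^^ j) (\<lambda>r. norm (r *\<^sub>R x - y) powr \<beta>) 0"

lemma riesz_jet_homogeneous:
  fixes x y :: "'a::euclidean_space"
  assumes "y \<noteq> 0" shows "riesz_jet \<beta> j (t *\<^sub>R x) y = t ^ j * riesz_jet \<beta> j x y"
proof -
  obtain G :: "nat \<Rightarrow> 'a \<Rightarrow> 'a \<Rightarrow> real \<Rightarrow> real" where G: "\<And>j. radial_jet (\<beta> / 2) j (G j)"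
    "\<And>j x y r. r *\<^sub>R x \<noteq> y \<Longrightarrow> (deriv ^^ j) (\<lambda>r. norm (r *\<^sub>R x - y) powr \<beta>) r = G j x y r"
    by (rule radial_jet_sequence[of \<beta>]) blast
  from radial_jet_homogeneous[OF G(1)] show ?thesis
    using assms G(2)[of 0 x y j] G(2)[of 0 "t *\<^sub>R x" y j] by simp
qed

lemma riesz_jet_measurable:
  "(\<lambda>p. if snd p = 0 then 0 else riesz_jet \<beta> j (fst p) (snd p)) \<in> borel_measurable (borel :: ('a::euclidean_space \<times> 'a) measure)"
proof -
  obtain G :: "nat \<Rightarrow> 'a \<Rightarrow> 'a \<Rightarrow> real \<Rightarrow> real" where G: "\<And>j. radial_jet (\<beta> / 2) j (G j)"
    "\<And>j x y r. r *\<^sub>R x \<noteq> y \<Longrightarrow> (deriv ^^ j) (\<lambda>r. norm (r *\<^sub>R x - y) powr \<beta>) r = G j x y r"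
    by (rule radial_jet_sequence[of \<beta>]) blast
  note [measurable] = radial_jet_measurable[OF G(1)[of j]]
  have [measurable]: "(\<lambda>p::'a \<times> 'a. snd p) \<in> borel_measurable borel"
    by (intro borel_measurable_continuous_onI continuous_intros)
  have "(\<lambda>p. if snd p = 0 then 0 else riesz_jet \<beta> j (fst p) (snd p)) =
     (\<lambda>p. if snd p = 0 then 0 else G j (fst p) (snd p) 0)"
    using G(2)[of 0] by auto
  also have "\<dots> \<in> borel_measurable borel" by measurable
  finally show ?thesis .
qed

lemma riesz_jet_bound:
  obtains C where "C \<ge> 0"
    and "\<forall>x y :: 'a::euclidean_space. y \<noteq> 0 \<longrightarrow> \<bar>riesz_jet \<beta> j x y\<bar> \<le> C * norm x ^ j * norm y powr (\<beta> - real j)"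
proof -
  obtain G :: "nat \<Rightarrow> 'a \<Rightarrow> 'a \<Rightarrow> real \<Rightarrow> real" where G: "\<And>j. radial_jet (\<beta> / 2) j (G j)"
    "\<And>j x y r. r *\<^sub>R x \<noteq> y \<Longrightarrow> (deriv ^^ j) (\<lambda>r. norm (r *\<^sub>R x - y) powr \<beta>) r = G j x y r"
    by (rule radial_jet_sequence[of \<beta>]) blast
  obtain C where "C \<ge> 0" and C: "\<And>x y r. r *\<^sub>R x \<noteq> y \<Longrightarrow> \<bar>G j x y r\<bar> \<le> C * norm x ^ j * norm (r *\<^sub>R x - y) powr (2 * (\<beta> / 2) - real j)"
    using radial_jet_bound[OF G(1)[of j]] by blast
  moreover have "\<bar>riesz_jet \<beta> j x y\<bar> \<le> C * norm x ^ j * norm y powr (\<beta> - real j)" if "y \<noteq> 0" for x y :: 'a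
    using C[of 0 x y] G(2)[of 0 x y j] that by simp
  ultimately show thesis by (intro that[of C]) auto
qed

text \<open>For \<open>2 * norm x \<le> norm y\<close> the segment from 0 to \<open>x\<close> stays
  at distance at least \<open>norm y / 2\<close> from \<open>y\<close>, so Lagrange's form of the
  remainder applies along it. As \<open>\<beta> - real m\<close> is negative, the lower bound on the
  distance becomes an upper bound on the derivative.\<close>

lemma riesz_jet_remainder:
  assumes m: "m > 0" and \<beta>: "\<beta> \<le> 0"
  obtains C where "C \<ge> 0"
    and "\<forall>x y :: 'a::euclidean_space. y \<noteq> 0 \<longrightarrow> 2 * norm x \<le> norm y \<longrightarrow>
      \<bar>norm (x - y) powr \<beta> - (\<Sum>j<m. riesz_jet \<beta> j x y / fact j)\<bar> \<le> C * norm x ^ m * norm y powr (\<beta> - real m)"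
proof -
  obtain G :: "nat \<Rightarrow> 'a \<Rightarrow> 'a \<Rightarrow> real \<Rightarrow> real" where G: "\<And>j. radial_jet (\<beta> / 2) j (G j)"
    and G0: "\<And>x y r. G 0 x y r = norm (r *\<^sub>R x - y) powr \<beta>"
    and GD: "\<And>j x y r. r *\<^sub>R x \<noteq> y \<Longrightarrow> (G j x y has_real_derivative G (Suc j) x y r) (at r)"
    and Gd: "\<And>j x y r. r *\<^sub>R x \<noteq> y \<Longrightarrow> (deriv ^^ j) (\<lambda>r. norm (r *\<^sub>R x - y) powr \<beta>) r = G j x y r"
    by (rule radial_jet_sequence[of \<beta>]) blast
  obtain C where C0: "C \<ge> 0" and C: "\<And>x y r. r *\<^sub>R x \<noteq> y \<Longrightarrow> \<bar>G m x y r\<bar> \<le> C * norm x ^ m * norm (r *\<^sub>R x - y) powr (2 * (\<beta> / 2) - real m)"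
    using radial_jet_bound[OF G(1)[of m]] by blast
  let ?C = "C * (1 / 2) powr (\<beta> - real m) / fact m"
  have "\<bar>norm (x - y) powr \<beta> - (\<Sum>j<m. riesz_jet \<beta> j x y / fact j)\<bar> \<le> ?C * norm x ^ m * norm y powr (\<beta> - real m)"
    if y: "y \<noteq> 0" and xy: "2 * norm x \<le> norm y" for x y :: 'a
  proof -
    have far: "norm y / 2 \<le> norm (r *\<^sub>R x - y)" if "0 \<le> r" "r \<le> 1" for r
    proof -
      have "norm (r *\<^sub>R x) \<le> norm x" using that by (simp add: mult_left_le_one_le)
      moreover have "norm y - norm (r *\<^sub>R x) \<le> norm (y - r *\<^sub>R x)" by (rule norm_triangle_ineq2)
      ultimately show ?thesis using xy by (simp add: norm_minus_commute)
    qed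
    have ne: "r *\<^sub>R x \<noteq> y" if "0 \<le> r" "r \<le> 1" for r
    proof
      assume eq: "r *\<^sub>R x = y"
      show False using far[OF that] y unfolding eq by simp
    qed
    have "\<exists>t. 0 < t \<and> t < 1 \<and> G 0 x y 1 = (\<Sum>j<m. G j x y 0 / fact j * 1 ^ j) + G m x y t / fact m * 1 ^ m"
      using m ne GD by (intro Maclaurin) auto
    then obtain t where t: "0 < t" "t < 1" "G 0 x y 1 = (\<Sum>j<m. G j x y 0 / fact j) + G m x y t / fact m"
      by auto
    have "(\<Sum>j<m. riesz_jet \<beta> j x y / fact j) = (\<Sum>j<m. G j x y 0 / fact j)"
      using Gd[of 0 x y] y by simp
    then have "\<bar>norm (x - y) powr \<beta> - (\<Sum>j<m. riesz_jet \<beta> j x y / fact j)\<bar> = \<bar>G m x y t\<bar> / fact m"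
      using t(3) G0[of x y 1] by simp
    also have "\<dots> \<le> (C * norm x ^ m * norm (t *\<^sub>R x - y) powr (\<beta> - real m)) / fact m"
      using C[OF ne, of t] t by (intro divide_right_mono) auto
    also have "\<dots> \<le> (C * norm x ^ m * (norm y / 2) powr (\<beta> - real m)) / fact m"
      using far[of t] t y \<beta> C0 by (intro divide_right_mono mult_left_mono powr_mono2') auto
    also have "\<dots> = ?C * norm x ^ m * norm y powr (\<beta> - real m)"
      using powr_mult[of "1 / 2" "norm y" "\<beta> - real m"] by simp
    finally show ?thesis .
  qed
  with C0 show thesis by (intro that[of ?C]) auto
qed

subsection \<open>Vanishing of sums of homogeneous functions\<close>

text \<open>Under the measure with density \<open>norm (F y)\<close> the function
  \<open>inverse (norm y)\<close> exceeds \<open>t\<close> only on the ball of radius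
  \<open>1 / t\<close>, whose mass decays faster than any power of \<open>t\<close>. The weak type
  criterion with exponent \<open>b + 1\<close> then gives the moment of order
  \<open>b\<close>.\<close>

lemma integrable_negative_moment:
  fixes F :: "'a::euclidean_space \<Rightarrow> complex"
  assumes F: "integrable lebesgue F"
    and van: "\<And>N. N > 0 \<Longrightarrow> \<exists>C\<ge>0. \<forall>r>0. (LINT x|lebesgue. indicator (ball 0 r) x * norm (F x)) \<le> C * r powr N"
    and b: "b > 0"
  shows "integrable lebesgue (\<lambda>y. norm y powr (- b) * norm (F y))"
proof -
  let ?M = "density lebesgue (\<lambda>y. ennreal (norm (F y)))"
  have nm: "(\<lambda>y::'a. norm y) \<in> borel_measurable lebesgue"
    by (intro borel_measurable_continuous_lebesgue continuous_intros)
  note [measurable] = borel_measurable_integrable[OF F] nm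
  have Fn: "(\<integral>\<^sup>+ y. ennreal (norm (F y)) \<partial>lebesgue) < \<infinity>"
    using F by (simp add: integrable_iff_bounded)
  obtain C where C: "C \<ge> 0" "\<And>r. r > 0 \<Longrightarrow> (LINT x|lebesgue. indicator (ball 0 r) x * norm (F x)) \<le> C * r powr (b + 1)"
    using van[of "b + 1"] b by auto
  have [measurable]: "(\<lambda>y::'a. inverse (norm y)) \<in> borel_measurable lebesgue" by measurable
  have "(\<integral>\<^sup>+ y. ennreal (inverse (norm y) powr b) \<partial>?M) < \<infinity>"
  proof (rule nn_integral_powr_finite_if_weak_type[where q = "b + 1" and C = C])
    show "emeasure ?M (space ?M) < \<infinity>"
      using Fn by (subst emeasure_density) auto
    show "emeasure ?M {y \<in> space ?M. t < inverse (norm y)} \<le> ennreal (C * t powr (- (b + 1)))" if t: "t \<ge> 1" for t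
    proof -
      have Bs: "ball (0::'a) (1 / t) \<in> sets lebesgue" by simp
      have "emeasure ?M {y \<in> space ?M. t < inverse (norm y)} \<le> emeasure ?M (ball 0 (1 / t))"
      proof (rule emeasure_mono)
        show "{y \<in> space ?M. t < inverse (norm y)} \<subseteq> ball 0 (1 / t)"
        proof
          fix y assume "y \<in> {y \<in> space ?M. t < inverse (norm y)}"
          then have "t < inverse (norm y)" by simp
          moreover from this have "norm y > 0" using t by (cases "y = 0") auto
          ultimately show "y \<in> ball 0 (1 / t)" using t by (simp add: field_simps)
        qed
      qed simp
      also have "\<dots> = (\<integral>\<^sup>+ y. ennreal (norm (F y)) * indicator (ball 0 (1 / t)) y \<partial>lebesgue)"
        by (rule emeasure_density) (auto intro: Bs)
      also have "\<dots> = (\<integral>\<^sup>+ y. ennreal (indicator (ball 0 (1 / t)) y * norm (F y)) \<partial>lebesgue)"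
        by (intro nn_integral_cong) (auto split: split_indicator)
      also have "\<dots> = ennreal (LINT y|lebesgue. indicator (ball 0 (1 / t)) y * norm (F y))"
      proof (intro nn_integral_eq_integral Bochner_Integration.integrable_bound[OF F])
        show "(\<lambda>y. indicator (ball 0 (1 / t)) y * norm (F y)) \<in> borel_measurable lebesgue"
          using Bs by measurable
      qed (auto split: split_indicator)
      also have "\<dots> \<le> ennreal (C * (1 / t) powr (b + 1))"
        using t by (intro ennreal_leI C) simp
      also have "(1 / t) powr (b + 1) = t powr (- (b + 1))"
        using t by (simp only: powr_minus) (simp add: powr_divide divide_inverse inverse_powr)
      finally show ?thesis .
    qed
  qed (use b C in \<open>auto\<close>)
  then have "(\<integral>\<^sup>+ y. ennreal (norm (F y)) * ennreal (inverse (norm y) powr b) \<partial>lebesgue) < \<infinity>"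
    by (subst (asm) nn_integral_density) auto
  moreover have "ennreal (norm (F y)) * ennreal (inverse (norm y) powr b) = ennreal (norm (norm y powr (- b) * norm (F y)))" for y
  proof (cases "y = 0")
    case False
    then have "inverse (norm y) powr b = norm y powr (- b)" by (simp add: powr_minus inverse_powr)
    then show ?thesis by (simp add: ennreal_mult'[symmetric] abs_mult mult.commute)
  qed simp
  ultimately show ?thesis
    by (intro integrableI_bounded) auto
qed

text \<open>The same criterion for Lebesgue measure on a ball: superlevel sets of
  \<open>inverse (norm z)\<close> are contained in balls of volume proportional to
  \<open>t powr (- real DIM('a))\<close>, and \<open>- \<beta>\<close> is below the
  dimension.\<close>

lemma nn_integral_norm_powr_ball_finite:
  assumes \<beta>: "- real DIM('a) < \<beta>" "\<beta> < 0" and \<rho>: "\<rho> > 0"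
  shows "(\<integral>\<^sup>+ z. ennreal (norm (z :: 'a::euclidean_space) powr \<beta>) * indicator (ball 0 \<rho>) z \<partial>lebesgue) < \<infinity>"
proof -
  let ?B = "ball (0::'a) \<rho>" and ?\<omega> = "measure lebesgue (ball (0::'a) 1)"
  have nm: "(\<lambda>y::'a. norm y) \<in> borel_measurable lebesgue"
    by (intro borel_measurable_continuous_lebesgue continuous_intros)
  have "(\<integral>\<^sup>+ z. ennreal (inverse (norm z) powr (- \<beta>)) \<partial>lebesgue_on ?B) < \<infinity>"
  proof (rule nn_integral_powr_finite_if_weak_type[where q = "real DIM('a)" and C = ?\<omega>])
    show "(\<lambda>z. inverse (norm z)) \<in> borel_measurable (lebesgue_on ?B)"
      using nm by (intro measurable_restrict_space1 borel_measurable_inverse)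
    show "emeasure (lebesgue_on ?B) (space (lebesgue_on ?B)) < \<infinity>"
      using emeasure_lborel_ball_finite[of "0::'a" \<rho>] by (simp add: emeasure_restrict_space)
    show "emeasure (lebesgue_on ?B) {z \<in> space (lebesgue_on ?B). t < inverse (norm z)} \<le> ennreal (?\<omega> * t powr (- real DIM('a)))"
      if t: "t \<ge> 1" for t
    proof -
      have sub: "{z \<in> space (lebesgue_on ?B). t < inverse (norm z)} \<subseteq> ball 0 (1 / t)"
      proof
        fix z assume "z \<in> {z \<in> space (lebesgue_on ?B). t < inverse (norm z)}"
        then have "t < inverse (norm z)" by simp
        moreover from this have "norm z > 0" using t by (cases "z = 0") auto
        ultimately show "z \<in> ball 0 (1 / t)" using t by (simp add: field_simps)
      qed
      have "emeasure (lebesgue_on ?B) {z \<in> space (lebesgue_on ?B). t < inverse (norm z)} =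
          emeasure lebesgue {z \<in> space (lebesgue_on ?B). t < inverse (norm z)}"
        by (rule emeasure_restrict_space) auto
      also have "\<dots> \<le> emeasure lebesgue (ball (0::'a) (1 / t))"
        by (intro emeasure_mono sub) simp
      also have "\<dots> = ennreal (measure lebesgue (ball (0::'a) (1 / t)))"
        by (intro emeasure_eq_measure2) simp
      also have "measure lebesgue (ball (0::'a) (1 / t)) = (1 / t) ^ DIM('a) * ?\<omega>"
        using content_ball_conv_unit_ball[of "1 / t" "0::'a"] t by simp
      also have "\<dots> = ?\<omega> * t powr (- real DIM('a))"
        using t by (simp add: powr_minus powr_realpow power_inverse divide_inverse)
      finally show ?thesis .
    qed
  qed (use \<beta> in auto)
  then have "(\<integral>\<^sup>+ z. ennreal (inverse (norm z) powr (- \<beta>)) * indicator ?B z \<partial>lebesgue) < \<infinity>"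
    by (subst (asm) nn_integral_restrict_space) auto
  \<comment> \<open>At \<open>z = 0\<close> both sides are 0 by the conventions for
    \<open>inverse\<close> and \<open>powr\<close>.\<close>
  moreover have "inverse (norm z) powr (- \<beta>) = norm z powr \<beta>" for z :: 'a
    by (cases "z = 0") (auto simp: powr_minus inverse_powr)
  ultimately show ?thesis by simp
qed

lemma nn_integral_lborel_scale:
  fixes f :: "'a::euclidean_space \<Rightarrow> ennreal"
  assumes c: "c > 0" and [measurable]: "f \<in> borel_measurable borel"
  shows "(\<integral>\<^sup>+ x. f x \<partial>lborel) = ennreal (c ^ DIM('a)) * (\<integral>\<^sup>+ x. f (t + c *\<^sub>R x) \<partial>lborel)"
  using c by (subst lborel_affine[of c t]) (simp_all add: nn_integral_density nn_integral_distr nn_integral_cmult)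

text \<open>Rescaling turns the decay of the integral over \<open>ball 0 (r * \<rho>)\<close> into
  \<open>\<integral> |\<Sum>j. r ^ j * Q j| \<le> K * r ^ m\<close> on a fixed ball, which kills the \<open>Q j\<close> one after the other.\<close>
lemma homogeneous_sum_vanishes:
  fixes Q :: "nat \<Rightarrow> 'a::euclidean_space \<Rightarrow> complex"
  assumes Qm[measurable]: "\<And>j. j < m \<Longrightarrow> Q j \<in> borel_measurable borel"
    and hom: "\<And>j t x. j < m \<Longrightarrow> t > 0 \<Longrightarrow> Q j (t *\<^sub>R x) = of_real (t ^ j) * Q j x"
    and bdd: "\<And>j. j < m \<Longrightarrow> \<exists>B. \<forall>x\<in>ball 0 \<rho>. norm (Q j x) \<le> B"
    and \<rho>: "\<rho> > 0" and r0: "r0 > 0" and K: "K \<ge> 0"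
    and small: "\<And>r. 0 < r \<Longrightarrow> r < r0 \<Longrightarrow>
      (\<integral>\<^sup>+ x. ennreal (norm (\<Sum>j<m. Q j x)) * indicator (ball 0 (r * \<rho>)) x \<partial>lborel) \<le> ennreal (K * r ^ (DIM('a) + m))"
  shows "AE x in lborel. x \<in> ball 0 \<rho> \<longrightarrow> (\<Sum>j<m. Q j x) = 0"
proof -
  let ?B = "ball (0::'a) \<rho>"
  let ?N = "\<lambda>f. \<integral>\<^sup>+ x. ennreal (norm (f x :: complex)) * indicator ?B x \<partial>lborel"
  have [measurable]: "?B \<in> sets borel" by simp
  have Qs: "(\<lambda>x. \<Sum>j<m. of_real (c j) * Q j x) \<in> borel_measurable borel" for c
    by (intro borel_measurable_sum borel_measurable_times borel_measurable_const Qm) auto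
  have Q1: "(\<lambda>x. \<Sum>j<m. Q j x) \<in> borel_measurable borel"
    using Qs[of "\<lambda>_. 1"] by simp
  have ind: "(\<lambda>x. ennreal (norm (f x)) * indicator (ball (0::'a) c) x) \<in> borel_measurable borel"
    if "f \<in> borel_measurable borel" for f :: "'a \<Rightarrow> complex" and c
  proof -
    have [measurable]: "ball (0::'a) c \<in> sets borel" by simp
    show ?thesis using that by measurable
  qed
  have ind': "(\<lambda>x. ennreal (norm (f x)) * indicator (ball (0::'a) c) x) \<in> borel_measurable lborel"
    if "f \<in> borel_measurable borel" for f :: "'a \<Rightarrow> complex" and c
    using ind[OF that] by simp
  have Nfin: "?N (Q j) < \<infinity>" if j: "j < m" for j
  proof -
    obtain B where B: "\<And>x. x \<in> ?B \<Longrightarrow> norm (Q j x) \<le> B" using bdd[OF j] by blast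
    have "?N (Q j) \<le> (\<integral>\<^sup>+ x. ennreal B * indicator ?B x \<partial>lborel)"
      using B by (intro nn_integral_mono) (auto split: split_indicator intro: ennreal_leI)
    also have "\<dots> = ennreal B * emeasure lborel ?B" by (rule nn_integral_cmult_indicator) simp
    also have "\<dots> < \<infinity>" using emeasure_lborel_ball_finite[of "0::'a" \<rho>] by (simp add: ennreal_mult_less_top)
    finally show ?thesis .
  qed
  have scaled: "?N (\<lambda>x. \<Sum>j<m. of_real (r ^ j) * Q j x) \<le> ennreal (K * r ^ m)" if r: "0 < r" "r < r0" for r
  proof -
    \<comment> \<open>Homogeneity pulls the factor \<open>r ^ j\<close> out of \<open>Q j\<close>;
      the Jacobian \<open>r ^ DIM('a)\<close> then cancels against the same factor in the
      hypothesis.\<close>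
    have eq: "ennreal (norm (\<Sum>j<m. Q j (0 + r *\<^sub>R x))) * indicator (ball 0 (r * \<rho>)) (0 + r *\<^sub>R x) =
        ennreal (norm (\<Sum>j<m. of_real (r ^ j) * Q j x)) * indicator ?B x" for x
      using r by (simp add: hom indicator_def)
    have "ennreal (r ^ DIM('a)) * ?N (\<lambda>x. \<Sum>j<m. of_real (r ^ j) * Q j x) =
      (\<integral>\<^sup>+ x. ennreal (norm (\<Sum>j<m. Q j x)) * indicator (ball 0 (r * \<rho>)) x \<partial>lborel)"
      by (subst (2) nn_integral_lborel_scale[OF r(1), of _ 0]) (rule ind[OF Q1], simp only: eq)
    also have "\<dots> \<le> ennreal (K * r ^ (DIM('a) + m))" by (rule small[OF r])
    also have "\<dots> = ennreal (r ^ DIM('a)) * ennreal (K * r ^ m)"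
      using r K by (subst ennreal_mult[symmetric]) (auto simp: power_add mult_ac)
    finally show ?thesis
      using r by (subst (asm) ennreal_mult_le_mult_iff) auto
  qed
  have "AE x in lborel. x \<in> ?B \<longrightarrow> Q j x = 0" if "j < m" for j
    using that
  proof (induction j rule: less_induct)
    case (less j)
    note [measurable] = Qm[OF less.prems]
    have Qi: "(\<lambda>x. ennreal (r ^ Suc j) * (ennreal (norm (Q i x)) * indicator ?B x)) \<in> borel_measurable lborel"
      "(\<lambda>x. ennreal (norm (Q i x)) * indicator ?B x) \<in> borel_measurable lborel"
      if "i \<in> {j<..<m}" for i and r :: real
    proof -
      have [measurable]: "(\<lambda>x. ennreal (norm (Q i x)) * indicator ?B x) \<in> borel_measurable lborel"
        using ind[OF Qm[of i]] that by simp
      show "(\<lambda>x. ennreal (r ^ Suc j) * (ennreal (norm (Q i x)) * indicator ?B x)) \<in> borel_measurable lborel"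
        by measurable
      show "(\<lambda>x. ennreal (norm (Q i x)) * indicator ?B x) \<in> borel_measurable lborel"
        by fact
    qed
    have ae: "AE x in lborel. \<forall>i\<in>{..<j}. x \<in> ?B \<longrightarrow> Q i x = 0"
      using less by (intro AE_finite_allI) auto
    define S where "S = (\<Sum>i\<in>{j<..<m}. enn2real (?N (Q i)))"
    have S0: "S \<ge> 0" unfolding S_def by (intro sum_nonneg) simp
    \<comment> \<open>With the terms of index below \<open>j\<close> already known to vanish,
      \<open>r ^ j * Q j\<close> is the full sum minus terms of order \<open>r ^ Suc j\<close>. The
      full sum is itself \<open>O(r ^ Suc j)\<close> in the mean because \<open>j < m\<close>, so
      dividing by \<open>r ^ j\<close> leaves a factor \<open>r\<close>.\<close>
    have key: "?N (Q j) \<le> ennreal ((K + S) * r)" if r: "0 < r" "r < r0" "r \<le> 1" for r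
    proof -
      let ?t = "\<lambda>i x. ennreal (r ^ Suc j) * (ennreal (norm (Q i x)) * indicator ?B x)"
      have "ennreal (r ^ j) * ?N (Q j) = (\<integral>\<^sup>+ x. ennreal (norm (of_real (r ^ j) * Q j x)) * indicator ?B x \<partial>lborel)"
        using r by (subst nn_integral_cmult[symmetric]) (auto simp: norm_mult norm_power ennreal_mult mult.assoc)
      also have "\<dots> \<le> (\<integral>\<^sup>+ x. ennreal (norm (\<Sum>i<m. of_real (r ^ i) * Q i x)) * indicator ?B x +
          (\<Sum>i\<in>{j<..<m}. ?t i x) \<partial>lborel)"
      proof (rule nn_integral_mono_AE, use ae in eventually_elim)
        fix x assume z: "\<forall>i\<in>{..<j}. x \<in> ?B \<longrightarrow> Q i x = 0"
        show "ennreal (norm (of_real (r ^ j) * Q j x)) * indicator ?B x \<le>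
          ennreal (norm (\<Sum>i<m. of_real (r ^ i) * Q i x)) * indicator ?B x +
          (\<Sum>i\<in>{j<..<m}. ?t i x)"
        proof (cases "x \<in> ?B")
          case True
          let ?q = "\<lambda>i. of_real (r ^ i) * Q i x"
          have "{..<m} = {..<j} \<union> ({j} \<union> {j<..<m})" using less.prems by auto
          then have "sum ?q {..<m} = sum ?q ({..<j} \<union> ({j} \<union> {j<..<m}))" by (simp only:)
          also have "\<dots> = sum ?q {..<j} + sum ?q ({j} \<union> {j<..<m})"
            by (rule sum.union_disjoint) auto
          also have "sum ?q ({j} \<union> {j<..<m}) = ?q j + sum ?q {j<..<m}" by simp
          also have "sum ?q {..<j} = 0" using z True by (intro sum.neutral) auto
          finally have "?q j = sum ?q {..<m} - sum ?q {j<..<m}" by simp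
          then have "norm (?q j) \<le> norm (sum ?q {..<m}) + norm (sum ?q {j<..<m})"
            by (simp only: norm_triangle_ineq4)
          also have "norm (sum ?q {j<..<m}) \<le> (\<Sum>i\<in>{j<..<m}. r ^ Suc j * norm (Q i x))"
          proof (rule order_trans[OF norm_sum], rule sum_mono)
            fix i assume "i \<in> {j<..<m}"
            then have "r ^ i \<le> r ^ Suc j" using r by (intro power_decreasing) auto
            then show "norm (?q i) \<le> r ^ Suc j * norm (Q i x)"
              using r by (simp only: norm_mult norm_of_real) (simp add: mult_right_mono)
          qed
          finally have "ennreal (norm (?q j)) \<le> ennreal (norm (sum ?q {..<m}) + (\<Sum>i\<in>{j<..<m}. r ^ Suc j * norm (Q i x)))"
            by (intro ennreal_leI) simp
          also have "\<dots> = ennreal (norm (sum ?q {..<m})) + (\<Sum>i\<in>{j<..<m}. ennreal (r ^ Suc j) * ennreal (norm (Q i x)))"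
            using r by (subst ennreal_plus) (auto intro!: sum_nonneg simp: sum_ennreal[symmetric] ennreal_mult)
          finally show ?thesis using True by simp
        qed simp
      qed
      also have "\<dots> = ?N (\<lambda>x. \<Sum>i<m. of_real (r ^ i) * Q i x) +
          (\<integral>\<^sup>+ x. (\<Sum>i\<in>{j<..<m}. ?t i x) \<partial>lborel)"
        by (rule nn_integral_add) (rule ind'[OF Qs], intro borel_measurable_sum Qi)
      also have "(\<integral>\<^sup>+ x. (\<Sum>i\<in>{j<..<m}. ?t i x) \<partial>lborel) =
          (\<Sum>i\<in>{j<..<m}. \<integral>\<^sup>+ x. ?t i x \<partial>lborel)"
        by (rule nn_integral_sum) (rule Qi)
      also have "\<dots> = (\<Sum>i\<in>{j<..<m}. ennreal (r ^ Suc j) * ?N (Q i))"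
        by (intro sum.cong refl nn_integral_cmult Qi)
      also have "\<dots> = (\<Sum>i\<in>{j<..<m}. ennreal (r ^ Suc j * enn2real (?N (Q i))))"
        using r Nfin by (intro sum.cong refl) (auto simp: ennreal_mult less_top)
      also have "\<dots> = ennreal (r ^ Suc j * S)"
        unfolding S_def sum_distrib_left using r by (intro sum_ennreal) auto
      also have "?N (\<lambda>x. \<Sum>i<m. of_real (r ^ i) * Q i x) + ennreal (r ^ Suc j * S) \<le>
          ennreal (K * r ^ Suc j) + ennreal (r ^ Suc j * S)"
      proof (intro add_right_mono order_trans[OF scaled[OF r(1,2)]])
        show "ennreal (K * r ^ m) \<le> ennreal (K * r ^ Suc j)"
          using r less.prems K by (intro ennreal_leI mult_left_mono power_decreasing) auto
      qed
      also have "ennreal (K * r ^ Suc j) + ennreal (r ^ Suc j * S) = ennreal (r ^ j) * ennreal ((K + S) * r)"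
        using r K S0 by (simp add: ennreal_plus[symmetric] ennreal_mult[symmetric] algebra_simps del: ennreal_plus)
      finally show ?thesis
        using r by (subst (asm) ennreal_mult_le_mult_iff) auto
    qed
    \<comment> \<open>The left-hand side is independent of \<open>r\<close>, so letting
      \<open>r\<close> tend to 0 in \<open>key\<close> finishes the induction step.\<close>
    have "?N (Q j) \<le> 0"
    proof (rule tendsto_lowerbound)
      have "((\<lambda>r. ennreal ((K + S) * r)) \<longlongrightarrow> ennreal ((K + S) * 0)) (at_right 0)"
        by (intro tendsto_ennrealI tendsto_intros)
      then show "((\<lambda>r. ennreal ((K + S) * r)) \<longlongrightarrow> 0) (at_right 0)" by simp
      have "eventually (\<lambda>r. r \<in> {0<..<min r0 1}) (at_right 0)"
        using r0 by (intro eventually_at_right_real) auto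
      then show "eventually (\<lambda>r. ?N (Q j) \<le> ennreal ((K + S) * r)) (at_right 0)"
        by eventually_elim (rule key, auto)
    qed simp
    then have "?N (Q j) = 0" by simp
    then have "AE x in lborel. ennreal (norm (Q j x)) * indicator ?B x = 0"
      by (subst (asm) nn_integral_0_iff_AE) auto
    then show ?case by eventually_elim (auto split: split_indicator_asm)
  qed
  then have "AE x in lborel. \<forall>j\<in>{..<m}. x \<in> ?B \<longrightarrow> Q j x = 0"
    by (intro AE_finite_allI) auto
  then show ?thesis by eventually_elim (auto intro: sum.neutral)
qed

subsection \<open>The remainder of the Riesz potential\<close>

lemma riesz_const_pos:
  assumes "0 < \<alpha>" "\<alpha> < real n" shows "riesz_const n \<alpha> > 0"
  using assms unfolding riesz_const_def by (intro divide_pos_pos mult_pos_pos Gamma_real_pos) auto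

text \<open>In the near zone no cancellation is sought: the kernel itself is put on the right-hand
  side, and the Taylor terms obey the far-zone bound on their own, since there a power of
  \<open>norm y\<close> may be exchanged for one of \<open>2 * norm x\<close>.\<close>

lemma riesz_kernel_split:
  assumes m: "m > 0" and \<beta>: "\<beta> \<le> 0"
  obtains A where "A \<ge> 0"
    and "\<forall>x y :: 'a::euclidean_space. y \<noteq> 0 \<longrightarrow>
      \<bar>norm (x - y) powr \<beta> - (\<Sum>j<m. riesz_jet \<beta> j x y / fact j)\<bar> \<le>
      A * norm x ^ m * norm y powr (\<beta> - real m) + norm (x - y) powr \<beta> * indicator {y. norm y < 2 * norm x} y"
proof -
  have "\<exists>C. C \<ge> 0 \<and> (\<forall>x y :: 'a. y \<noteq> 0 \<longrightarrow> \<bar>riesz_jet \<beta> j x y\<bar> \<le> C * norm x ^ j * norm y powr (\<beta> - real j))" for j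
    by (rule riesz_jet_bound[where \<beta> = \<beta> and j = j and 'a = 'a]) blast
  then obtain C where C0: "\<And>j. C j \<ge> 0"
    and C: "\<And>j x y. y \<noteq> (0::'a) \<Longrightarrow> \<bar>riesz_jet \<beta> j x y\<bar> \<le> C j * norm x ^ j * norm y powr (\<beta> - real j)"
    by metis
  obtain D where D0: "D \<ge> 0" and D: "\<forall>x y :: 'a. y \<noteq> 0 \<longrightarrow> 2 * norm x \<le> norm y \<longrightarrow>
      \<bar>norm (x - y) powr \<beta> - (\<Sum>j<m. riesz_jet \<beta> j x y / fact j)\<bar> \<le> D * norm x ^ m * norm y powr (\<beta> - real m)"
    by (rule riesz_jet_remainder[OF m \<beta>])
  let ?S = "\<Sum>j<m. C j * 2 ^ (m - j) / fact j"
  have S0: "?S \<ge> 0" using C0 by (intro sum_nonneg) auto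
  have "\<bar>norm (x - y) powr \<beta> - (\<Sum>j<m. riesz_jet \<beta> j x y / fact j)\<bar> \<le>
      (D + ?S) * norm x ^ m * norm y powr (\<beta> - real m) + norm (x - y) powr \<beta> * indicator {y. norm y < 2 * norm x} y"
    if y: "y \<noteq> 0" for x y :: 'a
  proof (cases "2 * norm x \<le> norm y")
    case True
    have "D * norm x ^ m * norm y powr (\<beta> - real m) \<le> (D + ?S) * norm x ^ m * norm y powr (\<beta> - real m)"
      using S0 by (intro mult_right_mono) auto
    with D[rule_format, OF y True] True show ?thesis by simp
  next
    case False
    have tm: "\<bar>riesz_jet \<beta> j x y / fact j\<bar> \<le> C j * 2 ^ (m - j) / fact j * (norm x ^ m * norm y powr (\<beta> - real m))"
      if j: "j < m" for j
    proof -
      \<comment> \<open>The surplus \<open>norm y ^ (m - j)\<close> is traded for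
        \<open>(2 * norm x) ^ (m - j)\<close>; this is the origin of the powers of 2 in
        \<open>?S\<close>.\<close>
      have "norm y powr (\<beta> - real j) = norm y powr (\<beta> - real m) * norm y ^ (m - j)"
        using y j by (simp add: powr_realpow[symmetric] powr_add[symmetric] of_nat_diff)
      also have "\<dots> \<le> norm y powr (\<beta> - real m) * (2 * norm x) ^ (m - j)"
        using False by (intro mult_left_mono power_mono) auto
      finally have "norm x ^ j * norm y powr (\<beta> - real j) \<le> norm x ^ j * (norm y powr (\<beta> - real m) * (2 * norm x) ^ (m - j))"
        by (rule mult_left_mono) simp
      also have "\<dots> = 2 ^ (m - j) * ((norm x ^ j * norm x ^ (m - j)) * norm y powr (\<beta> - real m))"
        by (simp add: power_mult_distrib mult_ac)
      also have "norm x ^ j * norm x ^ (m - j) = norm x ^ m"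
        using j by (simp add: power_add[symmetric])
      finally have "C j * (norm x ^ j * norm y powr (\<beta> - real j)) \<le> C j * (2 ^ (m - j) * (norm x ^ m * norm y powr (\<beta> - real m)))"
        by (rule mult_left_mono) (rule C0)
      then have "\<bar>riesz_jet \<beta> j x y\<bar> \<le> C j * 2 ^ (m - j) * (norm x ^ m * norm y powr (\<beta> - real m))"
        using C[OF y, of j x] by (simp only: mult.assoc)
      then have "\<bar>riesz_jet \<beta> j x y\<bar> / fact j \<le> C j * 2 ^ (m - j) * (norm x ^ m * norm y powr (\<beta> - real m)) / fact j"
        by (rule divide_right_mono) simp
      then show ?thesis by simp
    qed
    have "\<bar>\<Sum>j<m. riesz_jet \<beta> j x y / fact j\<bar> \<le> (\<Sum>j<m. \<bar>riesz_jet \<beta> j x y / fact j\<bar>)"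
      by (rule sum_abs)
    also have "\<dots> \<le> (\<Sum>j<m. C j * 2 ^ (m - j) / fact j * (norm x ^ m * norm y powr (\<beta> - real m)))"
      by (intro sum_mono tm) simp
    also have "\<dots> = ?S * (norm x ^ m * norm y powr (\<beta> - real m))"
      by (simp only: sum_distrib_right)
    also have "\<dots> \<le> (D + ?S) * (norm x ^ m * norm y powr (\<beta> - real m))"
      using D0 by (intro mult_right_mono) auto
    finally have "\<bar>\<Sum>j<m. riesz_jet \<beta> j x y / fact j\<bar> \<le> (D + ?S) * norm x ^ m * norm y powr (\<beta> - real m)"
      by (simp only: mult.assoc)
    moreover have "norm (x - y) powr \<beta> * indicator {y. norm y < 2 * norm x} y = norm (x - y) powr \<beta>"
      using False by simp
    moreover have "0 \<le> norm (x - y) powr \<beta>" by simp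
    ultimately show ?thesis by linarith
  qed
  then show thesis using D0 S0 by (intro that[of "D + ?S"]) auto
qed

text \<open>Its values are extended reals because the integral may diverge at individual points
  \<open>x\<close>; this lets the remainder bound hold at every point.\<close>

definition near_potential :: "real \<Rightarrow> ('a::euclidean_space \<Rightarrow> complex) \<Rightarrow> 'a \<Rightarrow> ennreal" where
  "near_potential \<beta> F x =
    (\<integral>\<^sup>+ y. ennreal (norm (x - y) powr \<beta> * norm (F y)) * indicator {y. norm y < 2 * norm x} y \<partial>lebesgue)"

lemma near_kernel_measurable:
  fixes F :: "'a::euclidean_space \<Rightarrow> complex"
  assumes [measurable]: "F \<in> borel_measurable lebesgue"
  shows "(\<lambda>(x, y). ennreal (norm (x - y) powr \<beta> * norm (F y)) * indicator {y. norm y < 2 * norm x} y)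
    \<in> borel_measurable (lebesgue \<Otimes>\<^sub>M lebesgue)"
proof -
  have "continuous_on UNIV (\<lambda>p :: 'a \<times> 'a. norm (fst p - snd p))" by (intro continuous_intros)
  note [measurable] = borel_measurable_continuous_lebesgue_pair[OF this]
  have "open {p :: 'a \<times> 'a. norm (snd p) < 2 * norm (fst p)}"
    by (intro open_Collect_less continuous_intros)
  then have "(\<lambda>p :: 'a \<times> 'a. indicator {p. norm (snd p) < 2 * norm (fst p)} p :: ennreal) \<in> borel_measurable (lebesgue \<Otimes>\<^sub>M lebesgue)"
    by (intro borel_measurable_lebesgue_pair borel_measurable_indicator) auto
  note [measurable] = this
  have "(\<lambda>(x, y). ennreal (norm (x - y) powr \<beta> * norm (F y)) * indicator {y. norm y < 2 * norm x} y) =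
    (\<lambda>p. ennreal (norm (fst p - snd p) powr \<beta> * norm (F (snd p))) * indicator {p. norm (snd p) < 2 * norm (fst p)} p)"
    by (auto simp: fun_eq_iff split: split_indicator)
  also have "\<dots> \<in> borel_measurable (lebesgue \<Otimes>\<^sub>M lebesgue)" by measurable
  finally show ?thesis .
qed

lemma near_potential_measurable:
  assumes "F \<in> borel_measurable lebesgue"
  shows "near_potential \<beta> F \<in> borel_measurable lebesgue"
  unfolding near_potential_def[abs_def]
  by (rule lebesgue.borel_measurable_nn_integral[OF near_kernel_measurable[OF assms]])

text \<open>For \<open>norm x < r\<close> and \<open>norm y < 2 * norm x\<close> the point
  \<open>y\<close> lies in the ball of radius 2r and \<open>x - y\<close> in that of radius 3r.
  Tonelli and translation invariance then separate the kernel from \<open>F\<close>, so all decay in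
  \<open>r\<close> comes from the mass of \<open>F\<close>.\<close>

lemma nn_integral_near_potential_le:
  fixes F :: "'a::euclidean_space \<Rightarrow> complex"
  assumes F[measurable]: "F \<in> borel_measurable lebesgue" and r: "0 < r" "r \<le> \<rho>"
  shows "(\<integral>\<^sup>+ x. near_potential \<beta> F x * indicator (ball 0 r) x \<partial>lebesgue) \<le>
    (\<integral>\<^sup>+ z. ennreal (norm (z :: 'a) powr \<beta>) * indicator (ball 0 (3 * \<rho>)) z \<partial>lebesgue) *
    (\<integral>\<^sup>+ y. ennreal (indicator (ball 0 (2 * r)) y * norm (F y)) \<partial>lebesgue)"
proof -
  let ?k = "\<lambda>z :: 'a. ennreal (norm z powr \<beta>) * indicator (ball 0 (3 * \<rho>)) z"
  let ?g = "\<lambda>y. ennreal (indicator (ball 0 (2 * r)) y * norm (F y))"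
  have km: "?k \<in> borel_measurable borel"
  proof -
    have [measurable]: "ball (0::'a) (3 * \<rho>) \<in> sets borel" by simp
    show ?thesis by measurable
  qed
  have gm: "?g \<in> borel_measurable lebesgue"
  proof -
    have [measurable]: "ball (0::'a) (2 * r) \<in> sets lebesgue" by simp
    show ?thesis by measurable
  qed
  have kpm: "(\<lambda>p. ?k (fst p - snd p)) \<in> borel_measurable (lebesgue \<Otimes>\<^sub>M lebesgue)"
  proof (rule borel_measurable_lebesgue_pair, rule measurable_compose[OF _ km])
    show "(\<lambda>p. fst p - snd p) \<in> borel_measurable (borel :: ('a \<times> 'a) measure)"
      by (intro borel_measurable_continuous_onI continuous_intros)
  qed
  have pm: "(\<lambda>(x, y). ?k (x - y) * ?g y) \<in> borel_measurable (lebesgue \<Otimes>\<^sub>M lebesgue)"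
    using borel_measurable_times_ennreal[OF kpm measurable_compose[OF measurable_snd gm]]
    by (simp only: split_beta')
  have shift: "(\<integral>\<^sup>+ x. ?k (x - y) \<partial>lebesgue) = (\<integral>\<^sup>+ z. ?k z \<partial>lebesgue)" for y
  proof -
    have m: "(\<lambda>x. ?k (x - y)) \<in> borel_measurable borel"
      by (rule measurable_compose[OF _ km]) (intro borel_measurable_continuous_onI continuous_intros)
    have "(\<integral>\<^sup>+ x. ?k (x - y) \<partial>lborel) = ennreal (1 ^ DIM('a)) * (\<integral>\<^sup>+ z. ?k ((y + 1 *\<^sub>R z) - y) \<partial>lborel)"
      by (rule nn_integral_lborel_scale) (simp, rule m)
    then show ?thesis
      using m km by (simp add: nn_integral_completion)
  qed
  have "(\<integral>\<^sup>+ x. near_potential \<beta> F x * indicator (ball 0 r) x \<partial>lebesgue) \<le> (\<integral>\<^sup>+ x. \<integral>\<^sup>+ y. ?k (x - y) * ?g y \<partial>lebesgue \<partial>lebesgue)"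
  proof (rule nn_integral_mono)
    fix x :: 'a
    show "near_potential \<beta> F x * indicator (ball 0 r) x \<le> (\<integral>\<^sup>+ y. ?k (x - y) * ?g y \<partial>lebesgue)"
    proof (cases "x \<in> ball 0 r")
      case True
      have "near_potential \<beta> F x \<le> (\<integral>\<^sup>+ y. ?k (x - y) * ?g y \<partial>lebesgue)"
        unfolding near_potential_def
      proof (rule nn_integral_mono)
        fix y
        show "ennreal (norm (x - y) powr \<beta> * norm (F y)) * indicator {y. norm y < 2 * norm x} y \<le> ?k (x - y) * ?g y"
        proof (cases "norm y < 2 * norm x")
          case near: True
          have "norm (x - y) \<le> norm x + norm y" by (rule norm_triangle_ineq4)
          then have "x - y \<in> ball 0 (3 * \<rho>)" "y \<in> ball 0 (2 * r)"
            using near True r by auto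
          then show ?thesis using near by (simp add: ennreal_mult)
        qed simp
      qed
      then show ?thesis using True by simp
    qed simp
  qed
  also have "\<dots> = (\<integral>\<^sup>+ y. \<integral>\<^sup>+ x. ?k (x - y) * ?g y \<partial>lebesgue \<partial>lebesgue)"
    by (rule lebesgue_pair.Fubini'[OF pm, symmetric])
  also have "\<dots> = (\<integral>\<^sup>+ y. (\<integral>\<^sup>+ z. ?k z \<partial>lebesgue) * ?g y \<partial>lebesgue)"
  proof (intro nn_integral_cong)
    fix y :: 'a
    have m: "(\<lambda>x. ?k (x - y)) \<in> borel_measurable lebesgue"
      by (intro measurable_completion, simp, rule measurable_compose[OF _ km])
        (intro borel_measurable_continuous_onI continuous_intros)
    show "(\<integral>\<^sup>+ x. ?k (x - y) * ?g y \<partial>lebesgue) = (\<integral>\<^sup>+ z. ?k z \<partial>lebesgue) * ?g y"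
      using nn_integral_multc[OF m, of "?g y"] unfolding shift .
  qed
  also have "\<dots> = (\<integral>\<^sup>+ z. ?k z \<partial>lebesgue) * (\<integral>\<^sup>+ y. ?g y \<partial>lebesgue)"
    by (rule nn_integral_cmult[OF gm])
  finally show ?thesis .
qed

text \<open>The jet of order \<open>j\<close> is singular like
  \<open>norm y powr (\<beta> - real j)\<close>, and the negative moments of \<open>F\<close>
  compensate it. Measurability is stated for the Borel sigma-algebra because the homogeneity
  argument rescales Borel functions.\<close>

lemma riesz_jet_mult:
  fixes F :: "'a::euclidean_space \<Rightarrow> complex"
  assumes F: "integrable lebesgue F"
    and van: "\<And>N. N > 0 \<Longrightarrow> \<exists>C\<ge>0. \<forall>r>0. (LINT x|lebesgue. indicator (ball 0 r) x * norm (F x)) \<le> C * r powr N"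
    and \<beta>: "\<beta> < 0"
  shows "integrable lebesgue (\<lambda>y. riesz_jet \<beta> j x y *\<^sub>R F y)"
    and "(\<lambda>x. LINT y|lebesgue. riesz_jet \<beta> j x y *\<^sub>R F y) \<in> borel_measurable borel"
    and "(LINT y|lebesgue. riesz_jet \<beta> j (t *\<^sub>R x) y *\<^sub>R F y) = t ^ j *\<^sub>R (LINT y|lebesgue. riesz_jet \<beta> j x y *\<^sub>R F y)"
    and "\<exists>B. \<forall>x. norm (LINT y|lebesgue. riesz_jet \<beta> j x y *\<^sub>R F y) \<le> B * norm x ^ j"
proof -
  \<comment> \<open>Joint measurability is known only after resetting the value at
    \<open>y = 0\<close>, which changes no integral.\<close>
  let ?J = "\<lambda>x y. if y = 0 then 0 else riesz_jet \<beta> j x y"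
  note [measurable] = borel_measurable_integrable[OF F]
  have null: "emeasure lebesgue {z} = 0" "{z} \<in> sets lebesgue" for z :: 'a
    by (simp_all add: emeasure_lborel_singleton)
  have int_eq: "(LINT y|lebesgue. riesz_jet \<beta> j x y *\<^sub>R F y) = (LINT y|lebesgue. ?J x y *\<^sub>R F y)" for x
    by (rule integral_discrete_difference[of "{0}"]) (auto simp: null)
  have integrable_eq: "integrable lebesgue (\<lambda>y. riesz_jet \<beta> j x y *\<^sub>R F y) \<longleftrightarrow> integrable lebesgue (\<lambda>y. ?J x y *\<^sub>R F y)" for x
    by (rule integrable_discrete_difference[of "{0}"]) (auto simp: null)
  have Jm: "(\<lambda>(x, y). ?J x y *\<^sub>R F y) \<in> borel_measurable (borel \<Otimes>\<^sub>M lebesgue)"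
  proof -
    have "(\<lambda>x. x) \<in> borel_measurable (lebesgue :: 'a measure)"
      by (intro measurable_completion) simp
    then have "(\<lambda>p :: 'a \<times> 'a. (fst p, snd p)) \<in> measurable (borel \<Otimes>\<^sub>M lebesgue) (borel \<Otimes>\<^sub>M borel)"
      by (intro measurable_Pair measurable_fst measurable_compose[OF measurable_snd])
    moreover have "(\<lambda>p :: 'a \<times> 'a. ?J (fst p) (snd p)) \<in> borel_measurable (borel \<Otimes>\<^sub>M borel)"
      using riesz_jet_measurable[where \<beta> = \<beta> and j = j and 'a = 'a] by (simp only: borel_prod)
    ultimately have J': "(\<lambda>p :: 'a \<times> 'a. ?J (fst p) (snd p)) \<in> borel_measurable (borel \<Otimes>\<^sub>M lebesgue)"
      by (rule measurable_compose[of "\<lambda>p. (fst p, snd p)" _ _ "\<lambda>p. ?J (fst p) (snd p)", unfolded fst_conv snd_conv])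
    have "(\<lambda>p. F (snd p)) \<in> borel_measurable (borel \<Otimes>\<^sub>M lebesgue)" by measurable
    then have "(\<lambda>p. ?J (fst p) (snd p) *\<^sub>R F (snd p)) \<in> borel_measurable (borel \<Otimes>\<^sub>M lebesgue)"
      by (intro borel_measurable_scaleR J')
    then show ?thesis by (simp only: split_beta')
  qed
  obtain C where C0: "C \<ge> 0" and C: "\<forall>x y :: 'a. y \<noteq> 0 \<longrightarrow> \<bar>riesz_jet \<beta> j x y\<bar> \<le> C * norm x ^ j * norm y powr (\<beta> - real j)"
    by (rule riesz_jet_bound)
  have mom: "integrable lebesgue (\<lambda>y. norm y powr (\<beta> - real j) * norm (F y))"
    using integrable_negative_moment[OF F van, of "real j - \<beta>"] \<beta> by simp
  have bound: "norm (?J x y *\<^sub>R F y) \<le> C * norm x ^ j * (norm y powr (\<beta> - real j) * norm (F y))" for x y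
  proof (cases "y = 0")
    case False
    with C have "\<bar>riesz_jet \<beta> j x y\<bar> * norm (F y) \<le> C * norm x ^ j * norm y powr (\<beta> - real j) * norm (F y)"
      by (intro mult_right_mono) auto
    then show ?thesis using False by (simp add: mult.assoc)
  qed simp
  have Ji: "integrable lebesgue (\<lambda>y. ?J x y *\<^sub>R F y)" for x
  proof (rule Bochner_Integration.integrable_bound[OF integrable_mult_right[OF mom, of "C * norm x ^ j"]])
    show "(\<lambda>y. ?J x y *\<^sub>R F y) \<in> borel_measurable lebesgue"
      using measurable_Pair2[OF Jm, of x] by simp
    show "AE y in lebesgue. norm (?J x y *\<^sub>R F y) \<le> norm (C * norm x ^ j * (norm y powr (\<beta> - real j) * norm (F y)))"
      using order_trans[OF bound abs_ge_self] by (intro AE_I2) (simp only: real_norm_def)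
  qed
  then show "integrable lebesgue (\<lambda>y. riesz_jet \<beta> j x y *\<^sub>R F y)"
    by (simp only: integrable_eq)
  show "(\<lambda>x. LINT y|lebesgue. riesz_jet \<beta> j x y *\<^sub>R F y) \<in> borel_measurable borel"
    unfolding int_eq by (rule lebesgue.borel_measurable_lebesgue_integral[OF Jm])
  have "(LINT y|lebesgue. ?J (t *\<^sub>R x) y *\<^sub>R F y) = (LINT y|lebesgue. t ^ j *\<^sub>R (?J x y *\<^sub>R F y))"
  proof (intro Bochner_Integration.integral_cong refl)
    fix y
    show "?J (t *\<^sub>R x) y *\<^sub>R F y = t ^ j *\<^sub>R (?J x y *\<^sub>R F y)"
    proof (cases "y = 0")
      case False
      then show ?thesis by (simp only: riesz_jet_homogeneous[OF False] if_False scaleR_scaleR[symmetric])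
    qed simp
  qed
  also have "\<dots> = t ^ j *\<^sub>R (LINT y|lebesgue. ?J x y *\<^sub>R F y)"
    by (rule integral_scaleR_right)
  finally show "(LINT y|lebesgue. riesz_jet \<beta> j (t *\<^sub>R x) y *\<^sub>R F y) = t ^ j *\<^sub>R (LINT y|lebesgue. riesz_jet \<beta> j x y *\<^sub>R F y)"
    unfolding int_eq .
  have "norm (LINT y|lebesgue. riesz_jet \<beta> j x y *\<^sub>R F y) \<le>
      (C * (LINT y|lebesgue. norm y powr (\<beta> - real j) * norm (F y))) * norm x ^ j" for x
  proof -
    have "norm (LINT y|lebesgue. ?J x y *\<^sub>R F y) \<le> (LINT y|lebesgue. C * norm x ^ j * (norm y powr (\<beta> - real j) * norm (F y)))"
      by (intro Bochner_Integration.integral_norm_bound_integral Ji integrable_mult_right mom bound)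
    also have "\<dots> = C * norm x ^ j * (LINT y|lebesgue. norm y powr (\<beta> - real j) * norm (F y))"
      by (rule integral_mult_right_zero)
    finally show ?thesis unfolding int_eq by (simp only: mult_ac)
  qed
  then show "\<exists>B. \<forall>x. norm (LINT y|lebesgue. riesz_jet \<beta> j x y *\<^sub>R F y) \<le> B * norm x ^ j" by blast
qed

text \<open>Integrating \<open>riesz_kernel_split\<close> against \<open>F\<close>, the far part is
  a negative moment of \<open>F\<close> times \<open>norm x ^ m\<close> and the near part is
  \<open>near_potential\<close>.\<close>

lemma riesz_remainder_bound:
  fixes F :: "real ^ 'n::finite \<Rightarrow> complex"
  assumes F: "integrable lebesgue F"
    and van: "\<And>N. N > 0 \<Longrightarrow> \<exists>C\<ge>0. \<forall>r>0. (LINT x|lebesgue. indicator (ball 0 r) x * norm (F x)) \<le> C * r powr N"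
    and \<alpha>: "0 < \<alpha>" "\<alpha> < real CARD('n)" and m: "m > 0"
  obtains C where "C \<ge> 0"
    and "\<And>x. ennreal (norm (riesz_remainder \<alpha> m F x)) \<le>
      ennreal (C * norm x ^ m) + ennreal (riesz_const CARD('n) \<alpha>) * near_potential (\<alpha> - real CARD('n)) F x"
proof -
  let ?\<beta> = "\<alpha> - real CARD('n)" and ?c = "riesz_const CARD('n) \<alpha>"
  have c: "?c > 0" using riesz_const_pos[OF \<alpha>] .
  have \<beta>: "?\<beta> < 0" "?\<beta> \<le> 0" using \<alpha> by auto
  note Fm[measurable] = borel_measurable_integrable[OF F]
  obtain A where A0: "A \<ge> 0" and A: "\<forall>x y :: real^'n. y \<noteq> 0 \<longrightarrow>
      \<bar>norm (x - y) powr ?\<beta> - (\<Sum>j<m. riesz_jet ?\<beta> j x y / fact j)\<bar> \<le>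
      A * norm x ^ m * norm y powr (?\<beta> - real m) + norm (x - y) powr ?\<beta> * indicator {y. norm y < 2 * norm x} y"
    by (rule riesz_kernel_split[OF m \<beta>(2)])
  have mom: "integrable lebesgue (\<lambda>y. norm y powr (?\<beta> - real m) * norm (F y))"
    using integrable_negative_moment[OF F van, of "real m - ?\<beta>"] \<beta> by simp
  define W where "W = (LINT y|lebesgue. norm y powr (?\<beta> - real m) * norm (F y))"
  have W0: "W \<ge> 0" unfolding W_def by (intro integral_nonneg_AE) simp
  have "ennreal (norm (riesz_remainder \<alpha> m F x)) \<le>
      ennreal (?c * A * W * norm x ^ m) + ennreal ?c * near_potential ?\<beta> F x" for x
  proof (cases "near_potential ?\<beta> F x = \<infinity>")
    case True
    then show ?thesis using c by (simp add: ennreal_mult_eq_top_iff)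
  next
    case False
    let ?k = "\<lambda>y. norm (x - y) powr ?\<beta>"
    let ?S = "\<lambda>y. \<Sum>j<m. riesz_jet ?\<beta> j x y / fact j"
    let ?N = "{y :: real^'n. norm y < 2 * norm x}"
    let ?f = "\<lambda>y. indicator ?N y * (?k y * norm (F y))"
    let ?w = "\<lambda>y. A * norm x ^ m * (norm y powr (?\<beta> - real m) * norm (F y))"
    let ?d = "\<lambda>y. (?k y - ?S y) *\<^sub>R F y"
    let ?J = "\<lambda>j y. riesz_jet ?\<beta> j x y *\<^sub>R F y"
    have Nm[measurable]: "?N \<in> sets lebesgue"
    proof -
      have "open ?N" by (intro open_Collect_less continuous_intros)
      then show ?thesis by simp
    qed
    have km[measurable]: "?k \<in> borel_measurable lebesgue"
      by (intro measurable_completion) measurable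
    have Si: "integrable lebesgue (\<lambda>y. ?S y *\<^sub>R F y)"
    proof -
      have "?S y *\<^sub>R F y = (\<Sum>j<m. (1 / fact j) *\<^sub>R (?J j y))" for y
        by (simp add: scaleR_sum_left)
      then show ?thesis
        by (simp only:) (intro Bochner_Integration.integrable_sum integrable_scaleR_right riesz_jet_mult(1)[OF F van \<beta>(1)])
    qed
    have nearm: "(\<lambda>y. ?f y) \<in> borel_measurable lebesgue" by measurable
    have near: "integrable lebesgue (\<lambda>y. ?f y)"
    proof (rule integrableI_bounded[OF nearm])
      have "(\<integral>\<^sup>+ y. ennreal (norm (?f y)) \<partial>lebesgue) = near_potential ?\<beta> F x"
        unfolding near_potential_def by (intro nn_integral_cong) (auto split: split_indicator)
      then show "(\<integral>\<^sup>+ y. ennreal (norm (?f y)) \<partial>lebesgue) < \<infinity>"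
        using False by (simp add: less_top)
    qed
    have ae: "AE y in lebesgue. y \<noteq> (0 :: real^'n)"
      by (rule AE_I[of _ _ "{0}"]) (auto simp: emeasure_lborel_singleton)
    have pt: "AE y in lebesgue. norm (?d y) \<le>
        ?w y + ?f y"
      using ae
    proof eventually_elim
      case (elim y)
      from A elim have "\<bar>?k y - ?S y\<bar> \<le> A * norm x ^ m * norm y powr (?\<beta> - real m) + ?k y * indicator ?N y"
        by blast
      then have "\<bar>?k y - ?S y\<bar> * norm (F y) \<le> (A * norm x ^ m * norm y powr (?\<beta> - real m) + ?k y * indicator ?N y) * norm (F y)"
        by (rule mult_right_mono) simp
      then show ?case by (simp only: norm_scaleR) (simp add: algebra_simps)
    qed
    have Ui: "integrable lebesgue (\<lambda>y. ?w y + ?f y)"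
      by (intro Bochner_Integration.integrable_add integrable_mult_right mom near)
    have kSi: "integrable lebesgue (\<lambda>y. ?d y)"
    proof (rule Bochner_Integration.integrable_bound[OF Ui])
      have "(\<lambda>y. ?k y *\<^sub>R F y - ?S y *\<^sub>R F y) \<in> borel_measurable lebesgue"
        by (intro borel_measurable_diff borel_measurable_integrable[OF Si]) measurable
      then show "(\<lambda>y. ?d y) \<in> borel_measurable lebesgue"
        by (simp only: scaleR_diff_left)
      show "AE y in lebesgue. norm (?d y) \<le>
        norm (?w y + ?f y)"
        using pt by eventually_elim (rule order_trans, assumption, simp only: real_norm_def abs_ge_self)
    qed
    \<comment> \<open>The integrals of kernel and Taylor sum may be subtracted only once both
      converge; for the kernel this follows from the convergence for the difference and for the
      Taylor sum.\<close>
    have ki: "integrable lebesgue (\<lambda>y. ?k y *\<^sub>R F y)"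
      using Bochner_Integration.integrable_add[OF kSi Si] by (simp only: scaleR_diff_left diff_add_cancel)
    have idx: "{..m - 1} = {..<m}" using m by auto
    have "(LINT y|lebesgue. ?S y *\<^sub>R F y) = (\<Sum>j<m. (1 / fact j) *\<^sub>R (LINT y|lebesgue. ?J j y))"
    proof -
      have "?S y *\<^sub>R F y = (\<Sum>j<m. (1 / fact j) *\<^sub>R (?J j y))" for y
        by (simp add: scaleR_sum_left)
      then have "(LINT y|lebesgue. ?S y *\<^sub>R F y) = (LINT y|lebesgue. (\<Sum>j<m. (1 / fact j) *\<^sub>R (?J j y)))"
        by (simp only:)
      also have "\<dots> = (\<Sum>j<m. (LINT y|lebesgue. (1 / fact j) *\<^sub>R (?J j y)))"
        by (rule Bochner_Integration.integral_sum) (intro integrable_scaleR_right riesz_jet_mult(1)[OF F van \<beta>(1)])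
      finally show ?thesis by (simp only: integral_scaleR_right)
    qed
    then have "riesz_remainder \<alpha> m F x = ?c *\<^sub>R ((LINT y|lebesgue. ?k y *\<^sub>R F y) - (LINT y|lebesgue. ?S y *\<^sub>R F y))"
      unfolding riesz_remainder_def riesz_potential_def riesz_taylor_def idx by (simp only: scaleR_diff_right)
    also have "(LINT y|lebesgue. ?k y *\<^sub>R F y) - (LINT y|lebesgue. ?S y *\<^sub>R F y) = (LINT y|lebesgue. ?d y)"
      by (simp only: scaleR_diff_left Bochner_Integration.integral_diff[OF ki Si])
    finally have "norm (riesz_remainder \<alpha> m F x) = ?c * norm (LINT y|lebesgue. ?d y)"
      using c by simp
    also have "\<dots> \<le> ?c * (A * norm x ^ m * W + (LINT y|lebesgue. ?f y))"
    proof (intro mult_left_mono)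
      have "norm (LINT y|lebesgue. ?d y) \<le> (LINT y|lebesgue. norm (?d y))"
        by (rule integral_norm_bound)
      also have "\<dots> \<le> (LINT y|lebesgue. ?w y + ?f y)"
        by (rule integral_mono_AE[OF integrable_norm[OF kSi] Ui pt])
      also have "\<dots> = A * norm x ^ m * W + (LINT y|lebesgue. ?f y)"
        unfolding W_def by (subst Bochner_Integration.integral_add[OF integrable_mult_right[OF mom] near]) (simp only: integral_mult_right_zero)
      finally show "norm (LINT y|lebesgue. ?d y) \<le> A * norm x ^ m * W + (LINT y|lebesgue. ?f y)" .
    qed (use c in simp)
    finally have "ennreal (norm (riesz_remainder \<alpha> m F x)) \<le>
        ennreal (?c * A * W * norm x ^ m + ?c * (LINT y|lebesgue. ?f y))"
      by (intro ennreal_leI) (simp add: algebra_simps)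
    also have "\<dots> = ennreal (?c * A * W * norm x ^ m) + ennreal (?c * (LINT y|lebesgue. ?f y))"
      using c A0 W0 by (intro ennreal_plus mult_nonneg_nonneg integral_nonneg_AE) auto
    also have "ennreal (?c * (LINT y|lebesgue. ?f y)) = ennreal ?c * ennreal (LINT y|lebesgue. ?f y)"
      using c by (intro ennreal_mult') simp
    also have "ennreal (LINT y|lebesgue. ?f y) = (\<integral>\<^sup>+ y. ennreal (?f y) \<partial>lebesgue)"
      by (rule nn_integral_eq_integral[OF near, symmetric]) (auto intro!: AE_I2)
    also have "\<dots> = near_potential ?\<beta> F x"
      unfolding near_potential_def by (intro nn_integral_cong) (auto split: split_indicator)
    finally show ?thesis .
  qed
  moreover have "?c * A * W \<ge> 0" using c A0 W0 by simp
  ultimately show thesis by (intro that[of "?c * A * W"])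
qed

section \<open>Taylor terms as homogeneous functions, and the proof of the identity\<close>

lemma continuous_on_monomial_list:
  "continuous_on UNIV (\<lambda>x :: real ^ 'n::finite. complex_of_real (\<Prod>i\<leftarrow>is. x $ i))"
proof (induction "is")
  case (Cons i "is")
  have "continuous_on UNIV (\<lambda>x :: real ^ 'n. complex_of_real (x $ i))"
    by (intro continuous_intros)
  from continuous_on_mult[OF this Cons.IH] show ?case by simp
qed simp

lemma monomial_list_scaleR:
  "(\<Prod>i\<leftarrow>is. (t *\<^sub>R x :: real ^ 'n::finite) $ i) = t ^ length is * (\<Prod>i\<leftarrow>is. x $ i)"
  by (induction "is") auto

lemma abs_monomial_list_le:
  "\<bar>\<Prod>i\<leftarrow>is. (x :: real ^ 'n::finite) $ i\<bar> \<le> norm x ^ length is"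
  by (induction "is") (auto simp: abs_mult intro!: mult_mono component_le_norm_cart)

theorem lemma5p3:
  fixes \<Omega> :: "(real ^ 'n::finite) set"
    and V u chi F h :: "real ^ 'n \<Rightarrow> complex"
    and hr :: "nat \<Rightarrow> real ^ 'n \<Rightarrow> complex"
    and s \<alpha> R \<rho>\<^sub>0 H :: real
  assumes "CARD('n) \<ge> 3"
    and "0 < s" and "s < 1" and "\<alpha> = 2 * s"
    and "open \<Omega>" and "0 \<in> \<Omega>"
    and "Lp_loc (real CARD('n) / (2 * s)) \<Omega> V"
    and "sobolev_H s u"
    and "frac_laplacian_eq_on s \<Omega> u (\<lambda>x. V x * u x)"
    and "vanishes_infinite_order_L2 u"
    and "R > 0" and "closure (ball 0 (4 * R)) \<subseteq> \<Omega>"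
    and "test_function (ball 0 (3 * R)) chi" and "\<forall>x\<in>ball 0 (2 * R). chi x = 1"
    and "F = (\<lambda>x. chi x * V x * u x)"
    \<comment> \<open>\<open>h\<close> is the representative of \<open>u - I\<^sub>\<alpha> F\<close> that is real analytic near the origin\<close>
    and "AE x in lebesgue. h x = u x - riesz_potential \<alpha> F x"
    and "real_analytic_on h (ball 0 (2 * R))"
    and "0 < \<rho>\<^sub>0" and "\<rho>\<^sub>0 < R" and "H > 0"
    and "\<forall>m\<ge>1. \<forall>x\<in>ball 0 \<rho>\<^sub>0. h x = taylor_poly (m - 1) h x + hr m x"
    and "\<forall>m\<ge>1. \<forall>x\<in>ball 0 \<rho>\<^sub>0. norm (hr m x) \<le> H * \<rho>\<^sub>0 powi (- int m) * norm x ^ m"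
  shows "\<forall>m\<ge>1. AE x in lebesgue_on (ball 0 \<rho>\<^sub>0). u x = riesz_remainder \<alpha> m F x + hr m x"
proof (intro allI impI)
  fix m :: nat assume m: "m \<ge> 1"
  note n3 = assms(1) and s = assms(2,3) and \<alpha>s = assms(4) and van_u = assms(10) and h_eq = assms(16)
    and \<rho> = assms(18) and H = assms(20) and h_taylor = assms(21) and hr_le = assms(22)
  let ?n = "CARD('n)"
  let ?\<beta> = "\<alpha> - real ?n" and ?c = "riesz_const ?n \<alpha>"
  let ?\<omega> = "measure lebesgue (ball (0 :: real^'n) 1)"
  have \<alpha>: "0 < \<alpha>" "\<alpha> < real ?n" using s n3 \<alpha>s by auto
  have \<beta>: "- real ?n < ?\<beta>" "?\<beta> < 0" using \<alpha> by auto
  have c: "?c > 0" by (rule riesz_const_pos[OF \<alpha>])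
  note src = cutoff_source_estimates[OF assms(1,2,3,7,8,10,11,12,13,15)]
  note Fi = src(1) and van = src(2)
  have um[measurable]: "u \<in> borel_measurable lebesgue" and u2: "integrable lebesgue (\<lambda>x. (norm (u x))\<^sup>2)"
    using assms(8) by (auto simp: sobolev_H_def square_integrable_def)
  have idx: "{..m - 1} = {..<m}" using m by auto
  let ?L = "\<lambda>j x. \<Sum>is\<in>{is. length is = j}. iter_partial is h 0 * of_real (\<Prod>i\<leftarrow>is. x $ i)"
  let ?I = "\<lambda>j x. LINT y|lebesgue. riesz_jet ?\<beta> j x y *\<^sub>R F y"
  \<comment> \<open>The summand of degree \<open>j\<close> collects the Taylor term of
    \<open>h\<close> and that of the Riesz potential, so the sum over \<open>j < m\<close> is the
    polynomial part that must vanish.\<close>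
  define Q where "Q j x = (1 / fact j) * (?L j x)
      + ?c *\<^sub>R ((1 / fact j) *\<^sub>R (?I j x))" for j x
  have Q_sum: "(\<Sum>j<m. Q j x) = taylor_poly (m - 1) h x + riesz_taylor \<alpha> (m - 1) F x" for x
    unfolding Q_def taylor_poly_def riesz_taylor_def idx sum.distrib scaleR_sum_right ..
  note jet = riesz_jet_mult[OF Fi van \<beta>(2)]

  have Qm: "Q j \<in> borel_measurable borel" for j
  proof -
    have "(\<lambda>x :: real^'n. complex_of_real (\<Prod>i\<leftarrow>is. x $ i)) \<in> borel_measurable borel" for "is"
      by (rule borel_measurable_continuous_onI[OF continuous_on_monomial_list])
    then show ?thesis
      unfolding Q_def[abs_def]
      by (intro borel_measurable_add borel_measurable_times borel_measurable_sum borel_measurable_scaleR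
          borel_measurable_const jet(2))
  qed
  have Q_hom: "Q j (t *\<^sub>R x) = of_real (t ^ j) * Q j x" for j t x
  proof -
    have "(?L j (t *\<^sub>R x)) =
        (\<Sum>is\<in>{is. length is = j}. of_real (t ^ j) * (iter_partial is h 0 * of_real (\<Prod>i\<leftarrow>is. x $ i)))"
      by (intro sum.cong refl) (simp only: monomial_list_scaleR of_real_mult mult.left_commute mem_Collect_eq)
    also have "\<dots> = of_real (t ^ j) * (?L j x)"
      by (rule sum_distrib_left[symmetric])
    finally have S: "(?L j (t *\<^sub>R x)) =
        of_real (t ^ j) * (?L j x)" .
    have J: "(?I j (t *\<^sub>R x)) = t ^ j *\<^sub>R (?I j x)"
      by (rule jet(3))
    have "a * (of_real T * S) + c *\<^sub>R (b *\<^sub>R (T *\<^sub>R I)) = of_real T * (a * S + c *\<^sub>R (b *\<^sub>R I))"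
      for a S I :: complex and T b c :: real
      by (simp add: scaleR_conv_of_real algebra_simps)
    then show ?thesis unfolding Q_def S J .
  qed
  have Q_bdd: "\<exists>B. \<forall>x\<in>ball 0 \<rho>\<^sub>0. norm (Q j x) \<le> B" for j
  proof -
    obtain B where B: "\<And>x. norm (?I j x) \<le> B * norm x ^ j"
      using jet(4) by blast
    let ?T = "\<Sum>is\<in>{is. length is = j}. norm (iter_partial is h 0)"
    have "norm (Q j x) \<le> 1 / fact j * (?T * \<rho>\<^sub>0 ^ j) + ?c * (1 / fact j * (\<bar>B\<bar> * \<rho>\<^sub>0 ^ j))" if x: "x \<in> ball 0 \<rho>\<^sub>0" for x
    proof -
      have xj: "norm x ^ j \<le> \<rho>\<^sub>0 ^ j" using x by (intro power_mono) auto
      have "norm (?L j x) \<le>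
          (\<Sum>is\<in>{is. length is = j}. norm (iter_partial is h 0) * \<rho>\<^sub>0 ^ j)"
      proof (rule order_trans[OF norm_sum], rule sum_mono)
        fix "is" :: "'n list" assume "is \<in> {is. length is = j}"
        then have "\<bar>\<Prod>i\<leftarrow>is. x $ i\<bar> \<le> \<rho>\<^sub>0 ^ j"
          using abs_monomial_list_le[of x "is"] xj by simp
        then show "norm (iter_partial is h 0 * of_real (\<Prod>i\<leftarrow>is. x $ i)) \<le> norm (iter_partial is h 0) * \<rho>\<^sub>0 ^ j"
          unfolding norm_mult norm_of_real by (rule mult_left_mono) simp
      qed
      also have "\<dots> = ?T * \<rho>\<^sub>0 ^ j" by (rule sum_distrib_right[symmetric])
      finally have 1: "norm ((1 / fact j) * (?L j x)) \<le> 1 / fact j * (?T * \<rho>\<^sub>0 ^ j)"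
        by (simp add: norm_mult norm_divide divide_right_mono)
      have "norm (?I j x) \<le> \<bar>B\<bar> * \<rho>\<^sub>0 ^ j"
        using B[of x] mult_mono[OF abs_ge_self[of B] xj] by simp
      then have 2: "norm (?c *\<^sub>R ((1 / fact j) *\<^sub>R (?I j x))) \<le> ?c * (1 / fact j * (\<bar>B\<bar> * \<rho>\<^sub>0 ^ j))"
        using c by (simp add: divide_right_mono mult_left_mono)
      from norm_triangle_le[OF add_mono[OF 1 2]] show ?thesis unfolding Q_def .
    qed
    then show ?thesis by blast
  qed

  define H' where "H' = H * \<rho>\<^sub>0 powi (- int m)"
  have H0: "H' \<ge> 0" using H \<rho> by (simp add: H'_def)
  \<comment> \<open>The two expressions for \<open>h\<close>, its Taylor expansion and
    \<open>u\<close> minus the potential, are equated and solved for the polynomial part. The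
    identity inherits the exceptional null set of the second one.\<close>
  have Q_eq: "AE x in lebesgue. x \<in> ball 0 \<rho>\<^sub>0 \<longrightarrow> (\<Sum>j<m. Q j x) = u x - riesz_remainder \<alpha> m F x - hr m x"
    using h_eq
  proof eventually_elim
    case (elim x)
    show ?case
    proof
      assume x: "x \<in> ball 0 \<rho>\<^sub>0"
      then have "h x = taylor_poly (m - 1) h x + hr m x" using h_taylor m by blast
      with elim show "(\<Sum>j<m. Q j x) = u x - riesz_remainder \<alpha> m F x - hr m x"
        unfolding Q_sum riesz_remainder_def by (simp add: algebra_simps)
    qed
  qed

  obtain A where A0: "A \<ge> 0" and A: "\<And>x. ennreal (norm (riesz_remainder \<alpha> m F x)) \<le>
      ennreal (A * norm x ^ m) + ennreal ?c * near_potential ?\<beta> F x"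
    using riesz_remainder_bound[OF Fi van \<alpha>, of m] m by auto
  \<comment> \<open>A nonzero homogeneous term of degree \<open>j < m\<close> has integral of exact
    order n + j over small balls, so order n + m excludes all of them.\<close>
  let ?p = "real ?n + real m"
  obtain CF where CF: "CF \<ge> 0" "\<And>r. r > 0 \<Longrightarrow> (LINT x|lebesgue. indicator (ball 0 r) x * norm (F x)) \<le> CF * r powr ?p"
    using van[of ?p] m by auto
  \<comment> \<open>The additional \<open>real m\<close> makes up for the factor
    \<open>t powr (- real m)\<close> that is lost below in passing from the square of
    \<open>u\<close> to \<open>u\<close>.\<close>
  obtain Cu r1 where Cu: "Cu \<ge> 0" "r1 > 0" "\<And>r. 0 < r \<Longrightarrow> r < r1 \<Longrightarrow>
      (LINT x|lebesgue. indicator (ball 0 r) x * (norm (u x))\<^sup>2) \<le> Cu * r powr (?p + real m)"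
    using vanishes_infinite_order_L2D[OF van_u, of "?p + real m"] m by auto
  define Z where "Z = enn2real (\<integral>\<^sup>+ z. ennreal (norm (z :: real^'n) powr ?\<beta>) * indicator (ball 0 (3 * \<rho>\<^sub>0)) z \<partial>lebesgue)"
  have Z: "(\<integral>\<^sup>+ z. ennreal (norm (z :: real^'n) powr ?\<beta>) * indicator (ball 0 (3 * \<rho>\<^sub>0)) z \<partial>lebesgue) = ennreal Z"
    unfolding Z_def using nn_integral_norm_powr_ball_finite[where 'a = "real^'n", of ?\<beta> "3 * \<rho>\<^sub>0"] \<beta> \<rho> by simp
  have Z0: "Z \<ge> 0" by (simp add: Z_def)
  \<comment> \<open>The three groups are the pointwise bounds of order \<open>t ^ m\<close> times
    the volume of the ball, the mean square of \<open>u\<close>, and the near field. The factor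
    \<open>2 powr ?p\<close> appears because the near field sees \<open>F\<close> on the ball of
    radius \<open>2 * t\<close>.\<close>
  define K where "K = (1 + H' + A) * ?\<omega> + Cu + ?c * (Z * (CF * 2 powr ?p))"
  have K0: "K \<ge> 0" unfolding K_def using H0 A0 Cu CF Z0 c by (intro add_nonneg_nonneg mult_nonneg_nonneg) auto

  have Q_small: "(\<integral>\<^sup>+ x. ennreal (norm (\<Sum>j<m. Q j x)) * indicator (ball 0 t) x \<partial>lborel) \<le> ennreal (K * t ^ (?n + m))"
    if t: "0 < t" "t < r1" "t \<le> \<rho>\<^sub>0" for t
  proof -
    let ?B = "ball (0 :: real^'n) t"
    have [measurable]: "?B \<in> sets lebesgue" by simp
    have Bl: "?B \<in> lmeasurable" by simp
    have tp: "t ^ (?n + m) = t powr ?p" using t by (simp add: powr_realpow[symmetric])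
    have mB: "measure lebesgue ?B = t ^ ?n * ?\<omega>"
      using content_ball_conv_unit_ball[of t "0 :: real^'n"] t by simp
    let ?a = "t ^ m + H' * t ^ m + A * t ^ m"
    let ?w = "\<lambda>x. indicator ?B x * (norm (u x))\<^sup>2" and ?P = "\<lambda>x. near_potential ?\<beta> F x * indicator ?B x"
    let ?tw = "\<lambda>x. ennreal (t powr (- real m) * ?w x)" and ?g = "\<lambda>y. indicator (ball 0 (2 * t)) y * norm (F y)"
    have a0: "?a \<ge> 0" using t H0 A0 by simp
    note near_m[measurable] = near_potential_measurable[OF borel_measurable_integrable[OF Fi], of ?\<beta>]
    have "(\<integral>\<^sup>+ x. ennreal (norm (\<Sum>j<m. Q j x)) * indicator ?B x \<partial>lborel) =
        (\<integral>\<^sup>+ x. ennreal (norm (\<Sum>j<m. Q j x)) * indicator ?B x \<partial>lebesgue)"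
      by (rule nn_integral_completion[symmetric])
    also have "\<dots> \<le> (\<integral>\<^sup>+ x. ennreal ?a * indicator ?B x + ?tw x
        + ennreal ?c * (?P x) \<partial>lebesgue)"
    proof (rule nn_integral_mono_AE, use Q_eq in eventually_elim)
      fix x assume eq: "x \<in> ball 0 \<rho>\<^sub>0 \<longrightarrow> (\<Sum>j<m. Q j x) = u x - riesz_remainder \<alpha> m F x - hr m x"
      show "ennreal (norm (\<Sum>j<m. Q j x)) * indicator ?B x \<le> ennreal ?a * indicator ?B x +
          ?tw x + ennreal ?c * (?P x)"
      proof (cases "x \<in> ?B")
        case True
        then have x: "norm x < t" "x \<in> ball 0 \<rho>\<^sub>0" using t by auto
        have xm: "norm x ^ m \<le> t ^ m" using x by (intro power_mono) auto
        have tm: "t powr (- real m) = inverse (t ^ m)" using t by (simp add: powr_minus powr_realpow)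
        have tm0: "t ^ m > 0" using t by simp
        \<comment> \<open>Where \<open>norm (u x)\<close> exceeds \<open>t ^ m\<close>, it is at
          most its square divided by \<open>t ^ m\<close>. This converts the decay in mean square
          into decay in the mean.\<close>
        have ub: "norm (u x) \<le> t ^ m + t powr (- real m) * (norm (u x))\<^sup>2"
        proof (cases "norm (u x) \<le> t ^ m")
          case False
          then have "norm (u x) * t ^ m \<le> (norm (u x))\<^sup>2" by (simp add: power2_eq_square mult_left_mono)
          then have "norm (u x) \<le> inverse (t ^ m) * (norm (u x))\<^sup>2" using tm0 by (simp add: field_simps)
          then show ?thesis using tm0 unfolding tm by linarith
        qed (use tm0 in \<open>simp add: add_increasing2\<close>)
        have hb: "norm (hr m x) \<le> H' * t ^ m"
          using hr_le m x(2) mult_left_mono[OF xm H0] unfolding H'_def by (meson order_trans)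
        have "norm (u x - riesz_remainder \<alpha> m F x - hr m x) \<le> norm (u x) + norm (riesz_remainder \<alpha> m F x) + norm (hr m x)"
          by (meson add_right_mono norm_triangle_ineq4 order_trans)
        also have "\<dots> \<le> (t ^ m + H' * t ^ m + t powr (- real m) * (norm (u x))\<^sup>2) + norm (riesz_remainder \<alpha> m F x)"
          using ub hb by simp
        finally have "ennreal (norm (u x - riesz_remainder \<alpha> m F x - hr m x)) \<le>
            ennreal ((t ^ m + H' * t ^ m + t powr (- real m) * (norm (u x))\<^sup>2) + norm (riesz_remainder \<alpha> m F x))"
          by (rule ennreal_leI)
        also have "\<dots> = ennreal (t ^ m + H' * t ^ m + t powr (- real m) * (norm (u x))\<^sup>2) + ennreal (norm (riesz_remainder \<alpha> m F x))"
          using t H0 by (intro ennreal_plus) auto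
        also have "\<dots> \<le> ennreal (t ^ m + H' * t ^ m + t powr (- real m) * (norm (u x))\<^sup>2) +
            (ennreal (A * t ^ m) + ennreal ?c * near_potential ?\<beta> F x)"
          by (intro add_left_mono order_trans[OF A] add_right_mono ennreal_leI mult_left_mono xm A0)
        also have "\<dots> = ennreal (t ^ m + H' * t ^ m + t powr (- real m) * (norm (u x))\<^sup>2 + A * t ^ m) + ennreal ?c * near_potential ?\<beta> F x"
          using t H0 A0 by (subst (2) ennreal_plus) (auto simp: add.assoc)
        also have "t ^ m + H' * t ^ m + t powr (- real m) * (norm (u x))\<^sup>2 + A * t ^ m = ?a + t powr (- real m) * (norm (u x))\<^sup>2"
          by simp
        also have "ennreal (?a + t powr (- real m) * (norm (u x))\<^sup>2) = ennreal ?a + ennreal (t powr (- real m) * (norm (u x))\<^sup>2)"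
          using a0 by (intro ennreal_plus) auto
        finally show ?thesis using True eq x(2) by simp
      qed simp
    qed
    also have "\<dots> = (\<integral>\<^sup>+ x. ennreal ?a * indicator ?B x + ?tw x \<partial>lebesgue)
        + (\<integral>\<^sup>+ x. ennreal ?c * (?P x) \<partial>lebesgue)"
      by (rule nn_integral_add) measurable
    also have "(\<integral>\<^sup>+ x. ennreal ?a * indicator ?B x + ?tw x \<partial>lebesgue) =
        (\<integral>\<^sup>+ x. ennreal ?a * indicator ?B x \<partial>lebesgue) + (\<integral>\<^sup>+ x. ?tw x \<partial>lebesgue)"
      by (rule nn_integral_add) measurable
    also have "(\<integral>\<^sup>+ x. ennreal ?a * indicator ?B x \<partial>lebesgue) = ennreal (?a * (t ^ ?n * ?\<omega>))"
      using a0 emeasure_eq_measure2[OF Bl] t unfolding mB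
      by (subst nn_integral_cmult_indicator) (auto simp: ennreal_mult)
    also have "(\<integral>\<^sup>+ x. ?tw x \<partial>lebesgue) =
        ennreal (t powr (- real m) * (LINT x|lebesgue. ?w x))"
    proof -
      have m2: "(\<lambda>x. ?w x) \<in> borel_measurable lebesgue" by measurable
      have "integrable lebesgue (\<lambda>x. ?w x)"
        by (rule Bochner_Integration.integrable_bound[OF u2 m2]) (auto split: split_indicator)
      then have "(\<integral>\<^sup>+ x. ?tw x \<partial>lebesgue) =
          ennreal (LINT x|lebesgue. t powr (- real m) * (?w x))"
        by (intro nn_integral_eq_integral integrable_mult_right) auto
      then show ?thesis by (simp only: integral_mult_right_zero)
    qed
    also have "(\<integral>\<^sup>+ x. ennreal ?c * (?P x) \<partial>lebesgue) =
        ennreal ?c * (\<integral>\<^sup>+ x. ?P x \<partial>lebesgue)"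
      by (rule nn_integral_cmult) measurable
    also have "ennreal (?a * (t ^ ?n * ?\<omega>)) + ennreal (t powr (- real m) * (LINT x|lebesgue. ?w x)) +
        ennreal ?c * (\<integral>\<^sup>+ x. ?P x \<partial>lebesgue) \<le>
        ennreal ((1 + H' + A) * ?\<omega> * t powr ?p) + ennreal (Cu * t powr ?p) + ennreal (?c * (Z * (CF * 2 powr ?p)) * t powr ?p)"
    proof (intro add_mono ennreal_leI)
      have "?a * (t ^ ?n * ?\<omega>) = (1 + H' + A) * ?\<omega> * t ^ (?n + m)"
        by (simp add: power_add algebra_simps)
      then show "?a * (t ^ ?n * ?\<omega>) \<le> (1 + H' + A) * ?\<omega> * t powr ?p" unfolding tp by (rule eq_refl)
      have "t powr (- real m) * (LINT x|lebesgue. ?w x) \<le> t powr (- real m) * (Cu * t powr (?p + real m))"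
        using Cu(3)[OF t(1,2)] by (rule mult_left_mono) simp
      also have "\<dots> = Cu * (t powr (- real m) * t powr (?p + real m))" by simp
      also have "t powr (- real m) * t powr (?p + real m) = t powr ?p"
        by (simp add: powr_add[symmetric] add.commute)
      finally show "t powr (- real m) * (LINT x|lebesgue. ?w x) \<le> Cu * t powr ?p" .
      have B2[measurable]: "ball (0 :: real^'n) (2 * t) \<in> sets lebesgue" by simp
      have m3: "(\<lambda>y. ?g y) \<in> borel_measurable lebesgue"
        using borel_measurable_integrable[OF Fi] by measurable
      have "integrable lebesgue (\<lambda>y. ?g y)"
        by (rule Bochner_Integration.integrable_bound[OF Fi m3]) (auto split: split_indicator)
      then have "(\<integral>\<^sup>+ y. ennreal (?g y) \<partial>lebesgue) =
          ennreal (LINT y|lebesgue. ?g y)"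
        by (intro nn_integral_eq_integral) auto
      also have "\<dots> \<le> ennreal (CF * (2 * t) powr ?p)"
        using t by (intro ennreal_leI CF) simp
      also have "(2 * t) powr ?p = 2 powr ?p * t powr ?p" by (rule powr_mult)
      finally have FB: "(\<integral>\<^sup>+ y. ennreal (?g y) \<partial>lebesgue) \<le> ennreal (CF * (2 powr ?p * t powr ?p))" .
      have "(\<integral>\<^sup>+ x. ?P x \<partial>lebesgue) \<le>
          ennreal Z * (\<integral>\<^sup>+ y. ennreal (?g y) \<partial>lebesgue)"
        using nn_integral_near_potential_le[OF borel_measurable_integrable[OF Fi] t(1,3), of ?\<beta>] unfolding Z .
      also have "\<dots> \<le> ennreal Z * ennreal (CF * (2 powr ?p * t powr ?p))"
        by (intro mult_left_mono FB) simp
      finally have "ennreal ?c * (\<integral>\<^sup>+ x. ?P x \<partial>lebesgue) \<le>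
          ennreal ?c * (ennreal Z * ennreal (CF * (2 powr ?p * t powr ?p)))"
        by (intro mult_left_mono) auto
      also have "\<dots> = ennreal (?c * (Z * (CF * (2 powr ?p * t powr ?p))))"
        using c Z0 CF(1) by (simp add: ennreal_mult)
      also have "?c * (Z * (CF * (2 powr ?p * t powr ?p))) = ?c * (Z * (CF * 2 powr ?p)) * t powr ?p" by simp
      finally show "ennreal ?c * (\<integral>\<^sup>+ x. ?P x \<partial>lebesgue) \<le> ennreal (?c * (Z * (CF * 2 powr ?p)) * t powr ?p)" .
    qed
    also have "\<dots> = ennreal ((1 + H' + A) * ?\<omega> * t powr ?p + Cu * t powr ?p + ?c * (Z * (CF * 2 powr ?p)) * t powr ?p)"
    proof -
      have "0 \<le> (1 + H' + A) * ?\<omega> * t powr ?p" "0 \<le> Cu * t powr ?p" "0 \<le> ?c * (Z * (CF * 2 powr ?p)) * t powr ?p"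
        using H0 A0 Cu(1) c Z0 CF(1) by auto
      then show ?thesis by (simp only: ennreal_plus add_nonneg_nonneg)
    qed
    also have "(1 + H' + A) * ?\<omega> * t powr ?p + Cu * t powr ?p + ?c * (Z * (CF * 2 powr ?p)) * t powr ?p = K * t ^ (?n + m)"
      unfolding K_def tp by (simp only: distrib_right)
    finally show ?thesis .
  qed

  have "AE x in lborel. x \<in> ball 0 \<rho>\<^sub>0 \<longrightarrow> (\<Sum>j<m. Q j x) = 0"
  proof (rule homogeneous_sum_vanishes[OF Qm Q_hom Q_bdd \<rho>])
    \<comment> \<open>The radii here are \<open>r * \<rho>\<^sub>0\<close>, so threshold and
      constant are rescaled; \<open>r < 1\<close> keeps the ball inside the one where the expansion
      of \<open>h\<close> holds.\<close>
    show "min 1 (r1 / \<rho>\<^sub>0) > 0" using Cu(2) \<rho> by simp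
    show "K * \<rho>\<^sub>0 ^ (?n + m) \<ge> 0" using K0 \<rho> by simp
    fix r assume r: "0 < r" "r < min 1 (r1 / \<rho>\<^sub>0)"
    then have "0 < r * \<rho>\<^sub>0" "r * \<rho>\<^sub>0 < r1" "r * \<rho>\<^sub>0 \<le> \<rho>\<^sub>0"
      using \<rho> by (auto simp: field_simps)
    from Q_small[OF this] show "(\<integral>\<^sup>+ x. ennreal (norm (\<Sum>j<m. Q j x)) * indicator (ball 0 (r * \<rho>\<^sub>0)) x \<partial>lborel) \<le>
        ennreal (K * \<rho>\<^sub>0 ^ (?n + m) * r ^ (DIM(real^'n) + m))"
      by (simp add: power_mult_distrib mult_ac)
  qed
  then have "AE x in lebesgue. x \<in> ball 0 \<rho>\<^sub>0 \<longrightarrow> (\<Sum>j<m. Q j x) = 0"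
    by (rule AE_completion)
  with Q_eq have "AE x in lebesgue. x \<in> ball 0 \<rho>\<^sub>0 \<longrightarrow> u x = riesz_remainder \<alpha> m F x + hr m x"
    by eventually_elim (auto simp: algebra_simps)
  then show "AE x in lebesgue_on (ball 0 \<rho>\<^sub>0). u x = riesz_remainder \<alpha> m F x + hr m x"
    by (subst AE_restrict_space_iff) auto
qed

end
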